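(* Assume the Hausdorff dimension $Q(m)$ takes the same value $\bm Q$ at every point $m$ of the equiregular region $M\setminus\mathcal Z$. Then, as $h\to0^+$, the densities $h^{\bm Q-d}\,\mathrm{dvol}_{g^h}$ converge to Popp's volume $\mathcal P$ uniformly on every compact subset $K\subset M\setminus\mathcal Z$; that is, for any fixed smooth positive density $\mu$ on $M$, the functions $h^{\bm Q-d}\,\mathrm{dvol}_{g^h}/\mu$ converge uniformly on $K$ to $\mathcal P/\mu$.
   Context: Let $M$ be a smooth connected orientable manifold of dimension $d$ and $X^{01},\dots,X^{0N_0}$ smooth vector fields on $M$. Set $\mathcal D_0(m)=\mathrm{span}\{X^{01}_m,\dots,X^{0N_0}_m\}$ and $\mathcal D_{i+1}=\mathcal D_i+[\mathcal D_0,\mathcal D_i]$. Assume that for each $m$ there is a smallest integer $r(m)$ with $\mathcal D_{r(m)}(m)=T_mM$ and that $\bm r:=\max_{m\in M}r(m)$ exists. Let $n_i(m)=\dim\mathcal D_i(m)$ ($0\le i\le\bm r$), $n_{-1}=0$. A point is equiregular if $(n_i)_i$ is locally constant near it; $\mathcal Z$ denotes the set of non-equiregular (singular) points. The Hausdorff dimension at $m$ is $Q(m)=\sum_{i=0}^{\bm r}(i+1)(n_i(m)-n_{i-1}(m))$. For $k\ge1$ and $I=(i_1,\dots,i_{k+1})\in\{1,\dots,N_0\}^{k+1}$ let $X_I=[X^{0i_1},[X^{0i_2},[\cdots,[X^{0i_k},X^{0i_{k+1}}]\cdots]]]$; let $\mathcal C_k$ be the set of such $I$ with $X_I\not\equiv0$,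 $N_k=\#\mathcal C_k$, and, for a fixed enumeration $I_1,\dots,I_{N_k}$ of $\mathcal C_k$, put $X^{kj}=X_{I_j}$. Let $N=\sum_{i=0}^{\bm r}N_i$, write $\mathbf u=(u_{ij})_{0\le i\le\bm r,\,1\le j\le N_i}\in\mathbb R^N$, $\sigma_m(\mathbf u)=\sum_{i,j}u_{ij}X^{ij}_m$, and $\delta_h\mathbf u=(h^{-i}u_{ij})_{i,j}$. For $h>0$ the Riemannian metric $g^h$ is given (as a quadratic form) by $g^h_m(X)=\inf\{|\delta_h\mathbf u|^2:\mathbf u\in\mathbb R^N,\ \sigma_m(\mathbf u)=X\}$, and $\mathrm{dvol}_{g^h}$ is its Riemannian density. The sub-Riemannian metric is $g^0_m(X)=\inf\{\sum_{j=1}^{N_0}u_j^2:\sum_j u_jX^{0j}_m=X\}$ (infimum of the empty set $=+\infty$). Popp's volume on $M\setminus\mathcal Z$: near an equiregular $m$ take an adapted frame, i.e. a local frame $Z_1,\dots,Z_d$ such that for every $i$, $Z_1,\dots,Z_{n_i}$ is a local frame of $\mathcal D_i$ and $Z_1,\dots,Z_{n_0}$ are orthonormal for $g^0$ near $m$. For $1\le j\le\bm r$ and $i_1,\dots,i_{j+1}\in\{1,\dots,n_0\}$ define $b^l_{i_1\dots i_{j+1}}$ by $[Z_{i_1},[Z_{i_2},\dots,[Z_{i_j},Z_{i_{j+1}}]\dots]]=\sum_{l=n_{j-1}+1}^{n_j}b^l_{i_1\dots i_{j+1}}Z_l \bmod \mathcal D_{j-1}$, and let $B_j$ be the $(n_j-n_{j-1})$-square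 matrix $[B_j]^{kl}=\sum_{i_1,\dots,i_{j+1}=1}^{n_0}b^k_{i_1\dots i_{j+1}}b^l_{i_1\dots i_{j+1}}$; $B_0=I_{n_0}$ (and $\det B_j=1$ if $n_j=n_{j-1}$). With $\nu_1,\dots,\nu_d$ the dual coframe, $\mathcal P=(\prod_{j}\det B_j)^{-1/2}|\nu_1\wedge\dots\wedge\nu_d|$. *)

theory Defs
  imports "HOL-Analysis.Analysis"
begin

fun smooth_k :: "nat \<Rightarrow> 'a::euclidean_space set \<Rightarrow> ('a \<Rightarrow> 'b::euclidean_space) \<Rightarrow> bool" where
  "smooth_k 0 U f = continuous_on U f"
| "smooth_k (Suc k) U f =
     (f differentiable_on U \<and> (\<forall>v. smooth_k k U (\<lambda>x. frechet_derivative f (at x) v)))"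

definition smooth_on :: "'a::euclidean_space set \<Rightarrow> ('a \<Rightarrow> 'b::euclidean_space) \<Rightarrow> bool" where
  "smooth_on U f \<longleftrightarrow> (\<forall>k. smooth_k k U f)"

type_synonym ('a, 'n) chart = "'a set \<times> ('a \<Rightarrow> real^'n)"

definition tmap :: "('a, 'n) chart \<Rightarrow> ('a, 'n) chart \<Rightarrow> real^'n \<Rightarrow> real^'n" where
  "tmap c c' = snd c' \<circ> the_inv_into (fst c) (snd c)"

definition smooth_atlas :: "('a::topological_space, 'n::finite) chart set \<Rightarrow> bool" where
  "smooth_atlas A \<longleftrightarrow>
     \<Union>(fst ` A) = UNIV \<and>
     (\<forall>c\<in>A. open (fst c) \<and> open (snd c ` fst c) \<and>
              (\<exists>\<psi>. homeomorphism (fst c) (snd c ` fst c) (snd c) \<psi>)) \<and>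
     (\<forall>c\<in>A. \<forall>c'\<in>A. smooth_on (snd c ` (fst c \<inter> fst c')) (tmap c c'))"

definition jac_det :: "('a, 'n::finite) chart \<Rightarrow> ('a, 'n) chart \<Rightarrow> 'a \<Rightarrow> real" where
  "jac_det c c' m = det (matrix (frechet_derivative (tmap c c') (at (snd c m))))"

definition orientable :: "('a::topological_space, 'n::finite) chart set \<Rightarrow> bool" where
  "orientable A \<longleftrightarrow> (\<exists>A'. smooth_atlas (A \<union> A') \<and> \<Union>(fst ` A') = UNIV \<and>
       (\<forall>c\<in>A'. \<forall>c'\<in>A'. \<forall>m\<in>fst c \<inter> fst c'. jac_det c c' m > 0))"

text \<open>A smooth vector field given by its coordinate expressions in all charts.\<close>
definition smooth_vf :: "('a, 'n::finite) chart set \<Rightarrow> (('a, 'n) chart \<Rightarrow> real^'n \<Rightarrow> real^'n) \<Rightarrow> bool" where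
  "smooth_vf A Y \<longleftrightarrow>
     (\<forall>c\<in>A. smooth_on (snd c ` fst c) (Y c)) \<and>
     (\<forall>c\<in>A. \<forall>c'\<in>A. \<forall>m\<in>fst c \<inter> fst c'.
        Y c' (snd c' m) = frechet_derivative (tmap c c') (at (snd c m)) (Y c (snd c m)))"

text \<open>A smooth positive density: in chart c it is rho c times Lebesgue density.\<close>
definition smooth_pos_density :: "('a, 'n::finite) chart set \<Rightarrow> (('a, 'n) chart \<Rightarrow> real^'n \<Rightarrow> real) \<Rightarrow> bool" where
  "smooth_pos_density A \<rho> \<longleftrightarrow>
     (\<forall>c\<in>A. smooth_on (snd c ` fst c) (\<rho> c) \<and> (\<forall>p\<in>snd c ` fst c. \<rho> c p > 0)) \<and>
     (\<forall>c\<in>A. \<forall>c'\<in>A. \<forall>m\<in>fst c \<inter> fst c'.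
        \<rho> c (snd c m) = \<rho> c' (snd c' m) * \<bar>jac_det c c' m\<bar>)"

definition chart_at :: "('a, 'n) chart set \<Rightarrow> 'a \<Rightarrow> ('a, 'n) chart" where
  "chart_at A m = (SOME c. c \<in> A \<and> m \<in> fst c)"

definition cbr :: "(real^'n \<Rightarrow> real^'n) \<Rightarrow> (real^'n \<Rightarrow> real^'n) \<Rightarrow> real^'n \<Rightarrow> real^'n" where
  "cbr Y W p = frechet_derivative W (at p) (Y p) - frechet_derivative Y (at p) (W p)"

text \<open>Right-nested iterated bracket X_I, I = [i1,...,i_(k+1)] (0-based field indices).\<close>
fun xf :: "(nat \<Rightarrow> ('a, 'n) chart \<Rightarrow> real^'n \<Rightarrow> real^'n) \<Rightarrow> ('a, 'n) chart \<Rightarrow> nat list \<Rightarrow> real^'n \<Rightarrow> real^'n" where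
  "xf X c [] = (\<lambda>_. 0)"
| "xf X c [j] = X j c"
| "xf X c (j # k # I) = cbr (X j c) (xf X c (k # I))"

definition Dc :: "(nat \<Rightarrow> ('a, 'n) chart \<Rightarrow> real^'n \<Rightarrow> real^'n) \<Rightarrow> nat \<Rightarrow> ('a, 'n) chart \<Rightarrow> nat \<Rightarrow> real^'n \<Rightarrow> (real^'n) set" where
  "Dc X N0 c i p = span {xf X c I p | I. I \<noteq> [] \<and> length I \<le> i + 1 \<and> set I \<subseteq> {..<N0}}"

definition ndim :: "('a, 'n::finite) chart set \<Rightarrow> (nat \<Rightarrow> ('a, 'n) chart \<Rightarrow> real^'n \<Rightarrow> real^'n) \<Rightarrow> nat \<Rightarrow> nat \<Rightarrow> 'a \<Rightarrow> nat" where
  "ndim A X N0 i m = dim (Dc X N0 (chart_at A m) i (snd (chart_at A m) m))"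

definition nprev :: "('a, 'n::finite) chart set \<Rightarrow> (nat \<Rightarrow> ('a, 'n) chart \<Rightarrow> real^'n \<Rightarrow> real^'n) \<Rightarrow> nat \<Rightarrow> nat \<Rightarrow> 'a \<Rightarrow> nat" where
  "nprev A X N0 i m = (if i = 0 then 0 else ndim A X N0 (i - 1) m)"

definition rloc :: "('a, 'n::finite) chart set \<Rightarrow> (nat \<Rightarrow> ('a, 'n) chart \<Rightarrow> real^'n \<Rightarrow> real^'n) \<Rightarrow> nat \<Rightarrow> 'a \<Rightarrow> nat" where
  "rloc A X N0 m = (LEAST r. ndim A X N0 r m = CARD('n))"

definition rbold :: "('a, 'n::finite) chart set \<Rightarrow> (nat \<Rightarrow> ('a, 'n) chart \<Rightarrow> real^'n \<Rightarrow> real^'n) \<Rightarrow> nat \<Rightarrow> nat" where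
  "rbold A X N0 = Max (range (rloc A X N0))"

definition equiregular :: "('a::topological_space, 'n::finite) chart set \<Rightarrow> (nat \<Rightarrow> ('a, 'n) chart \<Rightarrow> real^'n \<Rightarrow> real^'n) \<Rightarrow> nat \<Rightarrow> 'a \<Rightarrow> bool" where
  "equiregular A X N0 m \<longleftrightarrow>
     (\<exists>W. open W \<and> m \<in> W \<and> (\<forall>m'\<in>W. \<forall>i. ndim A X N0 i m' = ndim A X N0 i m))"

definition Zsing :: "('a::topological_space, 'n::finite) chart set \<Rightarrow> (nat \<Rightarrow> ('a, 'n) chart \<Rightarrow> real^'n \<Rightarrow> real^'n) \<Rightarrow> nat \<Rightarrow> 'a set" where
  "Zsing A X N0 = {m. \<not> equiregular A X N0 m}"

definition Qdim :: "('a, 'n::finite) chart set \<Rightarrow> (nat \<Rightarrow> ('a, 'n) chart \<Rightarrow> real^'n \<Rightarrow> real^'n) \<Rightarrow> nat \<Rightarrow> 'a \<Rightarrow> nat" where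
  "Qdim A X N0 m = (\<Sum>i\<le>rbold A X N0. (i + 1) * (ndim A X N0 i m - nprev A X N0 i m))"

definition Cidx :: "('a, 'n::finite) chart set \<Rightarrow> (nat \<Rightarrow> ('a, 'n) chart \<Rightarrow> real^'n \<Rightarrow> real^'n) \<Rightarrow> nat \<Rightarrow> nat list set" where
  "Cidx A X N0 = {I. I \<noteq> [] \<and> length I \<le> rbold A X N0 + 1 \<and> set I \<subseteq> {..<N0} \<and>
       (length I = 1 \<or> (\<exists>c\<in>A. \<exists>p\<in>snd c ` fst c. xf X c I p \<noteq> 0))}"

definition gh :: "('a, 'n::finite) chart set \<Rightarrow> (nat \<Rightarrow> ('a, 'n) chart \<Rightarrow> real^'n \<Rightarrow> real^'n) \<Rightarrow> nat \<Rightarrow> real \<Rightarrow> ('a, 'n) chart \<Rightarrow> real^'n \<Rightarrow> real^'n \<Rightarrow> real" where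
  "gh A X N0 h c p v = Inf {(\<Sum>I\<in>Cidx A X N0. (h powr (- real (length I - 1)) * u I)\<^sup>2) | u.
        (\<Sum>I\<in>Cidx A X N0. u I *\<^sub>R xf X c I p) = v}"

definition g0 :: "(nat \<Rightarrow> ('a, 'n) chart \<Rightarrow> real^'n \<Rightarrow> real^'n) \<Rightarrow> nat \<Rightarrow> ('a, 'n) chart \<Rightarrow> real^'n \<Rightarrow> real^'n \<Rightarrow> real" where
  "g0 X N0 c p v = Inf {(\<Sum>j<N0. (u j)\<^sup>2) | u. (\<Sum>j<N0. u j *\<^sub>R X j c p) = v}"

definition polar :: "(real^'n \<Rightarrow> real) \<Rightarrow> real^'n \<Rightarrow> real^'n \<Rightarrow> real" where
  "polar q v w = (q (v + w) - q v - q w) / 2"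

definition gram :: "(real^'n \<Rightarrow> real) \<Rightarrow> real^'n^'n" where
  "gram q = (\<chi> k l. polar q (axis k 1) (axis l 1))"

definition dvol_ratio :: "('a, 'n::finite) chart set \<Rightarrow> (nat \<Rightarrow> ('a, 'n) chart \<Rightarrow> real^'n \<Rightarrow> real^'n) \<Rightarrow> nat \<Rightarrow> (('a, 'n) chart \<Rightarrow> real^'n \<Rightarrow> real) \<Rightarrow> real \<Rightarrow> 'a \<Rightarrow> real" where
  "dvol_ratio A X N0 \<rho> h m =
     (let c = chart_at A m; p = snd c m in sqrt (det (gram (gh A X N0 h c p))) / \<rho> c p)"

definition adapted_frame ::
  "('a::topological_space, 'n::finite) chart set \<Rightarrow> (nat \<Rightarrow> ('a, 'n) chart \<Rightarrow> real^'n \<Rightarrow> real^'n) \<Rightarrow> nat \<Rightarrow>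
   ('a, 'n) chart \<Rightarrow> 'a \<Rightarrow> (real^'n) set \<Rightarrow> (nat \<Rightarrow> real^'n \<Rightarrow> real^'n) \<Rightarrow> bool" where
  "adapted_frame A X N0 c m V Z \<longleftrightarrow>
     open V \<and> snd c m \<in> V \<and> V \<subseteq> snd c ` fst c \<and>
     (\<forall>a<CARD('n). smooth_on V (Z a)) \<and>
     (\<forall>p\<in>V. inj_on (\<lambda>a. Z a p) {..<CARD('n)} \<and> independent ((\<lambda>a. Z a p) ` {..<CARD('n)})) \<and>
     (\<forall>p\<in>V. \<forall>i. span ((\<lambda>a. Z a p) ` {..<ndim A X N0 i m}) = Dc X N0 c i p) \<and>
     (\<forall>p\<in>V. \<forall>a<ndim A X N0 0 m. \<forall>b<ndim A X N0 0 m.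
         polar (g0 X N0 c p) (Z a p) (Z b p) = (if a = b then 1 else 0))"

fun zbr :: "(nat \<Rightarrow> real^'n \<Rightarrow> real^'n) \<Rightarrow> nat list \<Rightarrow> real^'n \<Rightarrow> real^'n" where
  "zbr Z [] = (\<lambda>_. 0)"
| "zbr Z [a] = Z a"
| "zbr Z (a # b # s) = cbr (Z a) (zbr Z (b # s))"

definition fcoef :: "(nat \<Rightarrow> real^'n \<Rightarrow> real^'n) \<Rightarrow> real^'n \<Rightarrow> real^'n \<Rightarrow> nat \<Rightarrow> real" where
  "fcoef Z p w = (THE b. (\<Sum>a<CARD('n). b a *\<^sub>R Z a p) = w \<and> (\<forall>a\<ge>CARD('n). b a = 0))"

definition detn :: "nat \<Rightarrow> (nat \<Rightarrow> nat \<Rightarrow> real) \<Rightarrow> real" where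
  "detn n B = (\<Sum>\<sigma> | \<sigma> permutes {..<n}. of_int (sign \<sigma>) * (\<Prod>i<n. B i (\<sigma> i)))"

definition Bmat ::
  "('a, 'n::finite) chart set \<Rightarrow> (nat \<Rightarrow> ('a, 'n) chart \<Rightarrow> real^'n \<Rightarrow> real^'n) \<Rightarrow> nat \<Rightarrow>
   'a \<Rightarrow> (nat \<Rightarrow> real^'n \<Rightarrow> real^'n) \<Rightarrow> real^'n \<Rightarrow> nat \<Rightarrow> nat \<Rightarrow> nat \<Rightarrow> real" where
  "Bmat A X N0 m Z p j k l =
     (\<Sum>s\<in>{s. length s = j + 1 \<and> set s \<subseteq> {..<ndim A X N0 0 m}}.
        fcoef Z p (zbr Z s p) (nprev A X N0 j m + k) * fcoef Z p (zbr Z s p) (nprev A X N0 j m + l))"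

definition enum_idx :: "'n::finite \<Rightarrow> nat" where
  "enum_idx = (SOME f. bij_betw f UNIV {..<CARD('n)})"

definition frame_det :: "(nat \<Rightarrow> real^'n::finite \<Rightarrow> real^'n) \<Rightarrow> real^'n \<Rightarrow> real" where
  "frame_det Z p = det (\<chi> i k. Z (enum_idx k) p $ i)"

text \<open>P / mu at m, computed from chart c and adapted frame Z:
  (prod_j det B_j)^(-1/2) |nu_1 ^ ... ^ nu_d| / (rho_c |dx|).\<close>
definition popp_val ::
  "('a, 'n::finite) chart set \<Rightarrow> (nat \<Rightarrow> ('a, 'n) chart \<Rightarrow> real^'n \<Rightarrow> real^'n) \<Rightarrow> nat \<Rightarrow>
   (('a, 'n) chart \<Rightarrow> real^'n \<Rightarrow> real) \<Rightarrow> ('a, 'n) chart \<Rightarrow> (nat \<Rightarrow> real^'n \<Rightarrow> real^'n) \<Rightarrow> 'a \<Rightarrow> real" where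
  "popp_val A X N0 \<rho> c Z m =
     (let p = snd c m in
       (\<Prod>j\<in>{1..rbold A X N0}. detn (ndim A X N0 j m - nprev A X N0 j m) (Bmat A X N0 m Z p j)) powr (-1/2)
       / (\<bar>frame_det Z p\<bar> * \<rho> c p))"

definition popp_ratio ::
  "('a::topological_space, 'n::finite) chart set \<Rightarrow> (nat \<Rightarrow> ('a, 'n) chart \<Rightarrow> real^'n \<Rightarrow> real^'n) \<Rightarrow> nat \<Rightarrow>
   (('a, 'n) chart \<Rightarrow> real^'n \<Rightarrow> real) \<Rightarrow> 'a \<Rightarrow> real" where
  "popp_ratio A X N0 \<rho> m =
     (let c = chart_at A m; Z = (SOME Z. \<exists>V. adapted_frame A X N0 c m V Z) in popp_val A X N0 \<rho> c Z m)"

end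

theory Submission
  imports Defs
begin

text \<open>
  The cometric of g^h in a chart is G_h, the sum of h^(2(|I|-1)) X_I X_I^T over the brackets X_I, so the
  Riemannian density is (det G_h)^(-1/2). Written in an adapted frame Z with weights w_a, the
  coefficients of X_I vanish on vectors of weight larger than |I| - 1; dividing the (a, b) entry of G_h
  by h^(w_a + w_b) therefore leaves a matrix E_h that is polynomial in h with coefficients continuous in the
  point, and the powers of h pulled out of the determinant add up to h^(2(Q - d)). Hence h^(Q-d) dvol extends
  continuously to h = 0, which gives locally uniform convergence. At h = 0 the matrix E_0 is block
  diagonal; the coefficients of the X_j in the orthonormal frame of D_0 form an isometry, so modulo lower
  order terms its blocks are the matrices B_j of Popp's volume. Positive definiteness of E_0 keeps the
  limit finite.
\<close>

section \<open>Calculus of smooth functions\<close>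

text \<open>\<open>dvol_ratio\<close> and \<open>popp_ratio\<close> choose a chart, and the latter
  also an adapted frame, separately at every point, so nothing in the definitions makes Popp's
  volume continuous or independent of these choices. The proof never compares two adapted frames.
  Around each equiregular point it fixes one frame and obtains locally uniform convergence to some
  limit; the value of that limit at a nearby point is then found with the frame chosen there,
  because the densities for h > 0 involve no frame and limits are unique. The identification of the
  blocks rests on two facts. Brackets of arbitrary smooth sections of D_0 and D_j lie in D_(j+1),
  which needs smooth local frames of the flag and hence constant ranks; this makes every term with a
  differentiated coefficient one of lower order. And the matrix of the X_j in the frame has
  orthonormal columns, so its tensor powers preserve sums over words. Inverse matrices are written
  by Cramer's rule, which makes frame coefficients and the auxiliary metric smooth in the
  point.\<close>

lemma smooth_k_Suc_open:
  assumes "open U"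
  shows "smooth_k (Suc k) U f \<longleftrightarrow>
    (\<forall>x\<in>U. f differentiable (at x)) \<and> (\<forall>v. smooth_k k U (\<lambda>x. frechet_derivative f (at x) v))"
  using differentiable_on_eq_differentiable_at[OF assms] by auto

declare smooth_k.simps(2) [simp del]

lemma smooth_k_cong:
  assumes "open U" "\<And>x. x \<in> U \<Longrightarrow> f x = g x" "smooth_k k U f"
  shows "smooth_k k U g"
  using assms(2,3)
proof (induction k arbitrary: f g)
  case 0
  then show ?case using continuous_on_cong[of U U f g] by auto
next
  case (Suc k)
  have d: "(g has_derivative frechet_derivative f (at x)) (at x)" if "x \<in> U" for x
    using Suc.prems that \<open>open U\<close> frechet_derivative_works[of f]
    by (auto simp: smooth_k_Suc_open intro: has_derivative_transform_within_open)
  have e: "frechet_derivative f (at x) = frechet_derivative g (at x)" if "x \<in> U" for x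
    using d[OF that] by (rule frechet_derivative_at)
  show ?case
    unfolding smooth_k_Suc_open[OF \<open>open U\<close>]
  proof (intro conjI ballI allI)
    show "g differentiable (at x)" if "x \<in> U" for x
      using d[OF that] by (rule differentiableI)
    show "smooth_k k U (\<lambda>x. frechet_derivative g (at x) v)" for v
      by (rule Suc.IH[of "\<lambda>x. frechet_derivative f (at x) v"])
         (use e Suc.prems \<open>open U\<close> in \<open>auto simp: smooth_k_Suc_open\<close>)
  qed
qed

text \<open>Any formula f' for the derivative may be supplied; the inductions below need one built
  from functions that are already known to be smooth.\<close>

lemma smooth_k_SucI:
  assumes "open U" "\<And>x. x \<in> U \<Longrightarrow> (f has_derivative f' x) (at x)"
    and "\<And>v. smooth_k k U (\<lambda>x. f' x v)"
  shows "smooth_k (Suc k) U f"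
  unfolding smooth_k_Suc_open[OF \<open>open U\<close>]
proof (intro conjI ballI allI)
  show "f differentiable (at x)" if "x \<in> U" for x
    using assms(2)[OF that] by (rule differentiableI)
  show "smooth_k k U (\<lambda>x. frechet_derivative f (at x) v)" for v
    by (rule smooth_k_cong[OF \<open>open U\<close> _ assms(3)[of v]])
       (use frechet_derivative_at[OF assms(2)] in auto)
qed

lemma smooth_k_Suc_has_derivative:
  assumes "open U" "smooth_k (Suc k) U f" "x \<in> U"
  shows "(f has_derivative frechet_derivative f (at x)) (at x)"
  using assms by (simp add: smooth_k_Suc_open frechet_derivative_works)

lemma smooth_k_SucD:
  "open U \<Longrightarrow> smooth_k (Suc k) U f \<Longrightarrow> smooth_k k U (\<lambda>x. frechet_derivative f (at x) v)"
  by (simp add: smooth_k_Suc_open)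

lemma smooth_k_less:
  assumes "open U" "smooth_k (Suc k) U f"
  shows "smooth_k k U f"
  using assms(2)
proof (induction k arbitrary: f)
  case 0
  then show ?case using assms(1)
    by (auto simp: smooth_k_Suc_open intro!: continuous_at_imp_continuous_on differentiable_imp_continuous_within)
next
  case (Suc k)
  then show ?case unfolding smooth_k_Suc_open[OF assms(1)] by blast
qed

lemma smooth_k_subset:
  assumes "open U" "open V" "V \<subseteq> U" "smooth_k k U f"
  shows "smooth_k k V f"
  using assms(4)
proof (induction k arbitrary: f)
  case 0
  then show ?case using assms by (auto intro: continuous_on_subset)
next
  case (Suc k)
  then show ?case using assms(3) unfolding smooth_k_Suc_open[OF assms(1)] smooth_k_Suc_open[OF assms(2)] by blast
qed

lemma smooth_k_const: "open U \<Longrightarrow> smooth_k k U (\<lambda>x. c)"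
proof (induction k arbitrary: c)
  case (Suc k)
  show ?case by (rule smooth_k_SucI[where f' = "\<lambda>x v. 0"]) (use Suc in auto)
qed auto

lemma smooth_k_add:
  assumes "open U" "smooth_k k U f" "smooth_k k U g"
  shows "smooth_k k U (\<lambda>x. f x + g x)"
  using assms(2,3)
proof (induction k arbitrary: f g)
  case 0
  then show ?case by (auto intro: continuous_on_add)
next
  case (Suc k)
  show ?case
    by (rule smooth_k_SucI[where f' = "\<lambda>x v. frechet_derivative f (at x) v + frechet_derivative g (at x) v"])
       (use Suc.prems in \<open>auto intro!: Suc.IH has_derivative_add assms(1) smooth_k_SucD[OF assms(1)] smooth_k_Suc_has_derivative[OF assms(1)]\<close>)
qed

text \<open>One induction serves products, scalings and inner products: by the Leibniz rule the
  derivative is a sum of two terms of the same bilinear shape, each with one factor differentiated,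
  to which the induction hypothesis applies again.\<close>

lemma smooth_k_bilinear:
  assumes "open U" "bounded_bilinear p" "smooth_k k U f" "smooth_k k U g"
  shows "smooth_k k U (\<lambda>x. p (f x) (g x))"
  using assms(3,4)
proof (induction k arbitrary: f g)
  case 0
  then show ?case using bounded_bilinear.continuous_on[OF assms(2)] by auto
next
  case (Suc k)
  show ?case
  proof (rule smooth_k_SucI[OF assms(1)])
    show "((\<lambda>x. p (f x) (g x)) has_derivative
       (\<lambda>v. p (f x) (frechet_derivative g (at x) v) + p (frechet_derivative f (at x) v) (g x))) (at x)" if "x \<in> U" for x
      by (intro bounded_bilinear.FDERIV[OF assms(2)] that
          smooth_k_Suc_has_derivative[OF assms(1) Suc.prems(1)] smooth_k_Suc_has_derivative[OF assms(1) Suc.prems(2)])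
    show "smooth_k k U (\<lambda>x. p (f x) (frechet_derivative g (at x) v) + p (frechet_derivative f (at x) v) (g x))" for v
      by (intro smooth_k_add[OF assms(1)] Suc.IH Suc.prems
          smooth_k_less[OF assms(1) Suc.prems(1)] smooth_k_less[OF assms(1) Suc.prems(2)] smooth_k_SucD[OF assms(1)])
  qed
qed

lemma smooth_k_linear:
  assumes "open U" "bounded_linear L" "smooth_k k U f"
  shows "smooth_k k U (\<lambda>x. L (f x))"
proof -
  \<comment> \<open>A linear map is treated as a bilinear one whose first argument is the constant
    1, so no new induction is needed.\<close>
  have "bounded_bilinear (\<lambda>(c::real) y. c *\<^sub>R L y)"
    using bounded_bilinear.comp[OF bounded_bilinear_scaleR bounded_linear_ident assms(2)] by simp
  from smooth_k_bilinear[OF assms(1) this smooth_k_const[OF assms(1), of k 1] assms(3)]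
  show ?thesis by simp
qed

text \<open>The exponent has to vary in the induction because differentiation lowers it by one. Real
  powers provide both reciprocals and the normalization in the Gram-Schmidt process.\<close>

lemma smooth_k_powr:
  fixes f :: "'a::euclidean_space \<Rightarrow> real"
  assumes "open U" "smooth_k k U f" "\<And>x. x \<in> U \<Longrightarrow> f x > 0"
  shows "smooth_k k U (\<lambda>x. f x powr a)"
  using assms(2)
proof (induction k arbitrary: a)
  case 0
  have "continuous_on U f" "\<forall>x\<in>U. f x \<noteq> 0" using 0 assms(3) by (simp_all add: less_imp_neq[symmetric])
  then show ?case by (simp add: continuous_on_powr continuous_on_const)
next
  case (Suc k)
  show ?case
  proof (rule smooth_k_SucI[OF assms(1)])
    fix x assume x: "x \<in> U"
    have "((\<lambda>y. y powr a) has_real_derivative a * f x powr (a - 1)) (at (f x))"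
      using assms(3)[OF x] by (auto intro: has_real_derivative_powr)
    from has_derivative_compose[OF smooth_k_Suc_has_derivative[OF assms(1) Suc.prems x] this[unfolded has_field_derivative_def]]
    show "((\<lambda>x. f x powr a) has_derivative (\<lambda>v. a * f x powr (a - 1) * frechet_derivative f (at x) v)) (at x)" .
  next
    show "smooth_k k U (\<lambda>x. a * f x powr (a - 1) * frechet_derivative f (at x) v)" for v
      by (intro smooth_k_bilinear[OF assms(1) bounded_bilinear_mult] smooth_k_const assms(1)
          Suc.IH smooth_k_less[OF assms(1) Suc.prems] smooth_k_SucD[OF assms(1) Suc.prems])
  qed
qed

lemma smooth_on_cong:
  "open U \<Longrightarrow> (\<And>x. x \<in> U \<Longrightarrow> f x = g x) \<Longrightarrow> smooth_on U f \<Longrightarrow> smooth_on U g"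
  unfolding smooth_on_def by (metis smooth_k_cong)

lemma smooth_on_subset: "open U \<Longrightarrow> open V \<Longrightarrow> V \<subseteq> U \<Longrightarrow> smooth_on U f \<Longrightarrow> smooth_on V f"
  unfolding smooth_on_def by (metis smooth_k_subset)

lemma smooth_on_const: "open U \<Longrightarrow> smooth_on U (\<lambda>x. c)"
  by (simp add: smooth_on_def smooth_k_const)

lemma smooth_on_add: "open U \<Longrightarrow> smooth_on U f \<Longrightarrow> smooth_on U g \<Longrightarrow> smooth_on U (\<lambda>x. f x + g x)"
  by (simp add: smooth_on_def smooth_k_add)

lemma smooth_on_bilinear:
  "open U \<Longrightarrow> bounded_bilinear p \<Longrightarrow> smooth_on U f \<Longrightarrow> smooth_on U g \<Longrightarrow> smooth_on U (\<lambda>x. p (f x) (g x))"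
  by (simp add: smooth_on_def smooth_k_bilinear)

lemmas smooth_on_mult = smooth_on_bilinear[OF _ bounded_bilinear_mult]
lemmas smooth_on_scaleR = smooth_on_bilinear[OF _ bounded_bilinear_scaleR]
lemmas smooth_on_inner = smooth_on_bilinear[OF _ bounded_bilinear_inner]

lemma smooth_on_linear:
  "open U \<Longrightarrow> bounded_linear L \<Longrightarrow> smooth_on U f \<Longrightarrow> smooth_on U (\<lambda>x. L (f x))"
  by (simp add: smooth_on_def smooth_k_linear)

lemmas smooth_on_vec_nth = smooth_on_linear[OF _ bounded_linear_vec_nth]

lemma smooth_on_diff: "open U \<Longrightarrow> smooth_on U f \<Longrightarrow> smooth_on U g \<Longrightarrow> smooth_on U (\<lambda>x. f x - g x)"
  using smooth_on_add[of U f "\<lambda>x. - g x"] smooth_on_linear[of U uminus g]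
  by (simp add: bounded_linear_minus bounded_linear_ident)

lemma smooth_on_sum:
  assumes "open U" "\<And>i. i \<in> S \<Longrightarrow> smooth_on U (f i)"
  shows "smooth_on U (\<lambda>x. \<Sum>i\<in>S. f i x)"
  using assms(2)
  by (induction S rule: infinite_finite_induct) (auto intro!: smooth_on_const smooth_on_add assms(1))

lemma smooth_on_prod:
  fixes f :: "'i \<Rightarrow> 'a::euclidean_space \<Rightarrow> real"
  assumes "open U" "\<And>i. i \<in> S \<Longrightarrow> smooth_on U (f i)"
  shows "smooth_on U (\<lambda>x. \<Prod>i\<in>S. f i x)"
  using assms(2)
  by (induction S rule: infinite_finite_induct) (auto intro!: smooth_on_const smooth_on_mult assms(1))

lemma smooth_on_powr:
  fixes f :: "'a::euclidean_space \<Rightarrow> real"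
  shows "open U \<Longrightarrow> smooth_on U f \<Longrightarrow> (\<And>x. x \<in> U \<Longrightarrow> f x > 0) \<Longrightarrow> smooth_on U (\<lambda>x. f x powr a)"
  by (simp add: smooth_on_def smooth_k_powr)

lemma smooth_on_det:
  assumes "open U" "\<And>i j. smooth_on U (\<lambda>x. F x $ i $ j :: real)"
  shows "smooth_on U (\<lambda>x. det (F x))"
  unfolding det_def
  by (intro smooth_on_sum smooth_on_mult smooth_on_const smooth_on_prod assms)

lemma smooth_on_vec_lambda:
  assumes "open U" "\<And>i. smooth_on U (\<lambda>x. f x i :: real)"
  shows "smooth_on U (\<lambda>x. (\<chi> i. f x i) :: real^'n)"
proof (rule smooth_on_cong[OF assms(1)])
  show "smooth_on U (\<lambda>x. \<Sum>i\<in>UNIV. f x i *\<^sub>R axis i (1::real))"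
    by (intro smooth_on_sum smooth_on_scaleR smooth_on_const assms)
  show "(\<Sum>i\<in>UNIV. f x i *\<^sub>R axis i (1::real)) = (\<chi> i. f x i)" for x
    by (simp add: vec_eq_iff axis_def if_distrib[of "\<lambda>t. _ * t"] cong: if_cong)
qed

lemma smooth_on_has_derivative:
  "open U \<Longrightarrow> smooth_on U f \<Longrightarrow> x \<in> U \<Longrightarrow> (f has_derivative frechet_derivative f (at x)) (at x)"
  unfolding smooth_on_def by (rule smooth_k_Suc_has_derivative) auto

lemma smooth_on_differentiable: "open U \<Longrightarrow> smooth_on U f \<Longrightarrow> x \<in> U \<Longrightarrow> f differentiable (at x)"
  by (rule differentiableI[OF smooth_on_has_derivative])

lemma smooth_on_continuous: "smooth_on U f \<Longrightarrow> continuous_on U f"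
  unfolding smooth_on_def by (drule spec[of _ 0]) simp

lemma smooth_on_frechet_derivative:
  "open U \<Longrightarrow> smooth_on U f \<Longrightarrow> smooth_on U (\<lambda>x. frechet_derivative f (at x) v)"
  unfolding smooth_on_def by (metis smooth_k_SucD)

lemma linear_axis_expansion:
  fixes w :: "real^'n"
  assumes "linear L"
  shows "L w = (\<Sum>i\<in>UNIV. w $ i *\<^sub>R L (axis i 1))"
proof -
  have "L w = L (\<Sum>i\<in>UNIV. w $ i *\<^sub>R axis i 1)"
    by (simp add: basis_expansion[of w, unfolded scalar_mult_eq_scaleR])
  also have "\<dots> = (\<Sum>i\<in>UNIV. w $ i *\<^sub>R L (axis i 1))"
    by (simp add: linear_sum[OF assms] linear_scale[OF assms])
  finally show ?thesis .
qed

text \<open>\<open>smooth_k\<close> controls derivatives in fixed directions only. Expanding W x in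
  the standard basis reduces a direction that varies with the point to finitely many fixed ones,
  with smooth coefficients.\<close>

lemma smooth_on_directional_derivative:
  fixes W :: "real^'n \<Rightarrow> real^'n"
  assumes "open U" "smooth_on U f" "smooth_on U W"
  shows "smooth_on U (\<lambda>x. frechet_derivative f (at x) (W x))"
proof (rule smooth_on_cong[OF assms(1)])
  show "smooth_on U (\<lambda>x. \<Sum>i\<in>UNIV. W x $ i *\<^sub>R frechet_derivative f (at x) (axis i 1))"
    by (intro smooth_on_sum smooth_on_scaleR smooth_on_vec_nth smooth_on_frechet_derivative assms)
  show "(\<Sum>i\<in>UNIV. W x $ i *\<^sub>R frechet_derivative f (at x) (axis i 1)) = frechet_derivative f (at x) (W x)"
    if "x \<in> U" for x
    by (rule linear_axis_expansion[symmetric, OF linear_frechet_derivative[OF smooth_on_differentiable[OF assms(1,2) that]]])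
qed

lemma smooth_on_cbr: "open U \<Longrightarrow> smooth_on U Y \<Longrightarrow> smooth_on U W \<Longrightarrow> smooth_on U (cbr Y W)"
  unfolding cbr_def[abs_def] by (intro smooth_on_diff smooth_on_directional_derivative)

lemma smooth_on_xf:
  assumes "open U" "set I \<subseteq> {..<N0}" "\<And>j. j < N0 \<Longrightarrow> smooth_on U (X j c)"
  shows "smooth_on U (xf X c I)"
  using assms(2,3)
  by (induction X c I rule: xf.induct) (auto intro!: smooth_on_const smooth_on_cbr assms(1))

lemma smooth_on_zbr:
  assumes "open U" "set s \<subseteq> {..<n}" "\<And>a. a < n \<Longrightarrow> smooth_on U (Z a)"
  shows "smooth_on U (zbr Z s)"
  using assms(2,3)
  by (induction Z s rule: zbr.induct) (auto intro!: smooth_on_const smooth_on_cbr assms(1))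

section \<open>Naturality of iterated brackets under changes of charts\<close>

text \<open>The mean value theorem is applied twice: along v to the difference of f between opposite
  sides of the parallelogram, then along w to the derivative of f in direction v.\<close>

lemma second_difference_MVT:
  fixes f :: "'a::euclidean_space \<Rightarrow> real"
  assumes "smooth_on (ball x e) f" "0 < t" "t * (norm v + norm w) < e"
  obtains z where "dist z x \<le> t * (norm v + norm w)"
    "f (x + t *\<^sub>R v + t *\<^sub>R w) - f (x + t *\<^sub>R v) - f (x + t *\<^sub>R w) + f x
      = t\<^sup>2 * frechet_derivative (\<lambda>y. frechet_derivative f (at y) v) (at z) w"
proof -
  define D where "D = (\<lambda>y. frechet_derivative f (at y) v)"
  have D: "smooth_on (ball x e) D"
    unfolding D_def using assms(1) by (intro smooth_on_frechet_derivative) auto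
  have n: "norm (a *\<^sub>R v + b *\<^sub>R w) \<le> t * (norm v + norm w)" if "0 \<le> a" "a \<le> t" "0 \<le> b" "b \<le> t" for a b
  proof -
    have "norm (a *\<^sub>R v + b *\<^sub>R w) \<le> norm (a *\<^sub>R v) + norm (b *\<^sub>R w)" by (rule norm_triangle_ineq)
    also have "\<dots> \<le> t * norm v + t * norm w"
      using that by (intro add_mono) (auto intro: mult_right_mono)
    finally show ?thesis by (simp add: algebra_simps)
  qed
  have inb: "x + a *\<^sub>R v + b *\<^sub>R w \<in> ball x e" if "0 \<le> a" "a \<le> t" "0 \<le> b" "b \<le> t" for a b
    using n[OF that] assms(3) unfolding mem_ball by (subst dist_commute) (simp add: dist_norm add.assoc)
  have path: "((\<lambda>s. h (y + s *\<^sub>R u)) has_real_derivative frechet_derivative h (at (y + s *\<^sub>R u)) u) (at s)"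
    if "smooth_on (ball x e) h" "y + s *\<^sub>R u \<in> ball x e" for h :: "'a \<Rightarrow> real" and y u s
  proof -
    have a: "(h has_derivative frechet_derivative h (at (y + s *\<^sub>R u))) (at (y + s *\<^sub>R u))"
      using smooth_on_has_derivative[OF open_ball that] .
    have "((\<lambda>s. y + s *\<^sub>R u) has_derivative (\<lambda>r. r *\<^sub>R u)) (at s)"
      by (auto intro!: derivative_eq_intros)
    from has_derivative_compose[OF this a]
    have "((\<lambda>s. h (y + s *\<^sub>R u)) has_derivative (\<lambda>r. frechet_derivative h (at (y + s *\<^sub>R u)) (r *\<^sub>R u))) (at s)" .
    moreover have "frechet_derivative h (at (y + s *\<^sub>R u)) (r *\<^sub>R u) = frechet_derivative h (at (y + s *\<^sub>R u)) u * r" for r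
      using linear_scale[OF has_derivative_linear[OF a]] by (simp add: mult.commute)
    ultimately show ?thesis by (simp add: has_field_derivative_def)
  qed
  have "\<exists>s>0. s < t \<and> (f (x + t *\<^sub>R w + t *\<^sub>R v) - f (x + t *\<^sub>R v)) - (f (x + t *\<^sub>R w + 0 *\<^sub>R v) - f (x + 0 *\<^sub>R v))
      = (t - 0) * (D (x + t *\<^sub>R w + s *\<^sub>R v) - D (x + s *\<^sub>R v))"
    unfolding D_def
  proof (rule MVT2[OF assms(2), of "\<lambda>s. f (x + t *\<^sub>R w + s *\<^sub>R v) - f (x + s *\<^sub>R v)"])
    fix s assume s: "0 \<le> s" "s \<le> t"
    show "((\<lambda>s. f (x + t *\<^sub>R w + s *\<^sub>R v) - f (x + s *\<^sub>R v)) has_real_derivative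
       frechet_derivative f (at (x + t *\<^sub>R w + s *\<^sub>R v)) v - frechet_derivative f (at (x + s *\<^sub>R v)) v) (at s)"
      using inb[of s t] inb[of s 0] s assms(2)
      by (intro DERIV_diff path assms(1)) (auto simp: algebra_simps)
  qed
  then obtain s where s: "0 < s" "s < t" and
    e1: "(f (x + t *\<^sub>R w + t *\<^sub>R v) - f (x + t *\<^sub>R v)) - (f (x + t *\<^sub>R w) - f x)
      = t * (D (x + t *\<^sub>R w + s *\<^sub>R v) - D (x + s *\<^sub>R v))"
    by auto
  have "\<exists>r>0. r < t \<and> D (x + s *\<^sub>R v + t *\<^sub>R w) - D (x + s *\<^sub>R v + 0 *\<^sub>R w)
      = (t - 0) * frechet_derivative D (at (x + s *\<^sub>R v + r *\<^sub>R w)) w"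
    by (rule MVT2[OF assms(2), of "\<lambda>r. D (x + s *\<^sub>R v + r *\<^sub>R w)"])
       (use inb[of s] s in \<open>auto intro!: path D\<close>)
  then obtain r where r: "0 < r" "r < t" and
    e2: "D (x + s *\<^sub>R v + t *\<^sub>R w) - D (x + s *\<^sub>R v) = t * frechet_derivative D (at (x + s *\<^sub>R v + r *\<^sub>R w)) w"
    by auto
  show ?thesis
  proof
    show "dist (x + s *\<^sub>R v + r *\<^sub>R w) x \<le> t * (norm v + norm w)"
      using n[of s r] r s by (simp add: dist_norm add.assoc)
    show "f (x + t *\<^sub>R v + t *\<^sub>R w) - f (x + t *\<^sub>R v) - f (x + t *\<^sub>R w) + f x
      = t\<^sup>2 * frechet_derivative (\<lambda>y. frechet_derivative f (at y) v) (at (x + s *\<^sub>R v + r *\<^sub>R w)) w"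
      using e1 e2 unfolding D_def[symmetric] by (simp add: power2_eq_square add_ac algebra_simps)
  qed
qed

text \<open>The second difference over a parallelogram is symmetric in v and w, so the two mixed
  derivatives take a common value at points arbitrarily close to x; their continuity at x does the
  rest.\<close>

lemma symmetric_second_derivative_real:
  fixes f :: "'a::euclidean_space \<Rightarrow> real"
  assumes "open U" "smooth_on U f" "x \<in> U"
  shows "frechet_derivative (\<lambda>y. frechet_derivative f (at y) v) (at x) w =
         frechet_derivative (\<lambda>y. frechet_derivative f (at y) w) (at x) v"
proof -
  obtain e where e: "e > 0" "ball x e \<subseteq> U" using assms by (meson openE)
  have sm: "smooth_on (ball x e) f" using smooth_on_subset[OF assms(1) _ e(2) assms(2)] by auto
  define H where "H = (\<lambda>v w z. frechet_derivative (\<lambda>y. frechet_derivative f (at y) v) (at z) w)"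
  have cont: "isCont (H v w) x" for v w
  proof -
    have "continuous_on (ball x e) (H v w)"
      unfolding H_def by (intro smooth_on_continuous smooth_on_frechet_derivative sm open_ball)
    then show ?thesis using e(1) by (simp add: continuous_on_eq_continuous_at)
  qed
  have "\<bar>H v w x - H w v x\<bar> < r" if "r > 0" for r
  proof -
    obtain d1 where d1: "d1 > 0" "\<And>z. dist z x < d1 \<Longrightarrow> dist (H v w z) (H v w x) < r / 2"
      using cont[of v w] \<open>r > 0\<close> unfolding continuous_at_eps_delta by (metis half_gt_zero)
    obtain d2 where d2: "d2 > 0" "\<And>z. dist z x < d2 \<Longrightarrow> dist (H w v z) (H w v x) < r / 2"
      using cont[of w v] \<open>r > 0\<close> unfolding continuous_at_eps_delta by (metis half_gt_zero)
    define b where "b = min e (min d1 d2)"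
    \<comment> \<open>The added 1 keeps the denominator positive for v = w = 0. This t is small
      enough for both intermediate points to lie in the ball and within both moduli of
      continuity.\<close>
    define t where "t = b / (norm v + norm w + 1)"
    have b: "b > 0" using e d1 d2 by (simp add: b_def)
    have "norm v + norm w + 1 > 0" by (smt (verit) norm_ge_zero)
    then have t: "t > 0" "t * (norm v + norm w) < b"
      using b by (auto simp: t_def field_simps)
    have te: "t * (norm v + norm w) < e" "t * (norm w + norm v) < e"
      using t(2) by (auto simp: b_def add.commute)
    obtain z1 where z1: "dist z1 x \<le> t * (norm v + norm w)"
      "f (x + t *\<^sub>R v + t *\<^sub>R w) - f (x + t *\<^sub>R v) - f (x + t *\<^sub>R w) + f x = t\<^sup>2 * H v w z1"
      unfolding H_def by (rule second_difference_MVT[OF sm t(1) te(1)])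
    obtain z2 where z2: "dist z2 x \<le> t * (norm w + norm v)"
      "f (x + t *\<^sub>R w + t *\<^sub>R v) - f (x + t *\<^sub>R w) - f (x + t *\<^sub>R v) + f x = t\<^sup>2 * H w v z2"
      unfolding H_def by (rule second_difference_MVT[OF sm t(1) te(2)])
    have "t\<^sup>2 * H v w z1 = t\<^sup>2 * H w v z2"
      using z1(2) z2(2) by (simp add: algebra_simps)
    then have "H v w z1 = H w v z2" using t(1) by simp
    moreover have "dist (H v w z1) (H v w x) < r / 2" "dist (H w v z2) (H w v x) < r / 2"
      using d1(2)[of z1] d2(2)[of z2] z1(1) z2(1) t(2) b_def by (simp_all add: add.commute)
    ultimately show ?thesis unfolding dist_real_def by linarith
  qed
  then have "\<not> 0 < \<bar>H v w x - H w v x\<bar>" by blast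
  then show ?thesis unfolding H_def by simp
qed

lemma frechet_derivative_vec_nth:
  "f differentiable (at x) \<Longrightarrow> frechet_derivative (\<lambda>y. f y $ i) (at x) v = frechet_derivative f (at x) v $ i"
  using frechet_derivative_at[OF bounded_linear.has_derivative[OF bounded_linear_vec_nth, of f _ "at x" i]]
  by (metis frechet_derivative_works)

lemma symmetric_second_derivative:
  fixes f :: "real^'m \<Rightarrow> real^'n"
  assumes "open U" "smooth_on U f" "x \<in> U"
  shows "frechet_derivative (\<lambda>y. frechet_derivative f (at y) v) (at x) w =
         frechet_derivative (\<lambda>y. frechet_derivative f (at y) w) (at x) v"
proof -
  have 1: "frechet_derivative (\<lambda>y. frechet_derivative f (at y) v) (at x) w $ i =
    frechet_derivative (\<lambda>y. frechet_derivative (\<lambda>y. f y $ i) (at y) v) (at x) w" for v w i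
  proof -
    have s: "smooth_on U (\<lambda>y. frechet_derivative f (at y) v)"
      by (intro smooth_on_frechet_derivative assms)
    have "frechet_derivative (\<lambda>y. frechet_derivative f (at y) v) (at x) w $ i
        = frechet_derivative (\<lambda>y. frechet_derivative f (at y) v $ i) (at x) w"
      by (rule frechet_derivative_vec_nth[symmetric, OF smooth_on_differentiable[OF assms(1) s assms(3)]])
    also have "frechet_derivative (\<lambda>y. frechet_derivative f (at y) v $ i) (at x) =
        frechet_derivative (\<lambda>y. frechet_derivative (\<lambda>y. f y $ i) (at y) v) (at x)"
    proof (rule frechet_derivative_transform_within_open[OF _ assms(1,3)])
      show "(\<lambda>y. frechet_derivative f (at y) v $ i) differentiable at x"
        by (rule smooth_on_differentiable[OF assms(1) smooth_on_vec_nth[OF assms(1) s] assms(3)])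
      show "frechet_derivative f (at y) v $ i = frechet_derivative (\<lambda>y. f y $ i) (at y) v" if "y \<in> U" for y
        by (rule frechet_derivative_vec_nth[symmetric, OF smooth_on_differentiable[OF assms(1,2) that]])
    qed
    finally show ?thesis .
  qed
  show ?thesis
    unfolding vec_eq_iff 1
    using symmetric_second_derivative_real[OF assms(1) smooth_on_vec_nth[OF assms(1,2)] assms(3)] by blast
qed

text \<open>Differentiating the two relations produces the Hessian of \<psi> applied to Y and W once
  in each order. By symmetry these terms cancel in the commutator, and only the first-order terms,
  which form the bracket of Y and W, survive.\<close>

lemma cbr_pushforward:
  fixes \<psi> :: "real^'n \<Rightarrow> real^'n"
  assumes U: "open U" "smooth_on U \<psi>" "x \<in> U"
    and Y: "Y differentiable (at x)" "Y' differentiable (at (\<psi> x))"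
    and W: "W differentiable (at x)" "W' differentiable (at (\<psi> x))"
    and Yr: "\<And>y. y \<in> U \<Longrightarrow> Y' (\<psi> y) = frechet_derivative \<psi> (at y) (Y y)"
    and Wr: "\<And>y. y \<in> U \<Longrightarrow> W' (\<psi> y) = frechet_derivative \<psi> (at y) (W y)"
  shows "cbr Y' W' (\<psi> x) = frechet_derivative \<psi> (at x) (cbr Y W x)"
proof -
  let ?D = "\<lambda>y. frechet_derivative \<psi> (at y)"
  let ?H = "\<lambda>i v. frechet_derivative (\<lambda>y. ?D y (axis i 1)) (at x) v"
  have lin: "linear (?D y)" if "y \<in> U" for y
    by (rule linear_frechet_derivative[OF smooth_on_differentiable[OF U(1,2) that]])
  have Hd: "((\<lambda>y. ?D y (axis i 1)) has_derivative ?H i) (at x)" for i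
    by (rule smooth_on_has_derivative[OF U(1) smooth_on_frechet_derivative[OF U(1,2)] U(3)])
  \<comment> \<open>The chain rule and the product rule differentiate the same map in two ways;
    uniqueness of the derivative equates the results.\<close>
  have key: "frechet_derivative W' (at (\<psi> x)) (?D x v) =
       (\<Sum>i\<in>UNIV. W x $ i *\<^sub>R ?H i v) + ?D x (frechet_derivative W (at x) v)"
    if W: "W differentiable (at x)" "W' differentiable (at (\<psi> x))"
      and Wr: "\<And>y. y \<in> U \<Longrightarrow> W' (\<psi> y) = ?D y (W y)" for W W' :: "real^'n \<Rightarrow> real^'n" and v
  proof -
    have d1: "((\<lambda>y. W' (\<psi> y)) has_derivative (\<lambda>v. frechet_derivative W' (at (\<psi> x)) (?D x v))) (at x)"
      by (rule has_derivative_compose[OF smooth_on_has_derivative[OF U]])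
         (use W(2) frechet_derivative_works in blast)
    have "((\<lambda>y. \<Sum>i\<in>UNIV. W y $ i *\<^sub>R ?D y (axis i 1)) has_derivative
        (\<lambda>v. \<Sum>i\<in>UNIV. W x $ i *\<^sub>R ?H i v + (frechet_derivative W (at x) v $ i) *\<^sub>R ?D x (axis i 1))) (at x)"
      by (intro has_derivative_sum has_derivative_scaleR Hd bounded_linear.has_derivative[OF bounded_linear_vec_nth])
         (use W(1) frechet_derivative_works in blast)
    note d0 = this
    have e0: "(\<Sum>i\<in>UNIV. W y $ i *\<^sub>R ?D y (axis i 1)) = W' (\<psi> y)" if "y \<in> U" for y
      unfolding Wr[OF that] by (rule linear_axis_expansion[OF lin[OF that], symmetric])
    have d2: "((\<lambda>y. W' (\<psi> y)) has_derivative
        (\<lambda>v. \<Sum>i\<in>UNIV. W x $ i *\<^sub>R ?H i v + (frechet_derivative W (at x) v $ i) *\<^sub>R ?D x (axis i 1))) (at x)"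
      by (rule has_derivative_transform_within_open[OF d0 U(1,3) e0])
    from has_derivative_unique[OF d1 d2]
    have "frechet_derivative W' (at (\<psi> x)) (?D x v) =
      (\<Sum>i\<in>UNIV. W x $ i *\<^sub>R ?H i v + (frechet_derivative W (at x) v $ i) *\<^sub>R ?D x (axis i 1))" by meson
    also have "\<dots> = (\<Sum>i\<in>UNIV. W x $ i *\<^sub>R ?H i v) + ?D x (frechet_derivative W (at x) v)"
      unfolding sum.distrib linear_axis_expansion[OF lin[OF U(3)], of "frechet_derivative W (at x) v"] ..
    finally show ?thesis .
  qed
  have Hl: "?H i v = (\<Sum>j\<in>UNIV. v $ j *\<^sub>R ?H i (axis j 1))" for i v
    by (rule linear_axis_expansion[OF has_derivative_linear[OF Hd]])
  have Hs: "?H i (axis j 1) = ?H j (axis i 1)" for i j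
    by (rule symmetric_second_derivative[OF U])
  have "(\<Sum>i\<in>UNIV. W x $ i *\<^sub>R ?H i (Y x)) = (\<Sum>i\<in>UNIV. \<Sum>j\<in>UNIV. (W x $ i * Y x $ j) *\<^sub>R ?H i (axis j 1))"
    by (subst Hl) (simp add: scaleR_sum_right)
  also have "\<dots> = (\<Sum>j\<in>UNIV. \<Sum>i\<in>UNIV. (W x $ i * Y x $ j) *\<^sub>R ?H j (axis i 1))"
    by (subst sum.swap) (simp only: Hs)
  also have "\<dots> = (\<Sum>j\<in>UNIV. Y x $ j *\<^sub>R ?H j (W x))"
    by (subst (2) Hl) (simp add: scaleR_sum_right mult.commute)
  finally have sym: "(\<Sum>i\<in>UNIV. W x $ i *\<^sub>R ?H i (Y x)) = (\<Sum>j\<in>UNIV. Y x $ j *\<^sub>R ?H j (W x))" .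
  show ?thesis
    unfolding cbr_def Yr[OF U(3)] Wr[OF U(3)] linear_diff[OF lin[OF U(3)]]
    using key[OF W Wr, of "Y x"] key[OF Y Yr, of "W x"] sym by simp
qed

section \<open>Charts, transition maps and the transformation of iterated brackets\<close>

lemma smooth_atlasD:
  assumes "smooth_atlas A" "c \<in> A"
  shows "open (fst c)" "open (snd c ` fst c)" "\<exists>\<psi>. homeomorphism (fst c) (snd c ` fst c) (snd c) \<psi>"
    "inj_on (snd c) (fst c)" "continuous_on (fst c) (snd c)"
proof -
  show "open (fst c)" "open (snd c ` fst c)" and
    ex: "\<exists>\<psi>. homeomorphism (fst c) (snd c ` fst c) (snd c) \<psi>"
    using assms unfolding smooth_atlas_def by blast+
  from ex obtain \<psi> where "homeomorphism (fst c) (snd c ` fst c) (snd c) \<psi>" ..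
  then show "inj_on (snd c) (fst c)" "continuous_on (fst c) (snd c)"
    by (auto simp: homeomorphism_def intro: inj_on_inverseI)
qed

lemma open_chart_image:
  assumes "smooth_atlas A" "c \<in> A" "open S" "S \<subseteq> fst c"
  shows "open (snd c ` S)"
proof -
  obtain \<psi> where h: "homeomorphism (fst c) (snd c ` fst c) (snd c) \<psi>"
    using smooth_atlasD(3)[OF assms(1,2)] by blast
  have "openin (top_of_set (fst c)) S"
    using assms(3,4) by (metis inf.absorb_iff2 openin_open)
  then have "openin (top_of_set (snd c ` fst c)) (snd c ` S)"
    by (rule homeomorphism_imp_open_map[OF h])
  then show ?thesis using smooth_atlasD(2)[OF assms(1,2)] openin_open_trans by blast
qed

lemma open_chart_vimage:
  assumes "smooth_atlas A" "c \<in> A" "open V"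
  shows "open {m \<in> fst c. snd c m \<in> V}"
proof -
  have "open (snd c -` V \<inter> fst c)"
    using continuous_on_open_vimage[OF smooth_atlasD(1)[OF assms(1,2)]] smooth_atlasD(5)[OF assms(1,2)] assms(3)
    by blast
  then show ?thesis by (simp add: vimage_def Int_def conj_commute)
qed

lemma tmap_apply:
  "smooth_atlas A \<Longrightarrow> c \<in> A \<Longrightarrow> m \<in> fst c \<Longrightarrow> tmap c c' (snd c m) = snd c' m"
  by (simp add: tmap_def the_inv_into_f_f[OF smooth_atlasD(4)])

lemma smooth_tmap:
  assumes "smooth_atlas A" "c \<in> A" "c' \<in> A"
  shows "smooth_on (snd c ` (fst c \<inter> fst c')) (tmap c c')"
  using assms by (auto simp: smooth_atlas_def)

lemma chart_at:
  assumes "smooth_atlas A"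
  shows "chart_at A m \<in> A" "m \<in> fst (chart_at A m)"
proof -
  have "\<exists>c. c \<in> A \<and> m \<in> fst c" using assms unfolding smooth_atlas_def by blast
  then have "chart_at A m \<in> A \<and> m \<in> fst (chart_at A m)"
    unfolding chart_at_def by (rule someI_ex)
  then show "chart_at A m \<in> A" "m \<in> fst (chart_at A m)" by auto
qed

lemma xf_smooth_on_chart:
  assumes "smooth_atlas A" "\<forall>j<N0. smooth_vf A (X j)" "c \<in> A" "set I \<subseteq> {..<N0}"
  shows "smooth_on (snd c ` fst c) (xf X c I)"
  by (rule smooth_on_xf[OF smooth_atlasD(2)[OF assms(1,3)] assms(4)])
     (use assms in \<open>auto simp: smooth_vf_def\<close>)

lemma xf_change_of_chart:
  assumes atlas: "smooth_atlas A" and fields: "\<forall>j<N0. smooth_vf A (X j)"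
    and c: "c \<in> A" "c' \<in> A" and I: "set I \<subseteq> {..<N0}" and m: "m \<in> fst c" "m \<in> fst c'"
  shows "xf X c' I (snd c' m) = frechet_derivative (tmap c c') (at (snd c m)) (xf X c I (snd c m))"
proof -
  define U where "U = snd c ` (fst c \<inter> fst c')"
  have U: "open U" unfolding U_def
    by (rule open_chart_image[OF atlas c(1)]) (use smooth_atlasD(1)[OF atlas c(1)] smooth_atlasD(1)[OF atlas c(2)] in auto)
  have s: "smooth_on U (tmap c c')" unfolding U_def by (rule smooth_tmap[OF atlas c])
  have lin: "linear (frechet_derivative (tmap c c') (at y))" if "y \<in> U" for y
    by (rule linear_frechet_derivative[OF smooth_on_differentiable[OF U s that]])
  have vf: "X j c' (tmap c c' y) = frechet_derivative (tmap c c') (at y) (X j c y)" if jy: "j < N0" "y \<in> U" for j y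
  proof -
    obtain m where m: "m \<in> fst c \<inter> fst c'" "y = snd c m" using jy(2) unfolding U_def by blast
    have "smooth_vf A (X j)" using fields jy(1) by blast
    then have "X j c' (snd c' m) = frechet_derivative (tmap c c') (at (snd c m)) (X j c (snd c m))"
      using c m(1) unfolding smooth_vf_def by blast
    moreover have "tmap c c' (snd c m) = snd c' m"
      by (rule tmap_apply[OF atlas c(1)]) (use m(1) in blast)
    ultimately show ?thesis by (simp only: m(2))
  qed
  \<comment> \<open>The induction runs over the whole overlap and not only at m, because each
    further bracket differentiates the relation.\<close>
  have "\<forall>y\<in>U. xf X c' I (tmap c c' y) = frechet_derivative (tmap c c') (at y) (xf X c I y)"
    using I
  proof (induction I rule: induct_list012)
    case 1
    then show ?case using linear_0[OF lin] by simp
  next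
    case (2 j)
    then show ?case
      using vf[of j] by simp
  next
    case (3 j k I)
    have d: "xf X c J differentiable at y" "xf X c' J differentiable at (tmap c c' y)"
      if "y \<in> U" "set J \<subseteq> {..<N0}" for J y
    proof -
      show "xf X c J differentiable at y"
        by (rule smooth_on_differentiable[OF smooth_atlasD(2)[OF atlas c(1)] xf_smooth_on_chart[OF atlas fields c(1) that(2)]])
           (use that U_def in auto)
      show "xf X c' J differentiable at (tmap c c' y)"
        by (rule smooth_on_differentiable[OF smooth_atlasD(2)[OF atlas c(2)] xf_smooth_on_chart[OF atlas fields c(2) that(2)]])
           (use that U_def in \<open>auto simp: tmap_apply[OF atlas c(1)]\<close>)
    qed
    have e1: "\<And>y. y \<in> U \<Longrightarrow> X j c' (tmap c c' y) = frechet_derivative (tmap c c') (at y) (X j c y)"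
      using vf[of j] 3(3) by simp
    have e2: "\<And>y. y \<in> U \<Longrightarrow> xf X c' (k # I) (tmap c c' y) = frechet_derivative (tmap c c') (at y) (xf X c (k # I) y)"
      using 3 by simp
    show ?case
      using cbr_pushforward[OF U s _ _ _ _ _ e1 e2] d(1)[of _ "[j]"] d(2)[of _ "[j]"]
        d(1)[of _ "k # I"] d(2)[of _ "k # I"] 3(3) by simp
  qed
  then show ?thesis using m by (auto simp: U_def tmap_apply[OF atlas c(1)])
qed

section \<open>Determinants and quadratic forms\<close>

text \<open>Arbitrary finite index sets link \<open>det\<close>, indexed by a type, with
  \<open>detn\<close>, indexed by an initial segment, and let blocks be handled as subsets.\<close>

definition det_on :: "'i set \<Rightarrow> ('i \<Rightarrow> 'i \<Rightarrow> real) \<Rightarrow> real" where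
  "det_on S M = (\<Sum>p | p permutes S. of_int (sign p) * (\<Prod>i\<in>S. M i (p i)))"

text \<open>Conjugation by f matches the permutations of S with those of its image and keeps the
  sign.\<close>

lemma det_on_reindex:
  assumes "finite S" "inj_on f S"
  shows "det_on (f ` S) M = det_on S (\<lambda>i j. M (f i) (f j))"
proof -
  have bij: "bij_betw f S (f ` S)" using assms(2) by (rule inj_on_imp_bij_betw)
  show ?thesis
    unfolding det_on_def
  proof (rule sum.reindex_bij_witness[where i = "map_permutation S f" and
        j = "map_permutation (f ` S) (inv_into S f)"]; clarsimp)
    have inv: "bij_betw (inv_into S f) (f ` S) S" using bij by (rule bij_betw_inv_into)
    show "map_permutation (f ` S) (inv_into S f) p permutes S" if "p permutes f ` S" for p
      by (rule map_permutation_permutes[OF inv that])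
    show "map_permutation S f (map_permutation (f ` S) (inv_into S f) p) = p" if "p permutes f ` S" for p
      by (rule map_permutation_compose_inv[OF inv that]) (auto simp: f_inv_into_f)
    show "map_permutation S f p permutes f ` S" if "p permutes S" for p
      by (rule map_permutation_permutes[OF bij that])
    show m: "map_permutation (f ` S) (inv_into S f) (map_permutation S f p) = p" if "p permutes S" for p
      by (rule map_permutation_compose_inv[OF bij that]) (use assms(2) in auto)
    fix p assume p: "p permutes f ` S"
    define q where "q = map_permutation (f ` S) (inv_into S f) p"
    have q: "q permutes S" unfolding q_def by (rule map_permutation_permutes[OF inv p])
    have pq: "p = map_permutation S f q"
      unfolding q_def by (rule map_permutation_compose_inv[OF inv p, symmetric]) (auto simp: f_inv_into_f)
    have "sign p = sign q"
      unfolding pq by (rule sign_map_permutation[OF assms(2) q assms(1)])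
    moreover have "(\<Prod>i\<in>f ` S. M i (p i)) = (\<Prod>i\<in>S. M (f i) (f (q i)))"
      by (subst prod.reindex[OF assms(2)]) (simp add: pq map_permutation_apply[OF assms(2)])
    ultimately show "real_of_int (sign (map_permutation (f ` S) (inv_into S f) p)) *
         (\<Prod>i\<in>S. M (f i) (f (map_permutation (f ` S) (inv_into S f) p i))) =
         real_of_int (sign p) * (\<Prod>i\<in>f ` S. M i (p i))"
      by (simp add: q_def)
  qed
qed

text \<open>A permutation contributes only if it sends no index of S into T. By finiteness it then
  preserves S and T separately, and the sum factors over pairs of permutations. Vanishing of one
  off-diagonal block suffices.\<close>

lemma det_on_Un:
  assumes "finite S" "finite T" "S \<inter> T = {}" and zero: "\<And>i j. i \<in> S \<Longrightarrow> j \<in> T \<Longrightarrow> M i j = 0"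
  shows "det_on (S \<union> T) M = det_on S M * det_on T M"
proof -
  define t where "t = (\<lambda>p. real_of_int (sign p) * (\<Prod>i\<in>S \<union> T. M i (p i)))"
  define Q where "Q = {p. p permutes (S \<union> T) \<and> p ` S \<subseteq> S}"
  have "det_on (S \<union> T) M = sum t {p. p permutes (S \<union> T)}" by (simp add: det_on_def t_def)
  also have "\<dots> = sum t Q"
  proof (rule sum.mono_neutral_right)
    show "finite {p. p permutes (S \<union> T)}" using assms by (simp add: finite_permutations)
    show "Q \<subseteq> {p. p permutes (S \<union> T)}" by (auto simp: Q_def)
    show "\<forall>p\<in>{p. p permutes S \<union> T} - Q. t p = 0"
    proof
      fix p assume "p \<in> {p. p permutes S \<union> T} - Q"
      then obtain i where p: "p permutes (S \<union> T)" and i: "i \<in> S" "p i \<notin> S" by (auto simp: Q_def)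
      then have "p i \<in> T" using permutes_in_image[OF p, of i] by auto
      then have "M i (p i) = 0" using i zero by auto
      then have "(\<Prod>i\<in>S \<union> T. M i (p i)) = 0" using i assms by (intro prod_zero) auto
      then show "t p = 0" by (simp add: t_def)
    qed
  qed
  also have "\<dots> = (\<Sum>(q, r)\<in>{q. q permutes S} \<times> {r. r permutes T}.
      (real_of_int (sign q) * (\<Prod>i\<in>S. M i (q i))) * (real_of_int (sign r) * (\<Prod>i\<in>T. M i (r i))))"
  proof (rule sum.reindex_bij_witness[where i = "\<lambda>(q, r). q \<circ> r" and j = "\<lambda>p. (restrict_id p S, restrict_id p T)"])
    fix p assume "p \<in> Q"
    then have p: "p permutes (S \<union> T)" "p ` S \<subseteq> S" by (auto simp: Q_def)
    have pS: "bij_betw p S S"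
      using p(2) endo_inj_surj[OF assms(1) p(2) permutes_inj_on[OF p(1)]] permutes_inj_on[OF p(1)]
      by (auto simp: bij_betw_def)
    have "p ` T = T"
    proof -
      have "p ` T = p ` (S \<union> T) - p ` S"
        using assms(3) image_set_diff[OF permutes_inj[OF p(1)], of "S \<union> T" S] by (metis Diff_cancel Un_Diff Un_Diff_Int Un_commute inf_commute sup_bot.right_neutral)
      also have "\<dots> = T" using permutes_image[OF p(1)] pS assms(3) by (auto simp: bij_betw_def)
      finally show ?thesis .
    qed
    then have pT: "bij_betw p T T" using permutes_inj_on[OF p(1)] by (auto simp: bij_betw_def)
    have rS: "restrict_id p S permutes S" and rT: "restrict_id p T permutes T"
      using pS pT by (auto intro: permutes_restrict_id)
    then show "(\<lambda>p. (restrict_id p S, restrict_id p T)) p \<in> {q. q permutes S} \<times> {r. r permutes T}" by simp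
    show comp: "(\<lambda>(q, r). q \<circ> r) (restrict_id p S, restrict_id p T) = p"
    proof
      fix x
      show "(\<lambda>(q, r). q \<circ> r) (restrict_id p S, restrict_id p T) x = p x"
        using assms(3) permutes_in_image[OF rT, of x] permutes_not_in[OF p(1), of x]
        by (auto simp: restrict_id_def)
    qed
    have "sign p = sign (restrict_id p S) * sign (restrict_id p T)"
      using sign_compose[of "restrict_id p S" "restrict_id p T"] rS rT assms comp
      by (auto simp: permutation_permutes)
    moreover have "(\<Prod>i\<in>S \<union> T. M i (p i)) = (\<Prod>i\<in>S. M i (restrict_id p S i)) * (\<Prod>i\<in>T. M i (restrict_id p T i))"
      by (subst prod.union_disjoint) (use assms in auto)
    ultimately show "(case (restrict_id p S, restrict_id p T) of (q, r) \<Rightarrow>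
      (real_of_int (sign q) * (\<Prod>i\<in>S. M i (q i))) * (real_of_int (sign r) * (\<Prod>i\<in>T. M i (r i)))) = t p"
      by (simp add: t_def)
  next
    fix b assume "b \<in> {q. q permutes S} \<times> {r. r permutes T}"
    then obtain q r where b: "b = (q, r)" and q: "q permutes S" and r: "r permutes T" by auto
    have s: "(q \<circ> r) x = (if x \<in> S then q x else if x \<in> T then r x else x)" for x
      using assms(3) permutes_in_image[OF r, of x] permutes_not_in[OF r, of x] permutes_not_in[OF q]
      by auto
    have "q x \<in> S \<longleftrightarrow> x \<in> S" "r x \<in> T \<longleftrightarrow> x \<in> T" for x using permutes_in_image q r by metis+
    then have "restrict_id (q \<circ> r) S = q" "restrict_id (q \<circ> r) T = r"
      using assms(3) permutes_not_in[OF q] permutes_not_in[OF r] unfolding restrict_id_def s fun_eq_iff by auto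
    then show "(\<lambda>p. (restrict_id p S, restrict_id p T)) ((\<lambda>(q, r). q \<circ> r) b) = b" by (simp add: b)
    have "q \<circ> r permutes S \<union> T"
      by (rule permutes_compose) (use permutes_subset[OF q] permutes_subset[OF r] in auto)
    moreover have "(q \<circ> r) ` S \<subseteq> S" using permutes_in_image[OF q] s by auto
    ultimately show "(\<lambda>(q, r). q \<circ> r) b \<in> Q" by (simp add: Q_def b)
  qed
  also have "\<dots> = det_on S M * det_on T M"
    by (simp add: det_on_def sum_product sum.cartesian_product)
  finally show ?thesis .
qed

lemma detn_eq_det_on: "detn n M = det_on {..<n} M"
  by (simp add: detn_def det_on_def)

lemma det_on_cong: "(\<And>i j. i \<in> S \<Longrightarrow> j \<in> S \<Longrightarrow> M i j = M' i j) \<Longrightarrow> det_on S M = det_on S M'"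
  unfolding det_on_def by (intro sum.cong refl arg_cong2[where f = "(*)"] prod.cong) (auto simp: permutes_in_image)

lemma detn_add:
  assumes "\<And>i j. i < a \<Longrightarrow> a \<le> j \<Longrightarrow> j < a + b \<Longrightarrow> M i j = 0"
  shows "detn (a + b) M = detn a M * detn b (\<lambda>k l. M (a + k) (a + l))"
proof -
  have "{..<a + b} = {..<a} \<union> (+) a ` {..<b}"
    using image_add_atLeastLessThan[of a 0 b] by (auto simp: lessThan_atLeast0)
  then have "detn (a + b) M = det_on ({..<a} \<union> (+) a ` {..<b}) M"
    by (simp add: detn_eq_det_on)
  also have "\<dots> = det_on {..<a} M * det_on ((+) a ` {..<b}) M"
    by (rule det_on_Un) (auto intro!: assms)
  also have "det_on ((+) a ` {..<b}) M = det_on {..<b} (\<lambda>k l. M (a + k) (a + l))"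
    by (rule det_on_reindex) auto
  finally show ?thesis by (simp add: detn_eq_det_on)
qed

text \<open>In the application n is the growth vector of the flag, so the blocks are the layers of
  successive new directions; the last one is split off in each step.\<close>

lemma detn_block_diagonal:
  fixes n :: "nat \<Rightarrow> nat"
  assumes "mono n" and "\<And>i a b. i < r \<Longrightarrow> a < n i \<Longrightarrow> n i \<le> b \<Longrightarrow> b < n (Suc i) \<Longrightarrow> M a b = 0"
  shows "detn (n r) M = detn (n 0) M * (\<Prod>j\<in>{1..r}. detn (n j - n (j - 1)) (\<lambda>k l. M (n (j - 1) + k) (n (j - 1) + l)))"
  using assms(2)
proof (induction r)
  case (Suc r)
  have "n r \<le> n (Suc r)" using assms(1) by (simp add: monoD)
  then have "detn (n (Suc r)) M = detn (n r) M * detn (n (Suc r) - n r) (\<lambda>k l. M (n r + k) (n r + l))"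
    using detn_add[of "n r" "n (Suc r) - n r" M] Suc.prems[of r] by simp
  moreover have "detn (n r) M = detn (n 0) M *
      (\<Prod>j\<in>{1..r}. detn (n j - n (j - 1)) (\<lambda>k l. M (n (j - 1) + k) (n (j - 1) + l)))"
    by (rule Suc.IH) (use Suc.prems less_SucI in blast)
  ultimately show ?case by (simp add: mult.assoc)
qed simp

section \<open>Translation between a finite index type and an initial segment of the
  naturals\<close>

lemma enum_idx_bij: "bij_betw (enum_idx :: 'n::finite \<Rightarrow> nat) UNIV {..<CARD('n)}"
proof -
  have "\<exists>f :: 'n \<Rightarrow> nat. bij_betw f UNIV {..<CARD('n)}"
    using ex_bij_betw_finite_nat[of "UNIV :: 'n set"] by (auto simp: atLeast0LessThan)
  then show ?thesis unfolding enum_idx_def by (rule someI_ex)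
qed

lemma enum_idx_less: "enum_idx (k :: 'n::finite) < CARD('n)"
  using enum_idx_bij bij_betwE by blast

lemma sum_enum_idx: "(\<Sum>k\<in>(UNIV :: 'n::finite set). f (enum_idx k)) = (\<Sum>a<CARD('n). f a)"
  using sum.reindex_bij_betw[OF enum_idx_bij] by blast

lemma det_enum_idx: "det (\<chi> k l :: 'n::finite. M (enum_idx k) (enum_idx l)) = detn CARD('n) M"
proof -
  have "det (\<chi> k l :: 'n. M (enum_idx k) (enum_idx l)) = det_on (UNIV :: 'n set) (\<lambda>k l. M (enum_idx k) (enum_idx l))"
    by (simp add: det_def det_on_def)
  also have "\<dots> = det_on (enum_idx ` (UNIV :: 'n set)) M"
    by (rule det_on_reindex[symmetric]) (use enum_idx_bij[where 'n = 'n] in \<open>auto simp: bij_betw_def\<close>)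
  also have "enum_idx ` (UNIV :: 'n set) = {..<CARD('n)}"
    using enum_idx_bij[where 'n = 'n] by (simp add: bij_betw_def)
  finally show ?thesis by (simp add: detn_eq_det_on)
qed

text \<open>The segment from the identity to A stays in the positive definite matrices, so the
  determinant cannot change sign along it.\<close>
lemma pos_def_det_pos:
  fixes A :: "real^'n^'n"
  assumes "\<And>x. x \<noteq> 0 \<Longrightarrow> x \<bullet> (A *v x) > 0"
  shows "det A > 0"
proof (rule ccontr)
  assume "\<not> det A > 0"
  define f where "f = (\<lambda>t. det (\<chi> i j. (1 - t) * (mat 1 :: real^'n^'n) $ i $ j + t * A $ i $ j))"
  have B: "(\<chi> i j. (1 - t) * (mat 1 :: real^'n^'n) $ i $ j + t * A $ i $ j) = (1 - t) *\<^sub>R mat 1 + t *\<^sub>R A" for t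
    by (simp add: vec_eq_iff)
  have "f 0 = 1" "f 1 = det A" by (simp_all add: f_def B)
  moreover have "continuous_on {0..1} f"
    unfolding f_def det_def by (auto intro!: continuous_intros)
  ultimately obtain t where t: "0 \<le> t" "t \<le> 1" "f t = 0"
    using IVT2'[of f 1 0 0] \<open>\<not> det A > 0\<close> by auto
  then have "\<not> invertible ((1 - t) *\<^sub>R mat 1 + t *\<^sub>R A)"
    by (simp add: invertible_det_nz f_def B)
  then obtain x where x: "x \<noteq> 0" "((1 - t) *\<^sub>R mat 1 + t *\<^sub>R A) *v x = 0"
    using matrix_left_invertible_ker invertible_left_inverse by blast
  have "(1 - t) * (x \<bullet> x) + t * (x \<bullet> (A *v x)) = 0"
    using arg_cong[OF x(2), of "\<lambda>y. x \<bullet> y"]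
    by (simp add: matrix_vector_mult_add_rdistrib scaleR_matrix_vector_assoc[symmetric] inner_add_right)
  moreover have "x \<bullet> x > 0" "x \<bullet> (A *v x) > 0" using x assms by auto
  moreover have "0 \<le> (1 - t) * (x \<bullet> x)" "0 \<le> t * (x \<bullet> (A *v x))" using t calculation by auto
  ultimately have "(1 - t) * (x \<bullet> x) = 0" "t * (x \<bullet> (A *v x)) = 0" by linarith+
  with \<open>x \<bullet> x > 0\<close> \<open>x \<bullet> (A *v x) > 0\<close> show False by simp
qed

section \<open>Cometrics and the quadratic forms of least norm that they determine\<close>

definition cometric :: "'i set \<Rightarrow> ('i \<Rightarrow> real^'n) \<Rightarrow> real^'n^'n" where
  "cometric S V = (\<chi> k l. \<Sum>i\<in>S. V i $ k * V i $ l)"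

lemma cometric_cong: "(\<And>i. i \<in> S \<Longrightarrow> v i = w i) \<Longrightarrow> cometric S v = cometric S w"
  by (simp add: cometric_def)

lemma cometric_mult_vec: "cometric S V *v x = (\<Sum>i\<in>S. (V i \<bullet> x) *\<^sub>R V i)"
proof -
  have "(\<Sum>j\<in>UNIV. (\<Sum>i\<in>S. V i $ k * V i $ j) * x $ j) = (\<Sum>i\<in>S. (\<Sum>j\<in>UNIV. V i $ j * x $ j) * V i $ k)" for k
    unfolding sum_distrib_right by (subst sum.swap) (simp add: mult_ac)
  then show ?thesis
    by (simp add: vec_eq_iff matrix_vector_mult_def cometric_def inner_vec_def)
qed

lemma inner_cometric: "x \<bullet> (cometric S V *v y) = (\<Sum>i\<in>S. (V i \<bullet> x) * (V i \<bullet> y))"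
  by (simp add: cometric_mult_vec inner_sum_right inner_commute mult.commute)

lemma cometric_image: "cometric S (\<lambda>i. J *v V i) = J ** cometric S V ** transpose J"
proof -
  have "(\<Sum>i\<in>S. (\<Sum>a\<in>UNIV. J $ k $ a * V i $ a) * (\<Sum>b\<in>UNIV. J $ l $ b * V i $ b))
      = (\<Sum>b\<in>UNIV. (\<Sum>a\<in>UNIV. J $ k $ a * (\<Sum>i\<in>S. V i $ a * V i $ b)) * J $ l $ b)" for k l
  proof -
    have "(\<Sum>i\<in>S. (\<Sum>a\<in>UNIV. J $ k $ a * V i $ a) * (\<Sum>b\<in>UNIV. J $ l $ b * V i $ b))
        = (\<Sum>i\<in>S. \<Sum>b\<in>UNIV. \<Sum>a\<in>UNIV. J $ k $ a * V i $ a * (J $ l $ b * V i $ b))"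
      by (simp add: sum_product) (subst sum.swap, rule refl)
    also have "\<dots> = (\<Sum>b\<in>UNIV. \<Sum>a\<in>UNIV. \<Sum>i\<in>S. J $ k $ a * V i $ a * (J $ l $ b * V i $ b))"
      by (subst sum.swap) (intro sum.cong refl sum.swap)
    finally show ?thesis by (simp add: sum_distrib_left sum_distrib_right mult_ac)
  qed
  then show ?thesis
    by (simp add: vec_eq_iff cometric_def matrix_matrix_mult_def matrix_vector_mult_def transpose_def)
qed

lemma det_cometric_pos:
  fixes V :: "'i \<Rightarrow> real^'n"
  assumes "finite S" and nondeg: "\<And>x. (\<And>i. i \<in> S \<Longrightarrow> V i \<bullet> x = 0) \<Longrightarrow> x = 0"
  shows "det (cometric S V) > 0"
proof (rule pos_def_det_pos)
  fix x :: "real^'n" assume "x \<noteq> 0"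
  then obtain i where "i \<in> S" "V i \<bullet> x \<noteq> 0" using nondeg by blast
  then have "(\<Sum>i\<in>S. (V i \<bullet> x) * (V i \<bullet> x)) > 0"
    using assms(1) by (intro sum_pos2[of S i]) (auto simp: zero_less_mult_iff)
  then show "x \<bullet> (cometric S V *v x) > 0" by (simp add: inner_cometric)
qed

lemma span_nondegenerate:
  fixes V :: "'i \<Rightarrow> real^'n"
  assumes "x \<in> span (V ` S)" "\<And>i. i \<in> S \<Longrightarrow> V i \<bullet> x = 0"
  shows "x = 0"
proof -
  have "orthogonal x x"
    by (rule orthogonal_to_span[OF assms(1)]) (use assms(2) in \<open>auto simp: orthogonal_def inner_commute\<close>)
  then show ?thesis by (simp add: orthogonal_def)
qed

text \<open>Decompose v orthogonally into y in the range of the cometric and a residual z. As z is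
  orthogonal to its own image, the sum of the squares of V i \<bullet> z is 0; but z lies in the
  span of the V i, so z = 0. The family may be degenerate, as it is for the sub-Riemannian
  metric.\<close>

lemma cometric_range:
  fixes V :: "'i \<Rightarrow> real^'n"
  assumes "finite S" "v \<in> span (V ` S)"
  obtains x where "cometric S V *v x = v"
proof -
  let ?R = "range (\<lambda>x. cometric S V *v x)"
  have R: "span ?R = ?R"
    by (intro span_eq_iff[THEN iffD2] linear_subspace_image[OF matrix_vector_mul_linear] subspace_UNIV)
  obtain y z where yz: "y \<in> span ?R" "\<And>w. w \<in> span ?R \<Longrightarrow> orthogonal z w" "v = y + z"
    using orthogonal_subspace_decomp_exists[of ?R v] by metis
  obtain x where x: "y = cometric S V *v x" using yz(1) R by auto
  have "orthogonal z (cometric S V *v z)" using yz(2) R by blast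
  then have "(\<Sum>i\<in>S. (V i \<bullet> z) * (V i \<bullet> z)) = 0" by (simp add: orthogonal_def inner_cometric)
  then have s: "i \<in> S \<Longrightarrow> V i \<bullet> z = 0" for i
    using assms(1) by (subst (asm) sum_nonneg_eq_0_iff) auto
  have "y \<in> span (V ` S)"
    unfolding x cometric_mult_vec by (intro span_sum span_scale span_base) auto
  then have "z \<in> span (V ` S)" using assms(2) yz(3) span_diff by fastforce
  then have "z = 0" by (rule span_nondegenerate) (use s in auto)
  then show ?thesis using that x yz(3) by simp
qed

lemma det_on_identity: "finite S \<Longrightarrow> det_on S (\<lambda>i j. if i = j then 1 else 0) = 1"
proof -
  assume S: "finite S"
  have "(\<Prod>i\<in>S. if i = p i then 1 else 0 :: real) = 0" if "p permutes S" "p \<noteq> id" for p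
    using that S permutes_not_in[OF that(1)] by (intro prod_zero) (auto simp: fun_eq_iff, metis)
  then have "det_on S (\<lambda>i j. if i = j then 1 else 0) =
     (\<Sum>p\<in>{id}. of_int (sign p) * (\<Prod>i\<in>S. if i = p i then 1 else 0))"
    unfolding det_on_def using S
    by (intro sum.mono_neutral_right) (auto simp: finite_permutations)
  then show ?thesis by simp
qed

text \<open>The common shape of \<open>g0\<close> and, after rescaling the fields, of
  \<open>gh\<close>. Outside the span of the V i the infimum is taken over the empty set; the
  results below only concern vectors in the image of the cometric.\<close>

definition inf_form :: "'i set \<Rightarrow> ('i \<Rightarrow> real^'n) \<Rightarrow> real^'n \<Rightarrow> real" where
  "inf_form S V v = Inf {(\<Sum>i\<in>S. (u i)\<^sup>2) | u. (\<Sum>i\<in>S. u i *\<^sub>R V i) = v}"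

text \<open>On the image of the cometric the infimum is attained at the coefficients V i \<bullet> x.\<close>
lemma inf_form_cometric: "inf_form S V (cometric S V *v x) = x \<bullet> (cometric S V *v x)"
  unfolding inf_form_def
proof (rule cInf_eq_minimum)
  show "x \<bullet> (cometric S V *v x) \<in> {(\<Sum>i\<in>S. (u i)\<^sup>2) | u. (\<Sum>i\<in>S. u i *\<^sub>R V i) = cometric S V *v x}"
    by (rule CollectI, rule exI[of _ "\<lambda>i. V i \<bullet> x"])
       (simp add: inner_cometric cometric_mult_vec[symmetric] power2_eq_square)
next
  fix s assume "s \<in> {(\<Sum>i\<in>S. (u i)\<^sup>2) | u. (\<Sum>i\<in>S. u i *\<^sub>R V i) = cometric S V *v x}"
  then obtain u where u: "s = (\<Sum>i\<in>S. (u i)\<^sup>2)" "(\<Sum>i\<in>S. u i *\<^sub>R V i) = cometric S V *v x" by blast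
  \<comment> \<open>In this completed square the cross term depends on u only through the
    constraint.\<close>
  have "0 \<le> (\<Sum>i\<in>S. (u i - V i \<bullet> x)\<^sup>2)" by (intro sum_nonneg) simp
  also have "\<dots> = s - 2 * (\<Sum>i\<in>S. u i * (V i \<bullet> x)) + (\<Sum>i\<in>S. (V i \<bullet> x) * (V i \<bullet> x))"
    by (simp add: u(1) power2_diff sum.distrib sum_subtractf sum_distrib_left power2_eq_square algebra_simps)
  also have "(\<Sum>i\<in>S. u i * (V i \<bullet> x)) = x \<bullet> (\<Sum>i\<in>S. u i *\<^sub>R V i)"
    by (simp add: inner_sum_right inner_commute)
  also have "(\<Sum>i\<in>S. (V i \<bullet> x) * (V i \<bullet> x)) = x \<bullet> (cometric S V *v x)" by (simp add: inner_cometric)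
  finally show "x \<bullet> (cometric S V *v x) \<le> s" by (simp add: u(2))
qed

lemma polar_inf_form:
  "polar (inf_form S V) (cometric S V *v x) (cometric S V *v y) = x \<bullet> (cometric S V *v y)"
proof -
  have "y \<bullet> (cometric S V *v x) = x \<bullet> (cometric S V *v y)" by (simp add: inner_cometric mult.commute)
  then show ?thesis
    unfolding polar_def matrix_vector_right_distrib[symmetric] inf_form_cometric
    by (simp add: inner_add_left inner_add_right matrix_vector_right_distrib)
qed

text \<open>The Gram matrix is the inverse of the cometric G: if G maps \<xi>_k to the k-th standard
  basis vector, polarization gives the l-th component of \<xi>_k as the entry at (k, l).\<close>

lemma det_gram_inf_form:
  assumes "det (cometric S V) \<noteq> 0"
  shows "det (gram (inf_form S V)) * det (cometric S V) = 1"
proof -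
  have "\<exists>x. cometric S V *v x = y" for y
    using assms by (metis invertible_det_nz invertible_right_inverse matrix_vector_mul_assoc matrix_vector_mul_lid)
  then have "\<forall>k. \<exists>x. cometric S V *v x = axis k 1" by blast
  from choice[OF this] obtain \<xi> where \<xi>: "\<And>k. cometric S V *v \<xi> k = axis k 1" by blast
  have g: "gram (inf_form S V) $ k $ l = \<xi> k $ l" for k l
    using polar_inf_form[of S V "\<xi> k" "\<xi> l"] by (simp add: gram_def \<xi> inner_axis)
  have sym: "cometric S V $ l $ m = cometric S V $ m $ l" for l m
    by (simp add: cometric_def mult.commute)
  have "(gram (inf_form S V) ** cometric S V) $ k $ m = (cometric S V *v \<xi> k) $ m" for k m
    by (simp add: matrix_matrix_mult_def matrix_vector_mult_def g sym[of _ m] mult.commute)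
  then have "gram (inf_form S V) ** cometric S V = mat 1"
    by (simp add: vec_eq_iff \<xi> mat_def axis_def)
  then show ?thesis by (metis det_I det_mul)
qed

section \<open>Smooth frames\<close>

lemma independent_family_zero:
  fixes f :: "'i \<Rightarrow> 'v::real_vector"
  assumes "finite S" "inj_on f S" "independent (f ` S)" "(\<Sum>a\<in>S. b a *\<^sub>R f a) = 0" "a \<in> S"
  shows "b a = 0"
proof -
  have "(\<Sum>v\<in>f ` S. b (inv_into S f v) *\<^sub>R v) = 0"
    using assms by (simp add: sum.reindex)
  from independentD[OF assms(3) _ subset_refl this, of "f a"] assms show ?thesis by simp
qed

lemma independent_familyI:
  fixes f :: "'i \<Rightarrow> 'v::real_vector"
  assumes "finite S" and z: "\<And>b a. (\<Sum>a\<in>S. b a *\<^sub>R f a) = 0 \<Longrightarrow> a \<in> S \<Longrightarrow> b a = 0"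
  shows "inj_on f S" "independent (f ` S)"
proof -
  show inj: "inj_on f S"
  proof (rule inj_onI, rule ccontr)
    fix x y assume xy: "x \<in> S" "y \<in> S" "f x = f y" "x \<noteq> y"
    have "(\<Sum>a\<in>S. (if a = x then 1 else if a = y then -1 else 0) *\<^sub>R f a)
        = (\<Sum>a\<in>{x, y}. (if a = x then 1 else if a = y then -1 else 0) *\<^sub>R f a)"
      by (rule sum.mono_neutral_right) (use assms(1) xy in auto)
    also have "\<dots> = 0" using xy by simp
    finally show False using z[of "\<lambda>a. if a = x then 1 else if a = y then -1 else 0" x] xy by simp
  qed
  show "independent (f ` S)"
  proof (rule independent_if_scalars_zero)
    fix g v assume g: "(\<Sum>x\<in>f ` S. g x *\<^sub>R x) = 0" "v \<in> f ` S"
    have "(\<Sum>a\<in>S. g (f a) *\<^sub>R f a) = 0" using g(1) inj by (simp add: sum.reindex)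
    then show "g v = 0" using z[of "\<lambda>a. g (f a)"] g(2) by auto
  qed (use assms in auto)
qed

section \<open>Frames as invertible matrices\<close>

definition frame_at :: "(nat \<Rightarrow> real^'n \<Rightarrow> real^'n) \<Rightarrow> real^'n \<Rightarrow> bool" where
  "frame_at Z p \<longleftrightarrow> inj_on (\<lambda>a. Z a p) {..<CARD('n)} \<and> independent ((\<lambda>a. Z a p) ` {..<CARD('n)})"

definition frame_matrix :: "(nat \<Rightarrow> real^'n \<Rightarrow> real^'n) \<Rightarrow> real^'n \<Rightarrow> real^'n^'n" where
  "frame_matrix Z p = (\<chi> i k. Z (enum_idx k) p $ i)"

lemma frame_matrix_mult_vec:
  "frame_matrix Z p *v x = (\<Sum>k\<in>UNIV. x $ k *\<^sub>R Z (enum_idx k) p)"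
  by (simp add: vec_eq_iff matrix_vector_mult_def frame_matrix_def mult.commute)

lemma frame_matrix_enum:
  fixes Z :: "nat \<Rightarrow> real^'n \<Rightarrow> real^'n"
  shows "frame_matrix Z p *v (\<chi> k. b (enum_idx k)) = (\<Sum>a<CARD('n). b a *\<^sub>R Z a p)"
  using sum_enum_idx[where 'n = 'n, of "\<lambda>a. b a *\<^sub>R Z a p"] by (simp add: frame_matrix_mult_vec)

lemma enum_idx_surj:
  assumes "a < CARD('n::finite)"
  obtains k :: "'n::finite" where "enum_idx k = a"
  using enum_idx_bij[where 'n = 'n] assms by (metis bij_betw_iff_bijections lessThan_iff)

lemma exists_enum_coefficients:
  fixes x :: "real^'n"
  obtains b where "x = (\<chi> k. b (enum_idx k))"
proof
  show "x = (\<chi> k. (\<lambda>a. x $ inv (enum_idx :: 'n \<Rightarrow> nat) a) (enum_idx k))"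
    using inv_f_f[OF bij_betw_imp_inj_on[OF enum_idx_bij[where 'n = 'n]]] by (simp add: vec_eq_iff)
qed

lemma det_nonzero_iff_ker:
  fixes M :: "real^'n^'n"
  shows "det M \<noteq> 0 \<longleftrightarrow> (\<forall>x. M *v x = 0 \<longrightarrow> x = 0)"
  by (simp add: invertible_det_nz[symmetric] invertible_left_inverse matrix_left_invertible_ker)

lemma frame_at_iff_det: "frame_at Z p \<longleftrightarrow> det (frame_matrix Z p) \<noteq> 0"
proof
  assume f: "frame_at Z p"
  have "x = 0" if x: "frame_matrix Z p *v x = 0" for x
  proof -
    obtain b where b: "x = (\<chi> k. b (enum_idx k))" by (rule exists_enum_coefficients)
    have s: "(\<Sum>a<CARD('a). b a *\<^sub>R Z a p) = 0"
      using x unfolding b by (simp add: frame_matrix_enum)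
    have "b a = 0" if "a < CARD('a)" for a
      by (rule independent_family_zero[OF _ _ _ s]) (use f that in \<open>auto simp: frame_at_def\<close>)
    then show "x = 0" by (simp add: b vec_eq_iff enum_idx_less)
  qed
  then show "det (frame_matrix Z p) \<noteq> 0"
    by (simp add: det_nonzero_iff_ker)
next
  assume "det (frame_matrix Z p) \<noteq> 0"
  then have k: "x = 0" if "frame_matrix Z p *v x = 0" for x
    using that by (simp add: det_nonzero_iff_ker)
  have "b a = 0" if "(\<Sum>a<CARD('a). b a *\<^sub>R Z a p) = 0" "a < CARD('a)" for b a
  proof -
    have "(\<chi> k. b (enum_idx k)) = (0 :: real^'a)" using k that(1) by (simp add: frame_matrix_enum)
    then show ?thesis using enum_idx_surj[OF that(2)] by (metis vec_lambda_beta zero_index)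
  qed
  then show "frame_at Z p"
    unfolding frame_at_def using independent_familyI[of "{..<CARD('a)}" "\<lambda>a. Z a p"] by auto
qed

text \<open>The solution of a linear system as a quotient of determinants. This explicit form makes
  its smooth dependence on the matrix and on the right-hand side visible.\<close>

definition cramer_vec :: "real^'n^'n \<Rightarrow> real^'n \<Rightarrow> real^'n" where
  "cramer_vec M w = (\<chi> k. det (\<chi> i j. if j = k then w $ i else M $ i $ j) / det M)"

lemma cramer_vec: "det M \<noteq> 0 \<Longrightarrow> M *v x = w \<longleftrightarrow> x = cramer_vec M w"
  unfolding cramer_vec_def by (rule cramer)

lemma smooth_on_divide:
  fixes f g :: "'a::euclidean_space \<Rightarrow> real"
  assumes "open U" "smooth_on U f" "smooth_on U g" "\<And>x. x \<in> U \<Longrightarrow> g x \<noteq> 0"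
  shows "smooth_on U (\<lambda>x. f x / g x)"
proof (rule smooth_on_cong[OF assms(1)])
  \<comment> \<open>\<open>smooth_on_powr\<close> requires a positive base, so 1 / g is written as g
    times the inverse of its square, which also covers negative g.\<close>
  show "smooth_on U (\<lambda>x. f x * (g x * (g x * g x) powr (-1)))"
    by (intro smooth_on_mult smooth_on_powr assms(1-3)) (use assms(4) in \<open>auto simp: zero_less_mult_iff linorder_neq_iff\<close>)
  show "f x * (g x * (g x * g x) powr (-1)) = f x / g x" if "x \<in> U" for x
    using assms(4)[OF that] by (simp add: powr_minus field_simps powr_one_gt_zero_iff)
qed

lemma smooth_on_cramer_vec:
  assumes "open U" "\<And>i j. smooth_on U (\<lambda>x. M x $ i $ j)" "smooth_on U w" "\<And>x. x \<in> U \<Longrightarrow> det (M x) \<noteq> 0"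
  shows "smooth_on U (\<lambda>x. cramer_vec (M x) (w x))"
  unfolding cramer_vec_def
proof (intro smooth_on_vec_lambda smooth_on_divide smooth_on_det assms)
  show "smooth_on U (\<lambda>x. (\<chi> i j. if j = k then w x $ i else M x $ i $ j) $ i $ j)" for k i j
    using assms smooth_on_vec_nth[OF assms(1,3)] by (cases "j = k") auto
qed

lemma fcoef_eq:
  fixes Z :: "nat \<Rightarrow> real^'n \<Rightarrow> real^'n"
  assumes "frame_at Z p" "(\<Sum>a<CARD('n). b a *\<^sub>R Z a p) = w" "a < CARD('n)"
  shows "fcoef Z p w a = b a"
proof -
  \<comment> \<open>\<open>fcoef\<close> is a unique function on all naturals only because it must
    vanish from CARD('n) on; b has to be cut off accordingly.\<close>
  define b' where "b' = (\<lambda>a. if a < CARD('n) then b a else 0)"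
  have "fcoef Z p w = b'"
    unfolding fcoef_def
  proof (rule the_equality)
    show "(\<Sum>a<CARD('n). b' a *\<^sub>R Z a p) = w \<and> (\<forall>a\<ge>CARD('n). b' a = 0)"
      using assms(2) by (simp add: b'_def)
  next
    fix c assume c: "(\<Sum>a<CARD('n). c a *\<^sub>R Z a p) = w \<and> (\<forall>a\<ge>CARD('n). c a = 0)"
    have s: "(\<Sum>a<CARD('n). (c a - b a) *\<^sub>R Z a p) = 0"
      using c assms(2) by (simp add: scaleR_diff_left sum_subtractf)
    have "c a - b a = 0" if "a < CARD('n)" for a
      by (rule independent_family_zero[OF _ _ _ s]) (use assms(1) that in \<open>auto simp: frame_at_def\<close>)
    then show "c = b'" using c by (auto simp: b'_def fun_eq_iff not_less)
  qed
  then show ?thesis using assms(3) by (simp add: b'_def)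
qed

lemma fcoef_cramer_vec:
  fixes Z :: "nat \<Rightarrow> real^'n \<Rightarrow> real^'n"
  assumes "frame_at Z p"
  shows "fcoef Z p w (enum_idx k) = cramer_vec (frame_matrix Z p) w $ k"
proof -
  obtain b where b: "cramer_vec (frame_matrix Z p) w = (\<chi> k. b (enum_idx k))"
    by (rule exists_enum_coefficients)
  have "frame_matrix Z p *v cramer_vec (frame_matrix Z p) w = w"
    using assms cramer_vec frame_at_iff_det by blast
  then have "(\<Sum>a<CARD('n). b a *\<^sub>R Z a p) = w" by (simp add: b frame_matrix_enum)
  from fcoef_eq[OF assms this enum_idx_less] show ?thesis by (simp add: b)
qed

lemma fcoef_sum:
  fixes Z :: "nat \<Rightarrow> real^'n \<Rightarrow> real^'n"
  assumes "frame_at Z p"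
  shows "(\<Sum>a<CARD('n). fcoef Z p w a *\<^sub>R Z a p) = w"
proof -
  have "frame_matrix Z p *v (\<chi> k. fcoef Z p w (enum_idx k)) = w"
    using assms cramer_vec frame_at_iff_det by (simp add: fcoef_cramer_vec) blast
  then show ?thesis by (simp add: frame_matrix_enum)
qed

lemma fcoef_linear:
  fixes Z :: "nat \<Rightarrow> real^'n \<Rightarrow> real^'n"
  assumes "frame_at Z p" "a < CARD('n)"
  shows "linear (\<lambda>w. fcoef Z p w a)"
proof
  show "fcoef Z p (v + w) a = fcoef Z p v a + fcoef Z p w a" for v w
    by (rule fcoef_eq[OF assms(1) _ assms(2)]) (simp add: scaleR_add_left sum.distrib fcoef_sum[OF assms(1)])
  show "fcoef Z p (r *\<^sub>R w) a = r *\<^sub>R fcoef Z p w a" for r w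
  proof -
    have "(\<Sum>a<CARD('n). (r * fcoef Z p w a) *\<^sub>R Z a p) = r *\<^sub>R w"
      using arg_cong[OF fcoef_sum[OF assms(1), of w], of "scaleR r"] by (simp add: scaleR_sum_right)
    from fcoef_eq[OF assms(1) this assms(2)] show ?thesis by simp
  qed
qed

lemma fcoef_frame:
  fixes Z :: "nat \<Rightarrow> real^'n \<Rightarrow> real^'n"
  assumes "frame_at Z p" "a < CARD('n)" "b < CARD('n)"
  shows "fcoef Z p (Z b p) a = (if a = b then 1 else 0)"
  by (rule fcoef_eq[OF assms(1) _ assms(2)]) (use assms(3) in \<open>simp add: if_distrib[of "\<lambda>t. t *\<^sub>R _"] cong: if_cong\<close>)

lemma fcoef_span_zero:
  fixes Z :: "nat \<Rightarrow> real^'n \<Rightarrow> real^'n"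
  assumes "frame_at Z p" "a < CARD('n)" "m \<le> a" "w \<in> span ((\<lambda>a. Z a p) ` {..<m})"
  shows "fcoef Z p w a = 0"
  by (rule linear_eq_0_on_span[OF fcoef_linear[OF assms(1,2)] _ assms(4)])
     (use assms in \<open>auto simp: fcoef_frame\<close>)

lemma fcoef_sum_span:
  fixes Z :: "nat \<Rightarrow> real^'n \<Rightarrow> real^'n"
  assumes "frame_at Z p" "m \<le> CARD('n)" "w \<in> span ((\<lambda>a. Z a p) ` {..<m})"
  shows "(\<Sum>a<m. fcoef Z p w a *\<^sub>R Z a p) = w"
proof -
  have "(\<Sum>a<CARD('n). fcoef Z p w a *\<^sub>R Z a p) = (\<Sum>a<m. fcoef Z p w a *\<^sub>R Z a p)"
    by (rule sum.mono_neutral_right) (use assms fcoef_span_zero[OF assms(1) _ _ assms(3)] in auto)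
  then show ?thesis by (simp add: fcoef_sum[OF assms(1)])
qed

lemma smooth_on_fcoef:
  fixes Z :: "nat \<Rightarrow> real^'n \<Rightarrow> real^'n"
  assumes "open U" "\<And>a. a < CARD('n) \<Longrightarrow> smooth_on U (Z a)" "\<And>q. q \<in> U \<Longrightarrow> frame_at Z q"
    "smooth_on U W" "a < CARD('n)"
  shows "smooth_on U (\<lambda>q. fcoef Z q (W q) a)"
proof -
  obtain k :: 'n where k: "enum_idx k = a" using enum_idx_surj[OF assms(5)] .
  show ?thesis
  proof (rule smooth_on_cong[OF assms(1)])
    show "smooth_on U (\<lambda>q. cramer_vec (frame_matrix Z q) (W q) $ k)"
    proof (rule smooth_on_vec_nth[OF assms(1)], rule smooth_on_cramer_vec[OF assms(1) _ assms(4)])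
      show "smooth_on U (\<lambda>x. frame_matrix Z x $ i $ j)" for i j
        by (simp add: frame_matrix_def smooth_on_vec_nth assms(1,2) enum_idx_less)
      show "det (frame_matrix Z x) \<noteq> 0" if "x \<in> U" for x
        using assms(3)[OF that] by (simp add: frame_at_iff_det)
    qed
    show "cramer_vec (frame_matrix Z q) (W q) $ k = fcoef Z q (W q) a" if "q \<in> U" for q
      using fcoef_cramer_vec[OF assms(3)[OF that]] k by metis
  qed
qed

lemma continuous_on_det_frame:
  fixes Z :: "nat \<Rightarrow> real^'n \<Rightarrow> real^'n"
  assumes "\<And>a. a < CARD('n) \<Longrightarrow> continuous_on U (Z a)"
  shows "continuous_on U (\<lambda>q. det (frame_matrix Z q))"
  unfolding det_def frame_matrix_def
  by (auto intro!: continuous_intros assms enum_idx_less)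

lemma card_frame_image:
  fixes Z :: "nat \<Rightarrow> real^'n \<Rightarrow> real^'n"
  assumes "frame_at Z p" "m \<le> CARD('n)"
  shows "dim ((\<lambda>a. Z a p) ` {..<m}) = m" "independent ((\<lambda>a. Z a p) ` {..<m})"
proof -
  have "{..<m} \<subseteq> {..<CARD('n)}" using assms(2) by auto
  then show i: "independent ((\<lambda>a. Z a p) ` {..<m})"
    using assms(1) independent_mono image_mono unfolding frame_at_def by metis
  have "inj_on (\<lambda>a. Z a p) {..<m}"
    using assms(1) \<open>{..<m} \<subseteq> {..<CARD('n)}\<close> inj_on_subset unfolding frame_at_def by blast
  then show "dim ((\<lambda>a. Z a p) ` {..<m}) = m"
    using i by (simp add: dim_eq_card_independent card_image)
qed

lemma frame_span_subspace:
  fixes Z :: "nat \<Rightarrow> real^'n \<Rightarrow> real^'n"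
  assumes "frame_at Z p" "m \<le> CARD('n)" "subspace D" "dim D = m" "\<And>a. a < m \<Longrightarrow> Z a p \<in> D"
  shows "span ((\<lambda>a. Z a p) ` {..<m}) = D"
proof -
  have "span ((\<lambda>a. Z a p) ` {..<m}) \<subseteq> D"
    by (rule span_minimal) (use assms in auto)
  moreover have "dim (span ((\<lambda>a. Z a p) ` {..<m})) = dim D"
    using card_frame_image[OF assms(1,2)] assms(4) by (metis dim_span)
  ultimately show ?thesis using subspace_dim_equal[of "span ((\<lambda>a. Z a p) ` {..<m})" D] assms(3) by simp
qed

section \<open>Brackets of sections of the flag\<close>

lemma frechet_derivative_sum_scaleR:
  assumes "\<And>b. b \<in> T \<Longrightarrow> w b differentiable (at p)" "\<And>b. b \<in> T \<Longrightarrow> G b differentiable (at p)"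
  shows "frechet_derivative (\<lambda>q. \<Sum>b\<in>T. w b q *\<^sub>R G b q) (at p) =
     (\<lambda>v. \<Sum>b\<in>T. w b p *\<^sub>R frechet_derivative (G b) (at p) v + frechet_derivative (w b) (at p) v *\<^sub>R G b p)"
proof (rule frechet_derivative_at[symmetric])
  show "((\<lambda>q. \<Sum>b\<in>T. w b q *\<^sub>R G b q) has_derivative
     (\<lambda>v. \<Sum>b\<in>T. w b p *\<^sub>R frechet_derivative (G b) (at p) v + frechet_derivative (w b) (at p) v *\<^sub>R G b p)) (at p)"
    by (intro has_derivative_sum has_derivative_scaleR) (use assms frechet_derivative_works in blast)+
qed

text \<open>The Leibniz rule for brackets of combinations with variable coefficients. The two sums
  with differentiated coefficients contain no bracket: they stay in the spans of the G b and of the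
  E a, and so drop out one level up in the flag.\<close>

lemma cbr_sum:
  assumes y: "\<And>a. a \<in> S \<Longrightarrow> y a differentiable (at p)" "\<And>a. a \<in> S \<Longrightarrow> E a differentiable (at p)"
    and w: "\<And>b. b \<in> T \<Longrightarrow> w b differentiable (at p)" "\<And>b. b \<in> T \<Longrightarrow> G b differentiable (at p)"
  shows "cbr (\<lambda>q. \<Sum>a\<in>S. y a q *\<^sub>R E a q) (\<lambda>q. \<Sum>b\<in>T. w b q *\<^sub>R G b q) p =
    (\<Sum>a\<in>S. \<Sum>b\<in>T. (y a p * w b p) *\<^sub>R cbr (E a) (G b) p)
    + (\<Sum>b\<in>T. frechet_derivative (w b) (at p) (\<Sum>a\<in>S. y a p *\<^sub>R E a p) *\<^sub>R G b p)
    - (\<Sum>a\<in>S. frechet_derivative (y a) (at p) (\<Sum>b\<in>T. w b p *\<^sub>R G b p) *\<^sub>R E a p)"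
proof -
  have 1: "frechet_derivative (G b) (at p) (\<Sum>a\<in>S. y a p *\<^sub>R E a p) =
      (\<Sum>a\<in>S. y a p *\<^sub>R frechet_derivative (G b) (at p) (E a p))" if "b \<in> T" for b
    using linear_frechet_derivative[OF w(2)[OF that]] by (simp add: linear_sum linear_scale)
  have 2: "frechet_derivative (E a) (at p) (\<Sum>b\<in>T. w b p *\<^sub>R G b p) =
      (\<Sum>b\<in>T. w b p *\<^sub>R frechet_derivative (E a) (at p) (G b p))" if "a \<in> S" for a
    using linear_frechet_derivative[OF y(2)[OF that]] by (simp add: linear_sum linear_scale)
  have 3: "(\<Sum>b\<in>T. w b p *\<^sub>R frechet_derivative (G b) (at p) (\<Sum>a\<in>S. y a p *\<^sub>R E a p))
     = (\<Sum>a\<in>S. \<Sum>b\<in>T. (y a p * w b p) *\<^sub>R frechet_derivative (G b) (at p) (E a p))"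
    by (subst sum.swap) (simp add: 1 scaleR_sum_right mult.commute)
  have 4: "(\<Sum>a\<in>S. y a p *\<^sub>R frechet_derivative (E a) (at p) (\<Sum>b\<in>T. w b p *\<^sub>R G b p))
     = (\<Sum>a\<in>S. \<Sum>b\<in>T. (y a p * w b p) *\<^sub>R frechet_derivative (E a) (at p) (G b p))"
    by (simp add: 2 scaleR_sum_right)
  have dY: "frechet_derivative (\<lambda>q. \<Sum>a\<in>S. y a q *\<^sub>R E a q) (at p) =
     (\<lambda>v. \<Sum>a\<in>S. y a p *\<^sub>R frechet_derivative (E a) (at p) v + frechet_derivative (y a) (at p) v *\<^sub>R E a p)"
    by (rule frechet_derivative_sum_scaleR) (fact y)+
  have dW: "frechet_derivative (\<lambda>q. \<Sum>b\<in>T. w b q *\<^sub>R G b q) (at p) =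
     (\<lambda>v. \<Sum>b\<in>T. w b p *\<^sub>R frechet_derivative (G b) (at p) v + frechet_derivative (w b) (at p) v *\<^sub>R G b p)"
    by (rule frechet_derivative_sum_scaleR) (fact w)+
  show ?thesis
    unfolding cbr_def dY dW
    by (simp add: sum.distrib 3 4 scaleR_diff_right sum_subtractf)
qed

lemma cbr_cong:
  assumes "open U" "p \<in> U" "\<And>q. q \<in> U \<Longrightarrow> Y q = Y' q" "\<And>q. q \<in> U \<Longrightarrow> W q = W' q"
    "Y differentiable (at p)" "W differentiable (at p)"
  shows "cbr Y W p = cbr Y' W' p"
  using frechet_derivative_transform_within_open[OF assms(5,1,2,3)]
    frechet_derivative_transform_within_open[OF assms(6,1,2,4)] assms(2-4)
  by (simp add: cbr_def)

text \<open>An equiregular region seen in one chart: \<open>nn\<close> is the constant growth vector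
  and \<open>r\<close> a level at which the flag fills the tangent space.\<close>

locale chart_fields =
  fixes X :: "nat \<Rightarrow> ('a, 'n::finite) chart \<Rightarrow> real^'n \<Rightarrow> real^'n" and N0 :: nat
    and c :: "('a, 'n) chart" and V :: "(real^'n) set" and nn :: "nat \<Rightarrow> nat" and r :: nat
  assumes open_V: "open V"
    and smooth_X: "j < N0 \<Longrightarrow> smooth_on V (X j c)"
    and dim_D: "q \<in> V \<Longrightarrow> dim (Dc X N0 c i q) = nn i"
    and full: "nn r = CARD('n)"
begin

abbreviation "D \<equiv> Dc X N0 c"

lemma subspace_D: "subspace (D i q)" by (simp add: Dc_def)

lemma D_mono: "i \<le> j \<Longrightarrow> D i q \<subseteq> D j q"
  unfolding Dc_def by (rule span_mono) auto

lemma xf_in_D: "I \<noteq> [] \<Longrightarrow> set I \<subseteq> {..<N0} \<Longrightarrow> length I \<le> i + 1 \<Longrightarrow> xf X c I q \<in> D i q"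
  unfolding Dc_def by (rule span_base) auto

lemma D_0_eq: "D 0 q = span ((\<lambda>j. X j c q) ` {..<N0})"
proof -
  have "{xf X c I q |I. I \<noteq> [] \<and> length I \<le> 0 + 1 \<and> set I \<subseteq> {..<N0}} = (\<lambda>j. X j c q) ` {..<N0}" (is "?L = ?R")
  proof
    show "?L \<subseteq> ?R"
    proof
      fix v assume "v \<in> ?L"
      then obtain I where I: "v = xf X c I q" "I \<noteq> []" "length I \<le> 0 + 1" "set I \<subseteq> {..<N0}" by blast
      then obtain j where "I = [j]" by (cases I) auto
      then show "v \<in> ?R" using I by auto
    qed
    show "?R \<subseteq> ?L"
    proof
      fix v assume "v \<in> ?R"
      then obtain j where "j < N0" "v = xf X c [j] q" by auto
      then show "v \<in> ?L" by (intro CollectI exI[of _ "[j]"]) auto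
    qed
  qed
  then show ?thesis by (simp add: Dc_def)
qed

lemma smooth_xf: "set I \<subseteq> {..<N0} \<Longrightarrow> smooth_on V (xf X c I)"
  by (rule smooth_on_xf[OF open_V]) (auto intro: smooth_X)

lemma nn_mono: "p \<in> V \<Longrightarrow> i \<le> j \<Longrightarrow> nn i \<le> nn j"
  using dim_subset[OF D_mono, of i j p] by (simp add: dim_D)

lemma nn_le: "p \<in> V \<Longrightarrow> nn i \<le> CARD('n)"
  using dim_subset_UNIV[of "D i p"] by (simp add: dim_D)

lemma nn_full: "p \<in> V \<Longrightarrow> r \<le> i \<Longrightarrow> nn i = CARD('n)"
  using nn_mono[of p r i] nn_le[of p i] full by simp

text \<open>A basis adapted to the flag is selected at the single point p from the iterated
  brackets. Each level extends the list of the level before, so every initial segment of length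
  \<open>nn i'\<close> uses only words of length at most i' + 1.\<close>

lemma adapted_lists:
  assumes "p \<in> V"
  shows "\<exists>Ls. length Ls = nn i \<and> (\<forall>I\<in>set Ls. I \<noteq> [] \<and> set I \<subseteq> {..<N0}) \<and>
    (\<forall>i'\<le>i. \<forall>a<nn i'. length (Ls ! a) \<le> i' + 1) \<and>
    inj_on (\<lambda>a. xf X c (Ls ! a) p) {..<nn i} \<and> independent ((\<lambda>a. xf X c (Ls ! a) p) ` {..<nn i})"
proof -
  define Gen where "Gen = (\<lambda>i. {xf X c I p | I. I \<noteq> [] \<and> length I \<le> i + 1 \<and> set I \<subseteq> {..<N0}})"
  have DG: "D i p = span (Gen i)" for i by (simp add: Dc_def Gen_def)
  \<comment> \<open>Extension by one level: complete the given independent brackets to a basis of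
    the level inside its generating set, and append a word for each new vector.\<close>
  have ext: "\<exists>Ls'. length Ls' = nn i \<and> (\<forall>a<length Ls. Ls' ! a = Ls ! a) \<and>
      (\<forall>I\<in>set Ls'. I \<noteq> [] \<and> set I \<subseteq> {..<N0}) \<and> (\<forall>a<nn i. length (Ls' ! a) \<le> i + 1) \<and>
      inj_on (\<lambda>a. xf X c (Ls' ! a) p) {..<nn i} \<and> independent ((\<lambda>a. xf X c (Ls' ! a) p) ` {..<nn i})"
    if Ls: "\<forall>I\<in>set Ls. I \<noteq> [] \<and> set I \<subseteq> {..<N0} \<and> length I \<le> i + 1"
      "inj_on (\<lambda>a. xf X c (Ls ! a) p) {..<length Ls}" "independent ((\<lambda>a. xf X c (Ls ! a) p) ` {..<length Ls})"
    for Ls i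
  proof -
    let ?B = "(\<lambda>a. xf X c (Ls ! a) p) ` {..<length Ls}"
    have Bset: "?B = (\<lambda>I. xf X c I p) ` set Ls" by (auto simp: set_conv_nth)
    have "?B \<subseteq> Gen i" unfolding Bset Gen_def using Ls(1) by auto
    then obtain B' where B': "?B \<subseteq> B'" "B' \<subseteq> Gen i" "independent B'" "Gen i \<subseteq> span B'"
      using maximal_independent_subset_extend[OF _ Ls(3)] by metis
    have fin: "finite B'" using independent_imp_finite[OF B'(3)] .
    have "span B' = D i p" unfolding DG
      using span_mono[OF B'(2)] span_mono[OF B'(4)] by (simp add: span_span)
    then have card: "card B' = nn i"
      using dim_D[OF assms, of i] dim_eq_card_independent[OF B'(3)] by (metis dim_span)
    obtain xs where xs: "set xs = B' - ?B" "distinct xs"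
      using finite_distinct_list[of "B' - ?B"] fin by auto
    have "\<forall>v\<in>B'. \<exists>I. v = xf X c I p \<and> I \<noteq> [] \<and> length I \<le> i + 1 \<and> set I \<subseteq> {..<N0}"
      using B'(2) unfolding Gen_def by blast
    then obtain I where I: "\<And>v. v \<in> B' \<Longrightarrow> v = xf X c (I v) p \<and> I v \<noteq> [] \<and> length (I v) \<le> i + 1 \<and> set (I v) \<subseteq> {..<N0}"
      by metis
    define Ls' where "Ls' = Ls @ map I xs"
    have setprops: "\<forall>J\<in>set Ls'. J \<noteq> [] \<and> set J \<subseteq> {..<N0} \<and> length J \<le> i + 1"
      using Ls(1) I xs(1) by (auto simp: Ls'_def)
    have cardB: "card ?B = length Ls" using Ls(2) by (simp add: card_image)
    have len: "length Ls' = nn i"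
    proof -
      have "length xs = card B' - card ?B"
        using xs card_Diff_subset[of ?B B'] B'(1) by (simp add: distinct_card[symmetric])
      moreover have "card ?B \<le> card B'" using card_mono[OF fin B'(1)] .
      ultimately show ?thesis using card cardB by (simp add: Ls'_def)
    qed
    have img: "(\<lambda>a. xf X c (Ls' ! a) p) ` {..<nn i} = B'"
    proof -
      have "(\<lambda>a. xf X c (Ls' ! a) p) ` {..<nn i} = (\<lambda>J. xf X c J p) ` set Ls'"
        unfolding len[symmetric] by (auto simp: set_conv_nth)
      also have "\<dots> = ?B \<union> (\<lambda>J. xf X c J p) ` I ` set xs" by (simp add: Ls'_def image_Un Bset)
      also have "(\<lambda>J. xf X c J p) ` I ` set xs = set xs"
        using I xs(1) by (force simp: image_iff)
      finally show ?thesis using xs(1) B'(1) by auto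
    qed
    have "inj_on (\<lambda>a. xf X c (Ls' ! a) p) {..<nn i}"
      by (rule eq_card_imp_inj_on) (auto simp: img card)
    moreover have "\<forall>a<nn i. length (Ls' ! a) \<le> i + 1" using setprops len by simp
    moreover have "\<forall>a<length Ls. Ls' ! a = Ls ! a" by (simp add: Ls'_def nth_append)
    ultimately show ?thesis using len setprops img B'(3) by (intro exI[of _ Ls']) auto
  qed
  show ?thesis
  proof (induction i)
    case 0
    obtain Ls where "length Ls = nn 0" "\<forall>I\<in>set Ls. I \<noteq> [] \<and> set I \<subseteq> {..<N0}"
      "\<forall>a<nn 0. length (Ls ! a) \<le> 0 + 1" "inj_on (\<lambda>a. xf X c (Ls ! a) p) {..<nn 0}"
      "independent ((\<lambda>a. xf X c (Ls ! a) p) ` {..<nn 0})"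
      using ext[of "[]" 0] by (auto simp: independent_empty)
    then show ?case by (intro exI[of _ Ls]) simp
  next
    case (Suc i)
    then obtain Ls where Ls: "length Ls = nn i" "\<forall>I\<in>set Ls. I \<noteq> [] \<and> set I \<subseteq> {..<N0}"
      "\<forall>i'\<le>i. \<forall>a<nn i'. length (Ls ! a) \<le> i' + 1"
      "inj_on (\<lambda>a. xf X c (Ls ! a) p) {..<nn i}" "independent ((\<lambda>a. xf X c (Ls ! a) p) ` {..<nn i})"
      by blast
    have "\<forall>I\<in>set Ls. length I \<le> Suc i + 1"
      using Ls(1,3) by (fastforce simp: set_conv_nth)
    then obtain Ls' where Ls': "length Ls' = nn (Suc i)" "\<forall>a<length Ls. Ls' ! a = Ls ! a"
      "\<forall>I\<in>set Ls'. I \<noteq> [] \<and> set I \<subseteq> {..<N0}" "\<forall>a<nn (Suc i). length (Ls' ! a) \<le> Suc i + 1"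
      "inj_on (\<lambda>a. xf X c (Ls' ! a) p) {..<nn (Suc i)}" "independent ((\<lambda>a. xf X c (Ls' ! a) p) ` {..<nn (Suc i)})"
      using ext[of Ls "Suc i"] Ls by auto
    have "length (Ls' ! a) \<le> i' + 1" if "i' \<le> Suc i" "a < nn i'" for i' a
    proof (cases "i' = Suc i")
      case False
      then have "a < length Ls" using that nn_mono[OF assms, of i' i] Ls(1) by simp
      then show ?thesis using False that Ls(3) Ls'(2) by simp
    qed (use that Ls'(4) in simp)
    then show ?case using Ls' by blast
  qed
qed

text \<open>Words selected at p stay independent nearby because a determinant remains nonzero. They
  lie in D_i by their length, and since the dimension of D_i is constant they still span it; this is
  where equiregularity enters.\<close>

lemma flag_frame:
  assumes "p \<in> V"
  obtains U L where "open U" "p \<in> U" "U \<subseteq> V"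
    "\<And>a. a < CARD('n) \<Longrightarrow> L a \<noteq> [] \<and> set (L a) \<subseteq> {..<N0}"
    "\<And>a i. a < nn i \<Longrightarrow> length (L a) \<le> i + 1"
    "\<And>q. q \<in> U \<Longrightarrow> frame_at (\<lambda>a. xf X c (L a)) q"
    "\<And>q i. q \<in> U \<Longrightarrow> span ((\<lambda>a. xf X c (L a) q) ` {..<nn i}) = D i q"
proof -
  obtain Ls where Ls: "length Ls = nn r" "\<forall>I\<in>set Ls. I \<noteq> [] \<and> set I \<subseteq> {..<N0}"
      "\<forall>i'\<le>r. \<forall>a<nn i'. length (Ls ! a) \<le> i' + 1"
      "inj_on (\<lambda>a. xf X c (Ls ! a) p) {..<nn r}" "independent ((\<lambda>a. xf X c (Ls ! a) p) ` {..<nn r})"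
    using adapted_lists[OF assms, of r] by blast
  define L where "L = (\<lambda>a. Ls ! a)"
  define Y where "Y = (\<lambda>a. xf X c (L a))"
  define U where "U = {q \<in> V. det (frame_matrix Y q) \<noteq> 0}"
  have L1: "L a \<noteq> [] \<and> set (L a) \<subseteq> {..<N0}" if "a < CARD('n)" for a
    using Ls(1,2) that full by (simp add: L_def)
  have L2: "length (L a) \<le> i + 1" if "a < nn i" for a i
  proof (cases "i \<le> r")
    case False
    then have "a < nn r" "r \<le> i" using that nn_full[OF assms, of i] full by auto
    then show ?thesis using Ls(3) by (force simp: L_def)
  qed (use that Ls(3) in \<open>simp add: L_def\<close>)
  have fr: "frame_at Y q" if "q \<in> U" for q using that by (simp add: U_def frame_at_iff_det)
  have pU: "p \<in> U"
    using Ls(4,5) assms full by (simp add: U_def frame_at_iff_det[symmetric] frame_at_def Y_def L_def)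
  have "continuous_on V (\<lambda>q. det (frame_matrix Y q))"
    by (intro continuous_on_det_frame smooth_on_continuous) (use L1 smooth_xf in \<open>auto simp: Y_def\<close>)
  then have "open ((\<lambda>q. det (frame_matrix Y q)) -` (- {0}) \<inter> V)"
    using continuous_on_open_vimage[OF open_V] open_Compl[OF closed_singleton] by blast
  moreover have "(\<lambda>q. det (frame_matrix Y q)) -` (- {0}) \<inter> V = U" by (auto simp: U_def)
  ultimately have openU: "open U" by simp
  \<comment> \<open>Membership together with the dimension count \<open>dim_D\<close> gives equality
    of the spans.\<close>
  have sp: "span ((\<lambda>a. Y a q) ` {..<nn i}) = D i q" if "q \<in> U" for q i
  proof (rule frame_span_subspace[OF fr[OF that] nn_le[OF assms] subspace_D dim_D])
    show "q \<in> V" using that by (simp add: U_def)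
    show "Y a q \<in> D i q" if "a < nn i" for a
      using L1[of a] L2[OF that] that nn_le[OF assms, of i] by (simp add: Y_def xf_in_D)
  qed
  show ?thesis
    by (rule that[of U L]) (use openU pU L1 L2 fr sp in \<open>auto simp: Y_def U_def\<close>)
qed

text \<open>\<open>Dc\<close> is generated pointwise by brackets of the given fields, so a statement
  on arbitrary sections needs the local frame of \<open>flag_frame\<close>. With smooth coefficients
  in that frame, the brackets of frame members raise the level by one, and the terms with
  differentiated coefficients stay in D_0 or D_j.\<close>

lemma bracket_section:
  assumes U: "open U" "U \<subseteq> V" "p \<in> U" and smooth: "smooth_on U Y" "smooth_on U W"
    and Y: "\<And>q. q \<in> U \<Longrightarrow> Y q \<in> D 0 q" and W: "\<And>q. q \<in> U \<Longrightarrow> W q \<in> D j q"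
  shows "cbr Y W p \<in> D (Suc j) p"
proof -
  have pV: "p \<in> V" using U by auto
  obtain U' L where L: "open U'" "p \<in> U'" "U' \<subseteq> V"
    "\<And>a. a < CARD('n) \<Longrightarrow> L a \<noteq> [] \<and> set (L a) \<subseteq> {..<N0}"
    "\<And>a i. a < nn i \<Longrightarrow> length (L a) \<le> i + 1"
    "\<And>q. q \<in> U' \<Longrightarrow> frame_at (\<lambda>a. xf X c (L a)) q"
    "\<And>q i. q \<in> U' \<Longrightarrow> span ((\<lambda>a. xf X c (L a) q) ` {..<nn i}) = D i q"
    using flag_frame[OF pV] by metis
  define E where "E = (\<lambda>a. xf X c (L a))"
  define T where "T = U \<inter> U'"
  have T: "open T" "p \<in> T" "T \<subseteq> V" "T \<subseteq> U" using U L by (auto simp: T_def)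
  have sE: "smooth_on T (E a)" if "a < CARD('n)" for a
    unfolding E_def by (rule smooth_on_subset[OF open_V T(1,3) smooth_xf]) (use L(4)[OF that] in simp)
  have fr: "frame_at E q" if "q \<in> T" for q using that L(6) by (simp add: T_def E_def)
  have sp: "span ((\<lambda>a. E a q) ` {..<nn i}) = D i q" if "q \<in> T" for q i
    using that L(7) by (simp add: T_def E_def)
  define y where "y = (\<lambda>a q. fcoef E q (Y q) a)"
  define w where "w = (\<lambda>a q. fcoef E q (W q) a)"
  have sy: "smooth_on T (y a)" "smooth_on T (w a)" if "a < CARD('n)" for a
    unfolding y_def w_def using smooth_on_subset[OF U(1) T(1,4)] smooth that fr sE T(1)
    by (auto intro!: smooth_on_fcoef)
  have nn: "nn i \<le> CARD('n)" for i using nn_le[OF pV] .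
  have eqY: "Y q = (\<Sum>a<nn 0. y a q *\<^sub>R E a q)" if "q \<in> T" for q
    unfolding y_def by (rule fcoef_sum_span[OF fr[OF that] nn, symmetric])
      (use that Y T(4) sp[OF that] in auto)
  have eqW: "W q = (\<Sum>a<nn j. w a q *\<^sub>R E a q)" if "q \<in> T" for q
    unfolding w_def by (rule fcoef_sum_span[OF fr[OF that] nn, symmetric])
      (use that W T(4) sp[OF that] in auto)
  have dif: "E a differentiable at p" "y a differentiable at p" "w a differentiable at p" if "a < CARD('n)" for a
    using smooth_on_differentiable[OF T(1) _ T(2)] sE[OF that] sy[OF that] by auto
  have "cbr Y W p = cbr (\<lambda>q. \<Sum>a<nn 0. y a q *\<^sub>R E a q) (\<lambda>q. \<Sum>a<nn j. w a q *\<^sub>R E a q) p"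
    using smooth_on_differentiable[OF U(1) smooth(1) U(3)] smooth_on_differentiable[OF U(1) smooth(2) U(3)]
    by (intro cbr_cong[OF T(1,2)] eqY eqW)
  also have "\<dots> = (\<Sum>a<nn 0. \<Sum>b<nn j. (y a p * w b p) *\<^sub>R cbr (E a) (E b) p)
    + (\<Sum>b<nn j. frechet_derivative (w b) (at p) (\<Sum>a<nn 0. y a p *\<^sub>R E a p) *\<^sub>R E b p)
    - (\<Sum>a<nn 0. frechet_derivative (y a) (at p) (\<Sum>b<nn j. w b p *\<^sub>R E b p) *\<^sub>R E a p)"
    by (rule cbr_sum) (auto intro!: dif less_le_trans[OF _ nn])
  also have "\<dots> \<in> D (Suc j) p"
  proof (intro subspace_diff subspace_add subspace_sum subspace_scale subspace_D)
    fix a b assume a: "a \<in> {..<nn 0}" and b: "b \<in> {..<nn j}"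
    have a': "a < CARD('n)" and b': "b < CARD('n)" using a b nn by (auto intro: less_le_trans)
    \<comment> \<open>The first \<open>nn 0\<close> frame members come from single letters, so the
      bracket with any other member is again a right-nested bracket of the given fields.\<close>
    have "length (L a) = 1" using L(4)[OF a'] L(5)[of a 0] a by (cases "L a") auto
    then obtain i where i: "L a = [i]" by (auto simp: length_Suc_conv)
    obtain k K where K: "L b = k # K" using L(4)[OF b'] by (cases "L b") auto
    have "cbr (E a) (E b) p = xf X c (i # L b) p" by (simp add: E_def i K)
    also have "\<dots> \<in> D (Suc j) p"
      by (rule xf_in_D) (use L(4)[OF a'] L(4)[OF b'] L(5)[of b j] b i in auto)
    finally show "cbr (E a) (E b) p \<in> D (Suc j) p" .
  next
    fix b assume b: "b \<in> {..<nn j}"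
    have b': "b < CARD('n)" using b nn by (auto intro: less_le_trans)
    show "E b p \<in> D (Suc j) p"
      unfolding E_def by (rule xf_in_D) (use L(4)[OF b'] L(5)[of b j] b in auto)
  next
    fix b assume b: "b \<in> {..<nn 0}"
    have b': "b < CARD('n)" using b nn by (auto intro: less_le_trans)
    show "E b p \<in> D (Suc j) p"
      unfolding E_def by (rule xf_in_D) (use L(4)[OF b'] L(5)[of b 0] b in auto)
  qed
  finally show ?thesis .
qed

end

section \<open>Adapted frames and Popp's matrices\<close>

text \<open>The entries of the tensor powers of the matrix A, indexed by pairs of words; words of
  different lengths get 0.\<close>

fun word_coef :: "(nat \<Rightarrow> nat \<Rightarrow> real) \<Rightarrow> nat list \<Rightarrow> nat list \<Rightarrow> real" where
  "word_coef A [] [] = 1"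
| "word_coef A (i # I) (a # s) = A i a * word_coef A I s"
| "word_coef A _ _ = 0"

definition words :: "nat \<Rightarrow> nat \<Rightarrow> nat list set" where
  "words n k = {s. length s = k \<and> set s \<subseteq> {..<n}}"

text \<open>The index set of \<open>gh\<close> before the identically vanishing brackets are
  removed. Unlike \<open>Cidx\<close> it does not depend on the fields.\<close>

definition bracket_words :: "nat \<Rightarrow> nat \<Rightarrow> nat list set" where
  "bracket_words n r = {I. I \<noteq> [] \<and> length I \<le> r + 1 \<and> set I \<subseteq> {..<n}}"

lemma finite_bracket_words: "finite (bracket_words n r)"
  unfolding bracket_words_def by (rule finite_subset[OF _ finite_lists_length_le[of "{..<n}" "r + 1"]]) auto

lemma finite_words: "finite (words n k)"
  unfolding words_def using finite_lists_length_eq[of "{..<n}" k] by (simp add: conj_commute)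

lemma words_0: "words n 0 = {[]}"
  by (auto simp: words_def)

lemma sum_words_Suc: "(\<Sum>s\<in>words n (Suc k). f s) = (\<Sum>a<n. \<Sum>s\<in>words n k. f (a # s))"
proof -
  have "(\<Sum>s\<in>words n (Suc k). f s) = (\<Sum>(a, s)\<in>{..<n} \<times> words n k. f (a # s))"
    by (rule sum.reindex_bij_witness[where i = "\<lambda>(a, s). a # s" and j = "\<lambda>s. (hd s, tl s)"])
       (auto simp: words_def length_Suc_conv)
  then show ?thesis by (simp add: sum.cartesian_product)
qed

text \<open>Orthonormal columns are inherited by tensor powers, one letter at a time.\<close>

lemma word_coef_orthonormal:
  assumes "\<And>a b. a < n \<Longrightarrow> b < n \<Longrightarrow> (\<Sum>j<N. A j a * A j b) = (if a = b then 1 else 0)"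
    and "s \<in> words n k" "t \<in> words n k"
  shows "(\<Sum>I\<in>words N k. word_coef A I s * word_coef A I t) = (if s = t then 1 else 0)"
  using assms(2,3)
proof (induction k arbitrary: s t)
  case 0
  then show ?case by (auto simp: words_0)
next
  case (Suc k)
  obtain a s' b t' where st: "s = a # s'" "t = b # t'" "a < n" "b < n" "s' \<in> words n k" "t' \<in> words n k"
    using Suc.prems by (auto simp: words_def length_Suc_conv)
  have "(\<Sum>I\<in>words N (Suc k). word_coef A I s * word_coef A I t)
      = (\<Sum>j<N. A j a * A j b) * (\<Sum>I\<in>words N k. word_coef A I s' * word_coef A I t')"
    by (simp add: sum_words_Suc st sum_product mult_ac)
  then show ?case using Suc.IH[OF st(5,6)] assms(1)[OF st(3,4)] st(1,2) by simp
qed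

section \<open>Iterated brackets of the X_j expanded in an adapted frame\<close>

locale adapted_fields = chart_fields X N0 c V nn r
  for X :: "nat \<Rightarrow> ('a, 'n::finite) chart \<Rightarrow> real^'n \<Rightarrow> real^'n" and N0 c V nn r +
  fixes Z :: "nat \<Rightarrow> real^'n \<Rightarrow> real^'n"
  assumes smooth_Z: "a < CARD('n) \<Longrightarrow> smooth_on V (Z a)"
    and frame_Z: "q \<in> V \<Longrightarrow> frame_at Z q"
    and span_Z: "q \<in> V \<Longrightarrow> span ((\<lambda>a. Z a q) ` {..<nn i}) = D i q"
    and orthonormal_Z: "q \<in> V \<Longrightarrow> a < nn 0 \<Longrightarrow> b < nn 0 \<Longrightarrow>
      polar (g0 X N0 c q) (Z a q) (Z b q) = (if a = b then 1 else 0)"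
begin

definition A :: "real^'n \<Rightarrow> nat \<Rightarrow> nat \<Rightarrow> real" where
  "A q j a = fcoef Z q (X j c q) a"

lemma Z_in_D: "q \<in> V \<Longrightarrow> a < nn i \<Longrightarrow> Z a q \<in> D i q"
  by (metis span_Z span_base image_eqI lessThan_iff)

lemma less_nn: "q \<in> V \<Longrightarrow> a < nn i \<Longrightarrow> a < CARD('n)"
  using nn_le less_le_trans by blast

lemma X_in_D: "j < N0 \<Longrightarrow> X j c q \<in> D 0 q"
  using xf_in_D[of "[j]" 0 q] by simp

lemma X_expansion: "q \<in> V \<Longrightarrow> j < N0 \<Longrightarrow> X j c q = (\<Sum>a<nn 0. A q j a *\<^sub>R Z a q)"
  unfolding A_def by (rule fcoef_sum_span[symmetric, OF frame_Z nn_le]) (auto simp: span_Z X_in_D)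

lemma smooth_A: "j < N0 \<Longrightarrow> a < CARD('n) \<Longrightarrow> smooth_on V (\<lambda>q. A q j a)"
  unfolding A_def by (intro smooth_on_fcoef open_V smooth_Z frame_Z smooth_X)

text \<open>Take x whose image under the cometric of the X_j is Z_a. Orthonormality for
  \<open>g0\<close> says that x pairs with Z_e to 1 if e = a and to 0 otherwise, hence with X_j to
  A_ja. So Z_a is the sum of the A_ja X_j, and its coefficient on Z_b is the asserted sum. A is
  rectangular in general: only its columns are orthonormal.\<close>

lemma A_orthonormal:
  assumes q: "q \<in> V" and ab: "a < nn 0" "b < nn 0"
  shows "(\<Sum>j<N0. A q j a * A q j b) = (if a = b then 1 else 0)"
proof -
  let ?G = "cometric {..<N0} (\<lambda>j. X j c q)"
  have g0: "g0 X N0 c q = inf_form {..<N0} (\<lambda>j. X j c q)"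
    by (rule ext) (simp add: g0_def inf_form_def)
  have ex: "\<exists>x. ?G *v x = Z e q" if "e < nn 0" for e
    using cometric_range[of "{..<N0}" "Z e q" "\<lambda>j. X j c q"] Z_in_D[OF q that] unfolding D_0_eq by blast
  obtain x where x: "?G *v x = Z a q" using ex[OF ab(1)] by blast
  have xZ: "x \<bullet> Z e q = (if a = e then 1 else 0)" if e: "e < nn 0" for e
  proof -
    obtain y where y: "?G *v y = Z e q" using ex[OF e] by blast
    show ?thesis
      using polar_inf_form[of "{..<N0}" "\<lambda>j. X j c q" x y] orthonormal_Z[OF q ab(1) e] unfolding x y g0 by simp
  qed
  have xX: "X j c q \<bullet> x = A q j a" if "j < N0" for j
    using ab(1) xZ unfolding X_expansion[OF q that] inner_sum_left
    by (simp add: inner_commute[of _ x] if_distrib[of "\<lambda>t. _ * t"] cong: if_cong)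
  have lin: "linear (\<lambda>w. fcoef Z q w b)" by (rule fcoef_linear[OF frame_Z[OF q] less_nn[OF q ab(2)]])
  have "(if a = b then 1 else 0) = fcoef Z q (Z a q) b"
    using fcoef_frame[OF frame_Z[OF q] less_nn[OF q ab(2)] less_nn[OF q ab(1)]] by auto
  also have "Z a q = (\<Sum>j<N0. A q j a *\<^sub>R X j c q)"
    unfolding x[symmetric] cometric_mult_vec by (simp add: xX)
  also have "fcoef Z q \<dots> b = (\<Sum>j<N0. A q j a * A q j b)"
    by (simp add: linear_sum[OF lin] linear_scale[OF lin] A_def)
  finally show ?thesis by simp
qed

text \<open>The convention D_(-1) = 0, with n_(-1) = 0 in \<open>nprv\<close>, lets level 0 be
  treated like the others.\<close>

definition Dprev :: "nat \<Rightarrow> real^'n \<Rightarrow> (real^'n) set" where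
  "Dprev k q = (if k = 0 then {0} else D (k - 1) q)"

definition nprv :: "nat \<Rightarrow> nat" where
  "nprv k = (if k = 0 then 0 else nn (k - 1))"

lemma zbr_in_D: "q \<in> V \<Longrightarrow> set s \<subseteq> {..<nn 0} \<Longrightarrow> s \<noteq> [] \<Longrightarrow> zbr Z s q \<in> D (length s - 1) q"
proof (induction s arbitrary: q rule: induct_list012)
  case (2 a)
  then show ?case by (simp add: Z_in_D)
next
  case (3 a b s)
  have "cbr (Z a) (zbr Z (b # s)) q \<in> D (Suc (length (b # s) - 1)) q"
  proof (rule bracket_section[OF open_V subset_refl 3(3)])
    show "smooth_on V (Z a)" using 3 by (auto intro!: smooth_Z less_nn)
    show "smooth_on V (zbr Z (b # s))"
      by (rule smooth_on_zbr[OF open_V, where n = "nn 0"]) (use 3 in \<open>auto intro: smooth_Z less_nn\<close>)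
    show "Z a q \<in> D 0 q" if "q \<in> V" for q using 3(4) that by (auto intro: Z_in_D)
    show "zbr Z (b # s) q \<in> D (length (b # s) - 1) q" if "q \<in> V" for q
      by (rule "3.IH"(2)[OF that]) (use 3(4) in auto)
  qed
  then show ?case by simp
qed simp

lemma smooth_on_zbr_Z: "q \<in> V \<Longrightarrow> set s \<subseteq> {..<nn 0} \<Longrightarrow> smooth_on V (zbr Z s)"
  by (rule smooth_on_zbr[OF open_V, where n = "nn 0"]) (auto intro: smooth_Z less_nn)

lemma smooth_word_coef:
  assumes q0: "q0 \<in> V" and "set I \<subseteq> {..<N0}" "set s \<subseteq> {..<nn 0}"
  shows "smooth_on V (\<lambda>q. word_coef (A q) I s)"
  using assms(2,3)
proof (induction I arbitrary: s)
  case Nil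
  then show ?case by (cases s) (simp_all add: smooth_on_const open_V)
next
  case (Cons i I)
  show ?case
  proof (cases s)
    case Nil
    then show ?thesis by (simp add: smooth_on_const open_V)
  next
    case (Cons a t)
    then have "smooth_on V (\<lambda>q. A q i a)" "smooth_on V (\<lambda>q. word_coef (A q) I t)"
      using Cons.prems less_nn[OF q0] by (auto intro!: smooth_A Cons.IH)
    then show ?thesis by (simp add: Cons smooth_on_mult open_V)
  qed
qed

text \<open>Modulo the preceding level, X_I is expanded as if the bracket were multilinear over
  functions. Bracketing the expansion of the tail with X_j yields the words one letter longer, terms
  with differentiated coefficients, and the bracket of X_j with the remainder; the last two kinds
  lie at least one level lower.\<close>

lemma xf_expansion:
  "q \<in> V \<Longrightarrow> set I \<subseteq> {..<N0} \<Longrightarrow> I \<noteq> [] \<Longrightarrow>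
    xf X c I q - (\<Sum>s\<in>words (nn 0) (length I). word_coef (A q) I s *\<^sub>R zbr Z s q) \<in> Dprev (length I - 1) q"
proof (induction I arbitrary: q rule: induct_list012)
  case (2 j)
  then have "X j c q = (\<Sum>s\<in>words (nn 0) (Suc 0). word_coef (A q) [j] s *\<^sub>R zbr Z s q)"
    by (simp add: sum_words_Suc words_0 X_expansion)
  then show ?case by (simp add: Dprev_def)
next
  case (3 j k I)
  let ?J = "k # I"
  define m where "m = length I"
  define W where "W = words (nn 0) (length ?J)"
  define P where "P = (\<lambda>q. \<Sum>s\<in>W. word_coef (A q) ?J s *\<^sub>R zbr Z s q)"
  \<comment> \<open>The remainder is kept as a smooth section over all of V, since its bracket, and
    not just its value at q, has to be estimated.\<close>
  define R where "R = (\<lambda>q. xf X c ?J q - P q)"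
  have q: "q \<in> V" and j: "j < N0" and J: "set ?J \<subseteq> {..<N0}" using 3 by auto
  have W: "s \<noteq> []" "set s \<subseteq> {..<nn 0}" "length s = Suc m" if "s \<in> W" for s
    using that by (auto simp: W_def words_def m_def)
  have sJ: "smooth_on V (xf X c ?J)" by (rule smooth_xf[OF J])
  have sZ: "smooth_on V (zbr Z s)" if "s \<in> W" for s by (rule smooth_on_zbr_Z[OF q W(2)[OF that]])
  have sc: "smooth_on V (\<lambda>q. word_coef (A q) ?J s)" if "s \<in> W" for s
    by (rule smooth_word_coef[OF q J W(2)[OF that]])
  have sP: "smooth_on V P"
    unfolding P_def by (intro smooth_on_sum smooth_on_scaleR open_V sZ sc)
  have sR: "smooth_on V R"
    unfolding R_def by (intro smooth_on_diff open_V sJ sP)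
  have dif: "f differentiable at q" if "smooth_on V f" for f :: "real^'n \<Rightarrow> 'x::euclidean_space"
    by (rule smooth_on_differentiable[OF open_V that q])
  have Rm: "R q \<in> Dprev m q" if "q \<in> V" for q
    using "3.IH"(2)[OF that J] by (simp add: R_def P_def W_def m_def)
  have bR: "cbr (X j c) R q \<in> D m q"
  proof (cases m)
    \<comment> \<open>For a one-letter tail the remainder vanishes on all of V, and so does its
      bracket; \<open>bracket_section\<close> offers no level below D_0 for it.\<close>
    case 0
    then have "R q = 0" if "q \<in> V" for q using Rm[OF that] by (simp add: Dprev_def)
    then have "cbr (X j c) R q = cbr (X j c) (\<lambda>q. 0) q"
      by (intro cbr_cong[OF open_V q]) (auto intro!: dif sR smooth_X j)
    also have "\<dots> = 0"
      using linear_0[OF linear_frechet_derivative[OF dif[OF smooth_X[OF j]]]] by (simp add: cbr_def)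
    finally show ?thesis using subspace_0[OF subspace_D] by simp
  next
    case (Suc m')
    have "cbr (X j c) R q \<in> D (Suc m') q"
      by (rule bracket_section[OF open_V subset_refl q smooth_X[OF j] sR])
         (use Rm Suc X_in_D j in \<open>auto simp: Dprev_def\<close>)
    then show ?thesis by (simp add: Suc)
  qed
  have "cbr (X j c) (xf X c ?J) q = cbr (X j c) (\<lambda>q. P q + R q) q"
    by (simp add: R_def)
  also have "\<dots> = cbr (X j c) P q + cbr (X j c) R q"
  proof -
    have "frechet_derivative (\<lambda>q. P q + R q) (at q) =
        (\<lambda>v. frechet_derivative P (at q) v + frechet_derivative R (at q) v)"
      by (rule frechet_derivative_at[symmetric]) (intro has_derivative_add; use dif sP sR frechet_derivative_works in blast)
    then show ?thesis
      using linear_frechet_derivative[OF dif[OF smooth_X[OF j]]] by (simp add: cbr_def linear_add)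
  qed
  also have "cbr (X j c) P q = cbr (\<lambda>q. \<Sum>a<nn 0. A q j a *\<^sub>R Z a q) P q"
    by (rule cbr_cong[OF open_V q]) (auto intro!: dif sP smooth_X j simp: X_expansion j)
  also have "\<dots> = (\<Sum>a<nn 0. \<Sum>s\<in>W. (A q j a * word_coef (A q) ?J s) *\<^sub>R cbr (Z a) (zbr Z s) q)
    + (\<Sum>s\<in>W. frechet_derivative (\<lambda>q. word_coef (A q) ?J s) (at q) (\<Sum>a<nn 0. A q j a *\<^sub>R Z a q) *\<^sub>R zbr Z s q)
    - (\<Sum>a<nn 0. frechet_derivative (\<lambda>q. A q j a) (at q) (\<Sum>s\<in>W. word_coef (A q) ?J s *\<^sub>R zbr Z s q) *\<^sub>R Z a q)"
    unfolding P_def by (rule cbr_sum) (auto intro!: dif smooth_A smooth_Z sZ sc less_nn[OF q] j)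
  \<comment> \<open>Prefixing a letter to every word of the tail's length enumerates the words of
    the full length.\<close>
  also have "(\<Sum>a<nn 0. \<Sum>s\<in>W. (A q j a * word_coef (A q) ?J s) *\<^sub>R cbr (Z a) (zbr Z s) q)
    = (\<Sum>s\<in>words (nn 0) (length (j # ?J)). word_coef (A q) (j # ?J) s *\<^sub>R zbr Z s q)"
  proof -
    have "zbr Z (a # s) = cbr (Z a) (zbr Z s)" if "s \<in> W" for a s
      using W(1)[OF that] by (cases s) auto
    then have "(\<Sum>a<nn 0. \<Sum>s\<in>W. (A q j a * word_coef (A q) ?J s) *\<^sub>R cbr (Z a) (zbr Z s) q)
      = (\<Sum>a<nn 0. \<Sum>s\<in>W. word_coef (A q) (j # ?J) (a # s) *\<^sub>R zbr Z (a # s) q)"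
      by (intro sum.cong refl) simp
    also have "\<dots> = (\<Sum>s\<in>words (nn 0) (Suc (length ?J)). word_coef (A q) (j # ?J) s *\<^sub>R zbr Z s q)"
      unfolding W_def by (rule sum_words_Suc[symmetric])
    finally show ?thesis by (simp only: list.size(4) add_Suc_right add_0_right One_nat_def)
  qed
  finally have "xf X c (j # ?J) q - (\<Sum>s\<in>words (nn 0) (length (j # ?J)). word_coef (A q) (j # ?J) s *\<^sub>R zbr Z s q) =
     (\<Sum>s\<in>W. frechet_derivative (\<lambda>q. word_coef (A q) ?J s) (at q) (\<Sum>a<nn 0. A q j a *\<^sub>R Z a q) *\<^sub>R zbr Z s q)
    - (\<Sum>a<nn 0. frechet_derivative (\<lambda>q. A q j a) (at q) (\<Sum>s\<in>W. word_coef (A q) ?J s *\<^sub>R zbr Z s q) *\<^sub>R Z a q)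
    + cbr (X j c) R q"
    by simp
  also have "\<dots> \<in> D m q"
  proof (intro subspace_diff subspace_add subspace_sum subspace_scale subspace_D bR)
    show "zbr Z s q \<in> D m q" if "s \<in> W" for s
      using zbr_in_D[OF q W(2)[OF that] W(1)[OF that]] W(3)[OF that] by simp
    show "Z a q \<in> D m q" if "a \<in> {..<nn 0}" for a
      using Z_in_D[OF q, of a 0] D_mono[of 0 m q] that by auto
  qed
  finally show ?case by (simp add: Dprev_def m_def)
qed simp

lemma fcoef_Dprev: "q \<in> V \<Longrightarrow> w \<in> Dprev k q \<Longrightarrow> nprv k \<le> a \<Longrightarrow> a < CARD('n) \<Longrightarrow> fcoef Z q w a = 0"
  using linear_0[OF fcoef_linear[OF frame_Z]] fcoef_span_zero[OF frame_Z, of q a "nn (k - 1)" w] span_Z[of q "k - 1"]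
  by (auto simp: Dprev_def nprv_def split: if_splits)

text \<open>Modulo lower order terms, passing from the words in Z to the words in X acts on each
  tensor slot by the isometry A.\<close>
lemma block_sum_words:
  assumes q: "q \<in> V" and a: "nprv k \<le> a" "a < CARD('n)" and b: "nprv k \<le> b" "b < CARD('n)"
  shows "(\<Sum>I\<in>words N0 (Suc k). fcoef Z q (xf X c I q) a * fcoef Z q (xf X c I q) b)
       = (\<Sum>s\<in>words (nn 0) (Suc k). fcoef Z q (zbr Z s q) a * fcoef Z q (zbr Z s q) b)"
proof -
  let ?W = "words (nn 0) (Suc k)"
  have e: "fcoef Z q (xf X c I q) a = (\<Sum>s\<in>?W. word_coef (A q) I s * fcoef Z q (zbr Z s q) a)"
    if I: "I \<in> words N0 (Suc k)" and a: "nprv k \<le> a" "a < CARD('n)" for I a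
  proof -
    have lin: "linear (\<lambda>w. fcoef Z q w a)" by (rule fcoef_linear[OF frame_Z[OF q] a(2)])
    have "xf X c I q - (\<Sum>s\<in>?W. word_coef (A q) I s *\<^sub>R zbr Z s q) \<in> Dprev k q"
    proof -
      have "length I = Suc k" "set I \<subseteq> {..<N0}" "I \<noteq> []" using I by (auto simp: words_def)
      then show ?thesis using xf_expansion[OF q, of I] by simp
    qed
    from fcoef_Dprev[OF q this a] show ?thesis
      by (simp add: linear_diff[OF lin] linear_sum[OF lin] linear_scale[OF lin])
  qed
  let ?f = "\<lambda>s. fcoef Z q (zbr Z s q)"
  have "(\<Sum>I\<in>words N0 (Suc k). fcoef Z q (xf X c I q) a * fcoef Z q (xf X c I q) b)
     = (\<Sum>I\<in>words N0 (Suc k). \<Sum>s\<in>?W. \<Sum>t\<in>?W. (word_coef (A q) I s * word_coef (A q) I t) * (?f s a * ?f t b))"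
    by (intro sum.cong refl) (simp add: e a b sum_product mult_ac)
  also have "\<dots> = (\<Sum>s\<in>?W. \<Sum>t\<in>?W. \<Sum>I\<in>words N0 (Suc k). (word_coef (A q) I s * word_coef (A q) I t) * (?f s a * ?f t b))"
    by (subst sum.swap) (intro sum.cong refl sum.swap)
  also have "\<dots> = (\<Sum>s\<in>?W. \<Sum>t\<in>?W. (if s = t then 1 else 0) * (?f s a * ?f t b))"
  proof (intro sum.cong refl)
    fix s t assume st: "s \<in> ?W" "t \<in> ?W"
    have "(\<Sum>I\<in>words N0 (Suc k). (word_coef (A q) I s * word_coef (A q) I t)) = (if s = t then 1 else 0)"
      by (rule word_coef_orthonormal[OF _ st]) (rule A_orthonormal[OF q])
    then show "(\<Sum>I\<in>words N0 (Suc k). (word_coef (A q) I s * word_coef (A q) I t) * (?f s a * ?f t b))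
      = (if s = t then 1 else 0) * (?f s a * ?f t b)"
      by (simp only: sum_distrib_right[symmetric])
  qed
  also have "\<dots> = (\<Sum>s\<in>?W. ?f s a * ?f s b)"
    by (simp add: if_distrib[of "\<lambda>t. t * _"] finite_words cong: if_cong)
  finally show ?thesis .
qed

end

section \<open>The rescaled cometric in an adapted frame\<close>

context adapted_fields
begin

definition wt :: "nat \<Rightarrow> nat" where
  "wt a = (LEAST i. a < nn i)"

text \<open>The natural subtraction truncates where the order of I is below the weight of a
  direction, but the coefficient vanishes there by \<open>fcoef_xf_eq_0\<close>. Natural powers keep
  the expression continuous at h = 0.\<close>

definition scaled :: "real \<Rightarrow> real^'n \<Rightarrow> nat list \<Rightarrow> real^'n" where
  "scaled h q I = (\<chi> k. h ^ (length I - 1 - wt (enum_idx k)) * fcoef Z q (xf X c I q) (enum_idx k))"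

definition E :: "real \<Rightarrow> real^'n \<Rightarrow> real^'n^'n" where
  "E h q = cometric (bracket_words N0 r) (scaled h q)"

definition popp_matrix :: "real^'n \<Rightarrow> nat \<Rightarrow> nat \<Rightarrow> nat \<Rightarrow> real" where
  "popp_matrix q j k l = (\<Sum>s\<in>words (nn 0) (Suc j).
     fcoef Z q (zbr Z s q) (nprv j + k) * fcoef Z q (zbr Z s q) (nprv j + l))"

lemma wt_le: "a < nn i \<Longrightarrow> wt a \<le> i"
  unfolding wt_def by (rule Least_le)

lemma less_nn_wt: "a < CARD('n) \<Longrightarrow> a < nn (wt a)"
  unfolding wt_def by (rule LeastI[of "\<lambda>i. a < nn i" r]) (simp add: full)

lemma wt_gt: "q \<in> V \<Longrightarrow> nn i \<le> a \<Longrightarrow> a < CARD('n) \<Longrightarrow> i < wt a"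
  using nn_mono[of q "wt a" i] less_nn_wt[of a] by (meson leD leI less_le_trans)

lemma nn_le_of_less_wt: "i < wt a \<Longrightarrow> nn i \<le> a"
  unfolding wt_def using not_less_Least not_less by blast

lemma wt_block: "q \<in> V \<Longrightarrow> nprv j \<le> a \<Longrightarrow> a < nn j \<Longrightarrow> wt a = j"
  using wt_le[of a j] wt_gt[of q "j - 1" a] less_nn[of q a j] by (cases j) (auto simp: nprv_def)

lemma fcoef_xf_eq_0:
  assumes "q \<in> V" "I \<in> bracket_words N0 r" "a < CARD('n)" "length I - 1 < wt a"
  shows "fcoef Z q (xf X c I q) a = 0"
proof (rule fcoef_span_zero[OF frame_Z[OF assms(1)] assms(3) nn_le_of_less_wt[OF assms(4)]])
  show "xf X c I q \<in> span ((\<lambda>a. Z a q) ` {..<nn (length I - 1)})"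
    unfolding span_Z[OF assms(1)] by (rule xf_in_D) (use assms(2) in \<open>auto simp: bracket_words_def\<close>)
qed

text \<open>The vectors of the cometric arise from the rescaled ones by a fixed linear map, the
  frame matrix after the diagonal of the powers of h. Their cometrics are therefore congruent, and
  the determinants differ by squares.\<close>

lemma scaled_xf:
  assumes "q \<in> V" "I \<in> bracket_words N0 r"
  shows "h ^ (length I - 1) *\<^sub>R xf X c I q =
    frame_matrix Z q *v ((\<chi> k l. if k = l then h ^ wt (enum_idx k) else 0) *v scaled h q I)"
proof -
  have "((\<chi> k l. if k = l then h ^ wt (enum_idx k) else 0) *v scaled h q I) $ k
      = h ^ (length I - 1) * fcoef Z q (xf X c I q) (enum_idx k)" for k
  proof (cases "wt (enum_idx k) \<le> length I - 1")
    case True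
    then have "wt (enum_idx k) + (length I - Suc (wt (enum_idx k))) = length I - Suc 0" by simp
    then show ?thesis
      by (simp add: matrix_vector_mult_def scaled_def if_distrib[of "\<lambda>t. t * _"] power_add[symmetric]
          mult.assoc[symmetric] cong: if_cong)
  next
    case False
    then have "fcoef Z q (xf X c I q) (enum_idx k) = 0"
      by (intro fcoef_xf_eq_0 assms enum_idx_less) simp
    then show ?thesis
      by (simp add: matrix_vector_mult_def scaled_def if_distrib[of "\<lambda>t. t * _"] cong: if_cong)
  qed
  then have "(\<chi> k l. if k = l then h ^ wt (enum_idx k) else 0) *v scaled h q I
      = (\<chi> k. (\<lambda>a. h ^ (length I - 1) * fcoef Z q (xf X c I q) a) (enum_idx k))"
    by (simp add: vec_eq_iff)
  then have "frame_matrix Z q *v ((\<chi> k l. if k = l then h ^ wt (enum_idx k) else 0) *v scaled h q I)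
    = (\<Sum>a<CARD('n). (h ^ (length I - 1) * fcoef Z q (xf X c I q) a) *\<^sub>R Z a q)"
    using frame_matrix_enum[of Z q "\<lambda>a. h ^ (length I - 1) * fcoef Z q (xf X c I q) a"] by simp
  also have "\<dots> = h ^ (length I - 1) *\<^sub>R xf X c I q"
    using arg_cong[OF fcoef_sum[OF frame_Z[OF assms(1)], of "xf X c I q"], of "scaleR (h ^ (length I - 1))"]
    by (simp add: scaleR_sum_right)
  finally show ?thesis by simp
qed

lemma det_scaled_cometric:
  assumes "q \<in> V"
  shows "det (cometric (bracket_words N0 r) (\<lambda>I. h ^ (length I - 1) *\<^sub>R xf X c I q)) =
    (det (frame_matrix Z q))\<^sup>2 * (h ^ (\<Sum>a<CARD('n). wt a))\<^sup>2 * det (E h q)"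
proof -
  let ?M = "(\<chi> k l. if k = l then h ^ wt (enum_idx k) else 0) :: real^'n^'n"
  have "cometric (bracket_words N0 r) (\<lambda>I. h ^ (length I - 1) *\<^sub>R xf X c I q)
      = cometric (bracket_words N0 r) (\<lambda>I. frame_matrix Z q *v (?M *v scaled h q I))"
    by (rule cometric_cong) (rule scaled_xf[OF assms])
  also have "\<dots> = frame_matrix Z q ** (?M ** E h q ** transpose ?M) ** transpose (frame_matrix Z q)"
    by (simp only: cometric_image E_def)
  finally have "det (cometric (bracket_words N0 r) (\<lambda>I. h ^ (length I - 1) *\<^sub>R xf X c I q))
     = (det (frame_matrix Z q))\<^sup>2 * (det ?M)\<^sup>2 * det (E h q)"
    by (simp add: det_mul det_transpose power2_eq_square)
  moreover have "det ?M = h ^ (\<Sum>a<CARD('n). wt a)"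
    by (subst det_diagonal) (auto simp: power_sum sum_enum_idx[symmetric])
  ultimately show ?thesis by simp
qed

lemma span_xf:
  assumes "q \<in> V"
  shows "span ((\<lambda>I. xf X c I q) ` bracket_words N0 r) = UNIV"
proof -
  have "D r q = span ((\<lambda>I. xf X c I q) ` bracket_words N0 r)"
    by (simp add: Dc_def bracket_words_def image_Collect)
  moreover have "D r q = UNIV"
    using dim_D[OF assms, of r] full subspace_D[of r q] by (metis DIM_cart DIM_real dim_eq_full mult.right_neutral span_eq_iff)
  ultimately show ?thesis by simp
qed

lemma det_E_pos:
  assumes "q \<in> V" "h > 0"
  shows "det (E h q) > 0"
proof -
  have "det (cometric (bracket_words N0 r) (\<lambda>I. h ^ (length I - 1) *\<^sub>R xf X c I q)) > 0"
  proof (rule det_cometric_pos[OF finite_bracket_words])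
    fix x assume "\<And>I. I \<in> bracket_words N0 r \<Longrightarrow> (h ^ (length I - 1) *\<^sub>R xf X c I q) \<bullet> x = 0"
    then show "x = 0"
      by (intro span_nondegenerate[of x "\<lambda>I. xf X c I q" "bracket_words N0 r"]) (use assms span_xf in auto)
  qed
  moreover have "(det (frame_matrix Z q))\<^sup>2 * (h ^ (\<Sum>a<CARD('n). wt a))\<^sup>2 > 0"
    using frame_Z[OF assms(1)] assms(2) by (simp add: frame_at_iff_det)
  ultimately show ?thesis
    unfolding det_scaled_cometric[OF assms(1)] by (rule zero_less_mult_pos)
qed

text \<open>With 0 ^ 0 = 1, setting h = 0 keeps exactly the coefficients whose order equals the
  weight.\<close>

lemma scaled_0: "q \<in> V \<Longrightarrow> I \<in> bracket_words N0 r \<Longrightarrow>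
  scaled 0 q I $ k = (if length I - 1 = wt (enum_idx k) then fcoef Z q (xf X c I q) (enum_idx k) else 0)"
  using fcoef_xf_eq_0[of q I "enum_idx k"] enum_idx_less[of k]
  by (cases "length I - 1 < wt (enum_idx k)") (auto simp: scaled_def power_0_left)

text \<open>The leading parts of the brackets must still span. If x is orthogonal to all of them,
  its components b of a given weight j define a functional L on the frame coefficients. L kills the
  brackets of order j by assumption and the shorter ones by their weight, hence all of D_j;
  evaluating it at Z_a with a of weight j gives b a = 0.\<close>

lemma det_E_0_pos:
  assumes q: "q \<in> V"
  shows "det (E 0 q) > 0"
  unfolding E_def
proof (rule det_cometric_pos[OF finite_bracket_words])
  fix x assume x: "\<And>I. I \<in> bracket_words N0 r \<Longrightarrow> scaled 0 q I \<bullet> x = 0"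
  obtain b where b: "x = (\<chi> k. b (enum_idx k))" by (rule exists_enum_coefficients)
  have "b a = 0" if a: "a < CARD('n)" for a
  proof -
    define j where "j = wt a"
    define L where "L = (\<lambda>v. \<Sum>e | e < CARD('n) \<and> wt e = j. b e * fcoef Z q v e)"
    have lin: "linear L"
      unfolding L_def
    proof (rule linear_compose_sum, rule ballI)
      fix e assume "e \<in> {e. e < CARD('n) \<and> wt e = j}"
      then have "linear (\<lambda>w. fcoef Z q w e)" using fcoef_linear[OF frame_Z[OF q]] by auto
      from linear_compose[OF this, of "(*) (b e)"] show "linear (\<lambda>v. b e * fcoef Z q v e)"
        by (simp add: o_def)
    qed
    have "L (xf X c I q) = 0" if I: "I \<noteq> []" "length I \<le> j + 1" "set I \<subseteq> {..<N0}" for I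
    proof -
      have jr: "j \<le> r" unfolding j_def by (rule wt_le) (use a full in simp)
      then have inL: "I \<in> bracket_words N0 r" using I by (auto simp: bracket_words_def)
      show ?thesis
      proof (cases "length I - 1 < j")
        case True
        then show ?thesis
          unfolding L_def by (intro sum.neutral) (use fcoef_xf_eq_0[OF q inL] in auto)
      next
        case False
        then have len: "length I - 1 = j" using I(2) by simp
        have "0 = (\<Sum>k\<in>UNIV. scaled 0 q I $ k * x $ k)"
          using x[OF inL] by (simp add: inner_vec_def)
        also have "\<dots> = (\<Sum>k\<in>(UNIV::'n set). (\<lambda>e. (if wt e = j then b e * fcoef Z q (xf X c I q) e else 0)) (enum_idx k))"
          by (intro sum.cong refl) (auto simp: scaled_0[OF q inL] len[simplified] b)
        also have "\<dots> = (\<Sum>e<CARD('n). if wt e = j then b e * fcoef Z q (xf X c I q) e else 0)"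
          by (rule sum_enum_idx)
        also have "\<dots> = L (xf X c I q)"
          unfolding L_def by (rule sum.mono_neutral_cong_right) auto
        finally show ?thesis by simp
      qed
    qed
    then have "L v = 0" if "v \<in> D j q" for v
      using linear_eq_0_on_span[OF lin _ that[unfolded Dc_def]] by blast
    then have "L (Z a q) = 0" using Z_in_D[OF q less_nn_wt[OF a]] by (simp add: j_def)
    moreover have "L (Z a q) = (\<Sum>e | e < CARD('n) \<and> wt e = j. if e = a then b a else 0)"
      unfolding L_def by (intro sum.cong refl) (auto simp: fcoef_frame[OF frame_Z[OF q] _ a])
    moreover have "\<dots> = b a" using a by (simp add: j_def)
    ultimately show "b a = 0" by simp
  qed
  then show "x = 0" by (simp add: b vec_eq_iff enum_idx_less)
qed

lemma continuous_on_det_E: "continuous_on (UNIV \<times> V) (\<lambda>(h, q). det (E h q))"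
proof -
  have f: "continuous_on V (\<lambda>q. fcoef Z q (xf X c I q) (enum_idx k))" if "I \<in> bracket_words N0 r" for I and k :: 'n
    by (intro smooth_on_continuous smooth_on_fcoef open_V smooth_Z frame_Z smooth_xf enum_idx_less)
       (use that in \<open>auto simp: bracket_words_def\<close>)
  have "continuous_on (UNIV \<times> V) (\<lambda>x. fcoef Z (snd x) (xf X c I (snd x)) (enum_idx k))" if "I \<in> bracket_words N0 r" for I and k :: 'n
    by (rule continuous_on_compose2[OF f[OF that] continuous_on_snd[OF continuous_on_id]]) auto
  then have "continuous_on (UNIV \<times> V) (\<lambda>x. det (E (fst x) (snd x)))"
    unfolding det_def E_def cometric_def scaled_def by (auto intro!: continuous_intros)
  then show ?thesis by (simp add: case_prod_unfold)
qed

text \<open>A word contributes to entry (a, b) only if its order equals both weights, whence the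
  block structure. Block 0 is formed by the scalar products of the columns of \<open>A\<close>, so
  it is the identity; the other blocks turn into sums over words in Z by
  \<open>block_sum_words\<close>.\<close>

lemma det_E_0:
  assumes q: "q \<in> V"
  shows "det (E 0 q) = (\<Prod>j\<in>{1..r}. detn (nn j - nprv j) (popp_matrix q j))"
proof -
  define M where "M = (\<lambda>a b. \<Sum>I\<in>bracket_words N0 r. (if length I - 1 = wt a then fcoef Z q (xf X c I q) a else 0) *
     (if length I - 1 = wt b then fcoef Z q (xf X c I q) b else 0))"
  have "E 0 q = (\<chi> k l. M (enum_idx k) (enum_idx l))"
    by (simp add: vec_eq_iff E_def cometric_def M_def scaled_0[OF q])
  then have "det (E 0 q) = detn CARD('n) M" by (simp only: det_enum_idx)
  also have "\<dots> = detn (nn 0) M * (\<Prod>j\<in>{1..r}. detn (nn j - nn (j - 1)) (\<lambda>k l. M (nn (j - 1) + k) (nn (j - 1) + l)))"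
    unfolding full[symmetric]
  proof (rule detn_block_diagonal)
    show "mono nn" using nn_mono[OF q] by (simp add: monoI)
    fix i a b assume i: "i < r" "a < nn i" "nn i \<le> b" "b < nn (Suc i)"
    then have "wt a \<noteq> wt b" using wt_le[OF i(2)] wt_gt[OF q i(3) less_nn[OF q i(4)]] by simp
    then show "M a b = 0" unfolding M_def by (intro sum.neutral) auto
  qed
  also have "detn (nn 0) M = 1"
  proof -
    have "detn (nn 0) M = det_on {..<nn 0} (\<lambda>i j. if i = j then 1 else 0)"
      unfolding detn_eq_det_on
    proof (rule det_on_cong)
      fix a b assume ab: "a \<in> {..<nn 0}" "b \<in> {..<nn 0}"
      then have w: "wt a = 0" "wt b = 0" using wt_le[of a 0] wt_le[of b 0] by auto
      have "M a b = (\<Sum>I\<in>words N0 (Suc 0). fcoef Z q (xf X c I q) a * fcoef Z q (xf X c I q) b)"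
        unfolding M_def w by (rule sum.mono_neutral_cong_right[OF finite_bracket_words])
          (auto simp: bracket_words_def words_def le_Suc_eq length_Suc_conv)
      also have "\<dots> = (\<Sum>j<N0. A q j a * A q j b)"
        by (simp add: sum_words_Suc words_0 A_def)
      finally show "M a b = (if a = b then 1 else 0)" using A_orthonormal[OF q] ab by simp
    qed
    then show ?thesis by (simp add: det_on_identity)
  qed
  also have "(\<Prod>j\<in>{1..r}. detn (nn j - nn (j - 1)) (\<lambda>k l. M (nn (j - 1) + k) (nn (j - 1) + l)))
      = (\<Prod>j\<in>{1..r}. detn (nn j - nprv j) (popp_matrix q j))"
  proof (rule prod.cong[OF refl])
    fix j assume j: "j \<in> {1..r}"
    then have np: "nprv j = nn (j - 1)" by (simp add: nprv_def)
    show "detn (nn j - nn (j - 1)) (\<lambda>k l. M (nn (j - 1) + k) (nn (j - 1) + l)) = detn (nn j - nprv j) (popp_matrix q j)"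
      unfolding detn_eq_det_on np
    proof (rule det_on_cong)
      fix k l assume kl: "k \<in> {..<nn j - nn (j - 1)}" "l \<in> {..<nn j - nn (j - 1)}"
      let ?a = "nprv j + k" and ?b = "nprv j + l"
      have ab: "nprv j \<le> ?a" "?a < nn j" "nprv j \<le> ?b" "?b < nn j" using kl np by auto
      have w: "wt ?a = j" "wt ?b = j" using wt_block[OF q] ab by auto
      \<comment> \<open>Only words of length j + 1 survive, and the bound r + 1 on the length admits
        all of them because j is at most r.\<close>
      have "M ?a ?b = (\<Sum>I\<in>words N0 (Suc j). fcoef Z q (xf X c I q) ?a * fcoef Z q (xf X c I q) ?b)"
        unfolding M_def w by (rule sum.mono_neutral_cong_right[OF finite_bracket_words])
          (use j in \<open>auto simp: bracket_words_def words_def\<close>)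
      also have "\<dots> = popp_matrix q j k l"
        unfolding popp_matrix_def by (rule block_sum_words[OF q]) (use ab less_nn[OF q] in auto)
      finally show "M (nn (j - 1) + k) (nn (j - 1) + l) = popp_matrix q j k l" by (simp add: np)
    qed
  qed
  finally show ?thesis by simp
qed

text \<open>The weight i belongs to nn i - nn (i - 1) frame members, and adding CARD('n) raises
  every weight by one. This is the Hausdorff dimension, so the exponent of h in the density is Q -
  d.\<close>

lemma sum_wt:
  assumes q: "q \<in> V"
  shows "(\<Sum>a<CARD('n). wt a) + CARD('n) = (\<Sum>i\<le>r. (i + 1) * (nn i - nprv i))"
proof -
  have "(\<Sum>a<nn m. wt a + 1) = (\<Sum>i\<le>m. (i + 1) * (nn i - nprv i))" for m
  proof (induction m)
    case 0
    have "(\<Sum>a<nn 0. wt a + 1) = (\<Sum>a<nn 0. 1)"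
      by (rule sum.cong) (use wt_le[of _ 0] in auto)
    then show ?case by (simp add: nprv_def)
  next
    case (Suc m)
    have "{..<nn (Suc m)} = {..<nn m} \<union> {nn m..<nn (Suc m)}" using nn_mono[OF q, of m "Suc m"] by auto
    then have "(\<Sum>a<nn (Suc m). wt a + 1) = (\<Sum>a<nn m. wt a + 1) + (\<Sum>a\<in>{nn m..<nn (Suc m)}. wt a + 1)"
      by (simp add: sum.union_disjoint ivl_disj_int_one(2) del: sum.lessThan_Suc)
    also have "(\<Sum>a\<in>{nn m..<nn (Suc m)}. wt a + 1) = (\<Sum>a\<in>{nn m..<nn (Suc m)}. Suc m + 1)"
      by (rule sum.cong) (use wt_block[OF q, of "Suc m"] in \<open>auto simp: nprv_def\<close>)
    finally show ?case using Suc by (simp add: nprv_def mult.commute)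
  qed
  from this[of r] show ?thesis by (simp add: full sum_Suc)
qed

end

section \<open>Existence of adapted frames\<close>

text \<open>A smoothly varying inner product. Its smoothness is required on pairs of smooth fields,
  the form in which Gram-Schmidt uses it.\<close>

locale smooth_inner =
  fixes U :: "(real^'n) set" and \<beta> :: "real^'n \<Rightarrow> real^'n \<Rightarrow> real^'n \<Rightarrow> real"
  assumes open_U: "open U"
    and linear_left: "q \<in> U \<Longrightarrow> linear (\<lambda>v. \<beta> q v w)"
    and sym: "q \<in> U \<Longrightarrow> \<beta> q v w = \<beta> q w v"
    and pos: "q \<in> U \<Longrightarrow> v \<noteq> 0 \<Longrightarrow> \<beta> q v v > 0"
    and smooth: "smooth_on U f \<Longrightarrow> smooth_on U g \<Longrightarrow> smooth_on U (\<lambda>q. \<beta> q (f q) (g q))"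
begin

lemma Gram_Schmidt_step:
  fixes Y Z :: "nat \<Rightarrow> real^'n \<Rightarrow> real^'n"
  assumes smY: "smooth_on U (Y m)" and smZ: "\<And>a. a < m \<Longrightarrow> smooth_on U (Z a)"
    and notin: "\<And>q. q \<in> U \<Longrightarrow> Y m q \<notin> span ((\<lambda>a. Y a q) ` {..<m})"
    and orth: "\<And>q a b. q \<in> U \<Longrightarrow> a < m \<Longrightarrow> b < m \<Longrightarrow> \<beta> q (Z a q) (Z b q) = (if a = b then 1 else 0)"
    and span: "\<And>q. q \<in> U \<Longrightarrow> span ((\<lambda>a. Z a q) ` {..<m}) = span ((\<lambda>a. Y a q) ` {..<m})"
  obtains z where "smooth_on U z"
    "\<And>q a. q \<in> U \<Longrightarrow> a < m \<Longrightarrow> \<beta> q (z q) (Z a q) = 0" "\<And>q. q \<in> U \<Longrightarrow> \<beta> q (z q) (z q) = 1"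
    "\<And>q. q \<in> U \<Longrightarrow> span (insert (z q) ((\<lambda>a. Z a q) ` {..<m})) = span (insert (Y m q) ((\<lambda>a. Y a q) ` {..<m}))"
proof -
  define C where "C = (\<lambda>q. \<Sum>a<m. \<beta> q (Y m q) (Z a q) *\<^sub>R Z a q)"
  define R where "R = (\<lambda>q. Y m q - C q)"
  define N where "N = (\<lambda>q. \<beta> q (R q) (R q))"
  define z where "z = (\<lambda>q. N q powr (-1/2) *\<^sub>R R q)"
  have Csp: "C q \<in> span ((\<lambda>a. Z a q) ` {..<m})" for q
    unfolding C_def by (intro span_sum span_scale span_base) auto
  have R0: "R q \<noteq> 0" if "q \<in> U" for q
  proof
    assume "R q = 0"
    then have "Y m q = C q" by (simp add: R_def)
    then show False using notin[OF that] Csp[of q] span[OF that] by simp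
  qed
  have N: "N q > 0" if "q \<in> U" for q unfolding N_def by (rule pos[OF that R0[OF that]])
  have smC: "smooth_on U C"
    unfolding C_def by (intro smooth_on_sum smooth_on_scaleR open_U smooth smY) (auto intro: smZ)
  have smR: "smooth_on U R" unfolding R_def by (intro smooth_on_diff open_U smY smC)
  have smN: "smooth_on U N" unfolding N_def by (intro smooth smR)
  show ?thesis
  proof
    show "smooth_on U z" unfolding z_def by (intro smooth_on_scaleR smooth_on_powr open_U smR smN N)
    fix q assume q: "q \<in> U"
    have bR: "\<beta> q (R q) (Z a q) = 0" if a: "a < m" for a
    proof -
      have "\<beta> q (C q) (Z a q) = (\<Sum>b<m. \<beta> q (Y m q) (Z b q) * \<beta> q (Z b q) (Z a q))"
        unfolding C_def by (simp add: linear_sum[OF linear_left[OF q]] linear_scale[OF linear_left[OF q]])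
      also have "\<dots> = \<beta> q (Y m q) (Z a q)"
        using a orth[OF q _ a] by (simp add: if_distrib[of "\<lambda>t. _ * t"] cong: if_cong)
      finally show ?thesis unfolding R_def using linear_diff[OF linear_left[OF q]] by simp
    qed
    show "\<beta> q (z q) (Z a q) = 0" if "a < m" for a
      using bR[OF that] linear_scale[OF linear_left[OF q]] by (simp add: z_def)
    have "\<beta> q (z q) (z q) = N q powr (-1/2) * (N q powr (-1/2) * N q)"
      using linear_scale[OF linear_left[OF q]] sym[OF q] by (simp add: z_def N_def)
    also have "\<dots> = N q powr (-1/2 + -1/2) * N q" by (simp only: powr_add mult.assoc)
    also have "\<dots> = 1" using N[OF q] by (simp add: powr_minus)
    finally show "\<beta> q (z q) (z q) = 1" .
    let ?Z = "(\<lambda>a. Z a q) ` {..<m}" and ?Y = "(\<lambda>a. Y a q) ` {..<m}"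
    have ZY: "span ?Z \<subseteq> span (insert (Y m q) ?Y)" "span ?Y \<subseteq> span (insert (z q) ?Z)"
      using span[OF q] span_mono[of ?Z "insert (z q) ?Z"] span_mono[of ?Y "insert (Y m q) ?Y"] by auto
    show "span (insert (z q) ?Z) = span (insert (Y m q) ?Y)"
    proof (rule antisym)
      have "R q \<in> span (insert (Y m q) ?Y)"
        unfolding R_def using Csp[of q] ZY(1) by (intro span_diff span_base[of "Y m q"]) auto
      then have "z q \<in> span (insert (Y m q) ?Y)" unfolding z_def by (rule span_scale)
      then show "span (insert (z q) ?Z) \<subseteq> span (insert (Y m q) ?Y)"
        using ZY(1) span_superset[of ?Z] by (intro span_minimal subspace_span) auto
      have "R q = (1 / N q powr (-1/2)) *\<^sub>R z q" using N[OF q] by (simp add: z_def)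
      then have "R q \<in> span (insert (z q) ?Z)" by (metis insertI1 span_base span_scale)
      moreover have "C q \<in> span (insert (z q) ?Z)" using Csp[of q] span_mono[of ?Z "insert (z q) ?Z"] by auto
      ultimately have "R q + C q \<in> span (insert (z q) ?Z)" by (rule span_add)
      then have "Y m q \<in> span (insert (z q) ?Z)" by (simp add: R_def)
      then show "span (insert (Y m q) ?Y) \<subseteq> span (insert (z q) ?Z)"
        using ZY(2) span_superset[of ?Y] by (intro span_minimal subspace_span) auto
    qed
  qed
qed

text \<open>The spans of all initial segments are preserved, so a frame adapted to the flag remains
  adapted after orthonormalization.\<close>

lemma Gram_Schmidt:
  fixes Y :: "nat \<Rightarrow> real^'n \<Rightarrow> real^'n"
  assumes smY: "\<And>a. a < n \<Longrightarrow> smooth_on U (Y a)"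
    and indep: "\<And>q m. q \<in> U \<Longrightarrow> m < n \<Longrightarrow> Y m q \<notin> span ((\<lambda>a. Y a q) ` {..<m})"
  shows "\<exists>Z. (\<forall>a<n. smooth_on U (Z a)) \<and>
    (\<forall>q\<in>U. \<forall>a<n. \<forall>b<n. \<beta> q (Z a q) (Z b q) = (if a = b then 1 else 0)) \<and>
    (\<forall>q\<in>U. \<forall>m\<le>n. span ((\<lambda>a. Z a q) ` {..<m}) = span ((\<lambda>a. Y a q) ` {..<m}))"
  using assms
proof (induction n)
  case (Suc n)
  have "\<exists>Z. (\<forall>a<n. smooth_on U (Z a)) \<and>
    (\<forall>q\<in>U. \<forall>a<n. \<forall>b<n. \<beta> q (Z a q) (Z b q) = (if a = b then 1 else 0)) \<and>
    (\<forall>q\<in>U. \<forall>m\<le>n. span ((\<lambda>a. Z a q) ` {..<m}) = span ((\<lambda>a. Y a q) ` {..<m}))"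
    by (rule Suc.IH) (use Suc.prems in auto)
  then obtain Z where Z: "\<And>a. a < n \<Longrightarrow> smooth_on U (Z a)"
    "\<And>q a b. q \<in> U \<Longrightarrow> a < n \<Longrightarrow> b < n \<Longrightarrow> \<beta> q (Z a q) (Z b q) = (if a = b then 1 else 0)"
    "\<And>q m. q \<in> U \<Longrightarrow> m \<le> n \<Longrightarrow> span ((\<lambda>a. Z a q) ` {..<m}) = span ((\<lambda>a. Y a q) ` {..<m})"
    by (elim exE conjE) blast
  obtain z where z: "smooth_on U z"
    "\<And>q a. q \<in> U \<Longrightarrow> a < n \<Longrightarrow> \<beta> q (z q) (Z a q) = 0" "\<And>q. q \<in> U \<Longrightarrow> \<beta> q (z q) (z q) = 1"
    "\<And>q. q \<in> U \<Longrightarrow> span (insert (z q) ((\<lambda>a. Z a q) ` {..<n})) = span (insert (Y n q) ((\<lambda>a. Y a q) ` {..<n}))"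
    by (rule Gram_Schmidt_step[of Y n Z]) (use Suc.prems Z in auto)
  define Z' where "Z' = Z(n := z)"
  have im: "(\<lambda>a. Z' a q) ` {..<m} = (\<lambda>a. Z a q) ` {..<m}" if "m \<le> n" for m q
    using that by (auto simp: Z'_def)
  show ?case
  proof (intro exI[of _ Z'] conjI allI ballI impI)
    fix a assume "a < Suc n"
    then show "smooth_on U (Z' a)" using Z(1) z(1) by (auto simp: Z'_def less_Suc_eq)
  next
    fix q a b assume "q \<in> U" "a < Suc n" "b < Suc n"
    then show "\<beta> q (Z' a q) (Z' b q) = (if a = b then 1 else 0)"
      using Z(2) z(2,3) sym[OF \<open>q \<in> U\<close>, of "Z a q" "z q"] by (auto simp: Z'_def less_Suc_eq)
  next
    fix q m assume q: "q \<in> U" and m: "m \<le> Suc n"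
    show "span ((\<lambda>a. Z' a q) ` {..<m}) = span ((\<lambda>a. Y a q) ` {..<m})"
    proof (cases "m = Suc n")
      case True
      then show ?thesis using z(4)[OF q] im[of n q] by (simp add: lessThan_Suc) (simp add: Z'_def)
    next
      case False
      then have "m \<le> n" using m by simp
      then show ?thesis using Z(3)[OF q] im by simp
    qed
  qed
qed simp

lemma orthonormal_frame_at:
  fixes Z :: "nat \<Rightarrow> real^'n \<Rightarrow> real^'n"
  assumes q: "q \<in> U" and "\<forall>a<CARD('n). \<forall>b<CARD('n). \<beta> q (Z a q) (Z b q) = (if a = b then 1 else 0)"
  shows "frame_at Z q"
proof -
  have "b a = 0" if s: "(\<Sum>a<CARD('n). b a *\<^sub>R Z a q) = 0" and a: "a \<in> {..<CARD('n)}" for b a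
  proof -
    have "0 = \<beta> q (\<Sum>a<CARD('n). b a *\<^sub>R Z a q) (Z a q)"
      unfolding s using linear_0[OF linear_left[OF q]] by simp
    also have "\<dots> = (\<Sum>e<CARD('n). b e * \<beta> q (Z e q) (Z a q))"
      by (simp add: linear_sum[OF linear_left[OF q]] linear_scale[OF linear_left[OF q]])
    also have "\<dots> = b a"
      using a assms(2) by (simp add: if_distrib[of "\<lambda>t. _ * t"] cong: if_cong)
    finally show ?thesis by simp
  qed
  then show ?thesis
    unfolding frame_at_def using independent_familyI[of "{..<CARD('n)}" "\<lambda>a. Z a q"] by auto
qed

end

lemma frame_at_not_in_span:
  fixes Y :: "nat \<Rightarrow> real^'n \<Rightarrow> real^'n"
  assumes "frame_at Y q" "m < CARD('n)"
  shows "Y m q \<notin> span ((\<lambda>a. Y a q) ` {..<m})"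
  using fcoef_span_zero[OF assms order_refl, of "Y m q"] fcoef_frame[OF assms assms(2)] by auto

lemma (in chart_fields) chart_fields_subset:
  "open U \<Longrightarrow> U \<subseteq> V \<Longrightarrow> chart_fields X N0 c U nn r"
  by unfold_locales (auto intro: smooth_on_subset[OF open_V _ _ smooth_X] dim_D full)

text \<open>The metric of the orthonormalization is the inverse of the cometric of X_1, ..., X_N0 completed
  by the frame vectors transverse to D_0; on D_0 it restricts to the sub-Riemannian metric.\<close>
lemma (in chart_fields) adapted_fields_exist:
  assumes p: "p \<in> V"
  obtains U Z where "p \<in> U" "U \<subseteq> V" "adapted_fields X N0 c U nn r Z"
proof -
  obtain U L where U: "open U" "p \<in> U" "U \<subseteq> V"
    and L: "\<And>a. a < CARD('n) \<Longrightarrow> L a \<noteq> [] \<and> set (L a) \<subseteq> {..<N0}"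
    and fr': "\<And>q. q \<in> U \<Longrightarrow> frame_at (\<lambda>a. xf X c (L a)) q"
    and sp': "\<And>q i. q \<in> U \<Longrightarrow> span ((\<lambda>a. xf X c (L a) q) ` {..<nn i}) = D i q"
    using flag_frame[OF p] by metis
  define Y where "Y = (\<lambda>a. xf X c (L a))"
  have fr: "frame_at Y q" if "q \<in> U" for q using fr'[OF that] by (simp add: Y_def)
  have sp: "span ((\<lambda>a. Y a q) ` {..<nn i}) = D i q" if "q \<in> U" for q i using sp'[OF that] by (simp add: Y_def)
  have smX: "smooth_on U (X j c)" if "j < N0" for j
    by (rule smooth_on_subset[OF open_V U(1,3) smooth_X[OF that]])
  have smY: "smooth_on U (Y a)" if "a < CARD('n)" for a
    unfolding Y_def by (rule smooth_on_subset[OF open_V U(1,3) smooth_xf]) (use L[OF that] in simp)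
  \<comment> \<open>A disjoint sum of index sets, because the X_j and the transverse members of the
    frame form one family for the cometric.\<close>
  let ?S = "{..<N0} <+> {nn 0..<CARD('n)}"
  define W where "W = (\<lambda>q. case_sum (\<lambda>j. X j c q) (\<lambda>a. Y a q))"
  define G where "G = (\<lambda>q. cometric ?S (W q))"
  \<comment> \<open>The inner product with matrix \<open>G q\<close> inverse, written through
    Cramer's rule to stay smooth in q.\<close>
  define \<beta> where "\<beta> = (\<lambda>q v w. v \<bullet> cramer_vec (G q) w)"
  have finS: "finite ?S" by simp
  have X_D: "X j c q \<in> D 0 q" if "j < N0" for j q using xf_in_D[of "[j]" 0 q] that by simp
  have nondeg: "x = 0" if q: "q \<in> U" and z: "\<And>i. i \<in> ?S \<Longrightarrow> W q i \<bullet> x = 0" for q x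
  proof (rule span_nondegenerate)
    have "Y a q \<in> span (W q ` ?S)" if a: "a < CARD('n)" for a
    proof (cases "a < nn 0")
      case True
      have "Y a q \<in> D 0 q" unfolding sp[OF q, symmetric] by (rule span_base) (use True in auto)
      moreover have "(\<lambda>j. X j c q) ` {..<N0} \<subseteq> W q ` ?S" by (force simp: W_def)
      ultimately show ?thesis unfolding D_0_eq using span_mono by blast
    next
      case False
      then have "Y a q = W q (Inr a)" "Inr a \<in> ?S" using a by (auto simp: W_def)
      then show ?thesis by (metis image_eqI span_base)
    qed
    then have "span ((\<lambda>a. Y a q) ` {..<nn r}) \<subseteq> span (W q ` ?S)"
      unfolding full by (intro span_minimal) auto
    moreover have "span ((\<lambda>a. Y a q) ` {..<nn r}) = UNIV"
      using fcoef_sum[OF fr[OF q]] unfolding full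
      by (intro set_eqI iffI UNIV_I) (metis (no_types, lifting) image_eqI span_base span_scale span_sum)
    ultimately show "x \<in> span (W q ` ?S)" by auto
  qed (use z in auto)
  have detG: "det (G q) \<noteq> 0" if "q \<in> U" for q
    using det_cometric_pos[OF finS, of "W q"] nondeg[OF that] by (auto simp: G_def)
  have inv: "G q *v cramer_vec (G q) w = w" if "q \<in> U" for q w
    using cramer_vec[OF detG[OF that]] by blast
  have Gsym: "(G q *v x) \<bullet> y = x \<bullet> (G q *v y)" for q x y
    by (subst inner_commute) (simp add: G_def inner_cometric mult.commute)
  interpret smooth_inner U \<beta>
  proof (rule smooth_inner.intro)
    show "open U" by fact
    show "linear (\<lambda>v. \<beta> q v w)" for q w
      unfolding \<beta>_def by (rule bounded_linear.linear[OF bounded_linear_inner_left])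
    fix q v w assume q: "q \<in> U"
    show "\<beta> q v w = \<beta> q w v"
    proof -
      have "\<beta> q v w = (G q *v cramer_vec (G q) v) \<bullet> cramer_vec (G q) w" by (simp only: inv[OF q] \<beta>_def)
      also have "\<dots> = cramer_vec (G q) v \<bullet> (G q *v cramer_vec (G q) w)" by (rule Gsym)
      also have "\<dots> = cramer_vec (G q) v \<bullet> w" by (simp only: inv[OF q])
      finally show ?thesis by (simp add: \<beta>_def inner_commute)
    qed
    assume v: "v \<noteq> 0"
    let ?x = "cramer_vec (G q) v"
    have x0: "?x \<noteq> 0" using v inv[OF q, of v] by (metis matrix_vector_mult_0_right)
    then obtain i where i: "i \<in> ?S" "W q i \<bullet> ?x \<noteq> 0" using nondeg[OF q] by blast
    have "\<beta> q v v = ?x \<bullet> (G q *v ?x)" using inv[OF q] by (simp add: \<beta>_def inner_commute)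
    also have "\<dots> = (\<Sum>i\<in>?S. (W q i \<bullet> ?x) * (W q i \<bullet> ?x))" by (simp add: G_def inner_cometric)
    also have "\<dots> > 0" by (rule sum_pos2[OF finS i(1)]) (use i(2) in \<open>auto simp: zero_less_mult_iff\<close>)
    finally show "\<beta> q v v > 0" .
  next
    fix f g :: "real^'n \<Rightarrow> real^'n" assume fg: "smooth_on U f" "smooth_on U g"
    have smW: "smooth_on U (\<lambda>q. W q i)" if "i \<in> ?S" for i
      using that smX smY by (auto simp: W_def)
    have smG: "smooth_on U (\<lambda>q. G q $ i $ j)" for i j
      unfolding G_def cometric_def vec_lambda_beta
      by (intro smooth_on_sum smooth_on_mult smooth_on_vec_nth U(1) smW)
    show "smooth_on U (\<lambda>q. \<beta> q (f q) (g q))"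
      unfolding \<beta>_def by (intro smooth_on_inner U(1) fg smooth_on_cramer_vec smG detG)
  qed
  obtain Z where Z: "\<forall>a<CARD('n). smooth_on U (Z a)"
    "\<forall>q\<in>U. \<forall>a<CARD('n). \<forall>b<CARD('n). \<beta> q (Z a q) (Z b q) = (if a = b then 1 else 0)"
    "\<forall>q\<in>U. \<forall>m\<le>CARD('n). span ((\<lambda>a. Z a q) ` {..<m}) = span ((\<lambda>a. Y a q) ` {..<m})"
    using Gram_Schmidt[of "CARD('n)" Y] smY frame_at_not_in_span[OF fr] by blast
  have sub: "chart_fields X N0 c U nn r" by (rule chart_fields_subset[OF U(1,3)])
  have spZ: "span ((\<lambda>a. Z a q) ` {..<nn i}) = D i q" if "q \<in> U" for q i
    using Z(3) sp[OF that] nn_le[OF p, of i] that by simp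
  have polar: "polar (g0 X N0 c q) v w = \<beta> q v w" if q: "q \<in> U" and vw: "v \<in> D 0 q" "w \<in> D 0 q" for q v w
  proof -
    let ?G0 = "cometric {..<N0} (\<lambda>j. X j c q)"
    have G0: "?G0 *v cramer_vec (G q) v = v" if v: "v \<in> D 0 q" for v
    proof -
      let ?x = "cramer_vec (G q) v"
      have e: "v = ?G0 *v ?x + (\<Sum>a\<in>{nn 0..<CARD('n)}. (Y a q \<bullet> ?x) *\<^sub>R Y a q)"
        using inv[OF q, of v] by (simp add: G_def cometric_mult_vec sum.Plus W_def)
      \<comment> \<open>Both v and the G0-image of x lie in D_0, so comparing the coefficients of
        transverse frame members in the decomposition \<open>e\<close> forces these pairings to
        vanish. Hence the full and the sub-Riemannian cometric agree at x.\<close>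
      have "Y a q \<bullet> ?x = 0" if a: "nn 0 \<le> a" "a < CARD('n)" for a
      proof -
        have lin: "linear (\<lambda>w. fcoef Y q w a)" by (rule fcoef_linear[OF fr[OF q] a(2)])
        have z: "fcoef Y q w a = 0" if "w \<in> D 0 q" for w
          by (rule fcoef_span_zero[OF fr[OF q] a(2,1)]) (use that sp[OF q] in simp)
        have "?G0 *v ?x \<in> D 0 q"
          unfolding cometric_mult_vec D_0_eq by (intro span_sum span_scale span_base) auto
        then have "0 = (\<Sum>b\<in>{nn 0..<CARD('n)}. (Y b q \<bullet> ?x) * fcoef Y q (Y b q) a)"
          using arg_cong[OF e, of "\<lambda>w. fcoef Y q w a"] z[OF v] z
          by (simp add: linear_add[OF lin] linear_sum[OF lin] linear_scale[OF lin])
        also have "\<dots> = (\<Sum>b\<in>{nn 0..<CARD('n)}. if b = a then Y a q \<bullet> ?x else 0)"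
          by (intro sum.cong refl) (auto simp: fcoef_frame[OF fr[OF q] a(2)])
        also have "\<dots> = Y a q \<bullet> ?x" using a by simp
        finally show ?thesis by simp
      qed
      then have "(\<Sum>a\<in>{nn 0..<CARD('n)}. (Y a q \<bullet> ?x) *\<^sub>R Y a q) = 0" by simp
      then show ?thesis using e by simp
    qed
    have "g0 X N0 c q = inf_form {..<N0} (\<lambda>j. X j c q)"
      by (rule ext) (simp add: g0_def inf_form_def)
    then have "polar (g0 X N0 c q) v w = cramer_vec (G q) v \<bullet> w"
      using polar_inf_form[of "{..<N0}" "\<lambda>j. X j c q" "cramer_vec (G q) v" "cramer_vec (G q) w"]
      by (simp add: G0 vw)
    also have "\<dots> = \<beta> q w v" by (simp add: \<beta>_def inner_commute)
    finally show ?thesis using sym[OF q] by simp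
  qed
  have "adapted_fields X N0 c U nn r Z"
  proof (intro adapted_fields.intro sub adapted_fields_axioms.intro)
    show "frame_at Z q" if "q \<in> U" for q
      by (rule orthonormal_frame_at[OF that]) (use Z(2) that in blast)
    fix q a b assume q: "q \<in> U" and ab: "a < nn 0" "b < nn 0"
    have "Z a q \<in> D 0 q" "Z b q \<in> D 0 q"
      unfolding spZ[OF q, symmetric] using ab by (auto intro: span_base)
    then show "polar (g0 X N0 c q) (Z a q) (Z b q) = (if a = b then 1 else 0)"
      using polar[OF q] Z(2) q ab nn_le[OF p, of 0] by simp
  qed (use Z(1) spZ in auto)
  then show ?thesis using that U by blast
qed

section \<open>The limit of the Riemannian densities\<close>

text \<open>Once a function extends continuously to h = 0, convergence is uniform by uniform
  continuity on a compact product.\<close>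

lemma uniform_limit_at_right_0:
  fixes f :: "real \<times> 'b::metric_space \<Rightarrow> 'c::metric_space"
  assumes "compact K" "continuous_on ({0..1} \<times> K) f"
  shows "uniform_limit K (\<lambda>h q. f (h, q)) (\<lambda>q. f (0, q)) (at_right 0)"
proof (rule uniform_limitI)
  fix e :: real assume "e > 0"
  have "uniformly_continuous_on ({0..1} \<times> K) f"
    by (rule compact_uniformly_continuous[OF assms(2)]) (intro compact_Times compact_Icc assms(1))
  then obtain d where d: "d > 0"
    "\<And>x y. x \<in> {0..1} \<times> K \<Longrightarrow> y \<in> {0..1} \<times> K \<Longrightarrow> dist y x < d \<Longrightarrow> dist (f y) (f x) < e"
    unfolding uniformly_continuous_on_def using \<open>e > 0\<close> by metis
  have "\<forall>\<^sub>F h in at_right (0::real). h < min d 1"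
    by (rule order_tendstoD(2)[OF tendsto_ident_at]) (use d(1) in simp)
  moreover have "\<forall>\<^sub>F h in at_right (0::real). h > 0" by (rule eventually_at_right_less)
  ultimately show "\<forall>\<^sub>F h in at_right 0. \<forall>q\<in>K. dist (f (h, q)) (f (0, q)) < e"
  proof eventually_elim
    case (elim h)
    show ?case
      by (intro ballI d(2)) (use elim in \<open>auto simp: dist_Pair_Pair\<close>)
  qed
qed

lemma uniform_limit_compact_local:
  fixes f :: "'i \<Rightarrow> 'a::topological_space \<Rightarrow> 'b::metric_space"
  assumes "compact K" "\<And>x. x \<in> K \<Longrightarrow> \<exists>U. open U \<and> x \<in> U \<and> uniform_limit U f l F"
  shows "uniform_limit K f l F"
proof -
  let ?T = "{U. open U \<and> uniform_limit U f l F}"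
  have "K \<subseteq> \<Union>?T" using assms(2) by blast
  then obtain T where T: "T \<subseteq> ?T" "finite T" "K \<subseteq> \<Union>T"
    using compactE[OF assms(1), of ?T] by blast
  show ?thesis
  proof (rule uniform_limitI)
    fix e :: real assume e: "e > 0"
    have "\<forall>\<^sub>F i in F. \<forall>U\<in>T. \<forall>x\<in>U. dist (f i x) (l x) < e"
      by (rule eventually_ball_finite[OF T(2)]) (use T(1) uniform_limitD[OF _ e] in blast)
    then show "\<forall>\<^sub>F i in F. \<forall>x\<in>K. dist (f i x) (l x) < e"
      by eventually_elim (use T(3) in blast)
  qed
qed

lemma frechet_derivative_matrix:
  fixes f :: "real^'n \<Rightarrow> real^'m"
  shows "f differentiable (at x) \<Longrightarrow> frechet_derivative f (at x) v = matrix (frechet_derivative f (at x)) *v v"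
  using matrix_vector_mul(2)[OF linear_frechet_derivative] by metis

section \<open>Independence of the chart, and assembly of the local limits\<close>

locale sub_riemannian =
  fixes A :: "('a::topological_space, 'n::finite) chart set"
    and X :: "nat \<Rightarrow> ('a, 'n) chart \<Rightarrow> real^'n \<Rightarrow> real^'n"
    and N0 :: nat
    and \<rho> :: "('a, 'n) chart \<Rightarrow> real^'n \<Rightarrow> real"
  assumes atlas: "smooth_atlas A"
    and fields: "\<forall>j<N0. smooth_vf A (X j)"
    and hoerm: "\<forall>m. \<exists>r. ndim A X N0 r m = CARD('n)"
    and rmax: "finite (range (rloc A X N0))"
    and mu: "smooth_pos_density A \<rho>"
begin

abbreviation "r \<equiv> rbold A X N0"

definition J :: "('a, 'n) chart \<Rightarrow> ('a, 'n) chart \<Rightarrow> 'a \<Rightarrow> real^'n^'n" where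
  "J c c' m = matrix (frechet_derivative (tmap c c') (at (snd c m)))"

lemma density_pos: "c \<in> A \<Longrightarrow> m \<in> fst c \<Longrightarrow> \<rho> c (snd c m) > 0"
  using mu unfolding smooth_pos_density_def by blast

lemma density_change:
  assumes "c \<in> A" "c' \<in> A" "m \<in> fst c" "m \<in> fst c'"
  shows "\<rho> c (snd c m) = \<rho> c' (snd c' m) * \<bar>det (J c c' m)\<bar>"
proof -
  have "\<forall>c\<in>A. \<forall>c'\<in>A. \<forall>m\<in>fst c \<inter> fst c'. \<rho> c (snd c m) = \<rho> c' (snd c' m) * \<bar>jac_det c c' m\<bar>"
    using mu unfolding smooth_pos_density_def by blast
  then have "\<rho> c (snd c m) = \<rho> c' (snd c' m) * \<bar>jac_det c c' m\<bar>" using assms by blast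
  then show ?thesis by (simp only: jac_det_def J_def)
qed

text \<open>Positivity of the density in the chart c rules out a vanishing Jacobian in its
  transformation rule.\<close>

lemma det_J: "c \<in> A \<Longrightarrow> c' \<in> A \<Longrightarrow> m \<in> fst c \<Longrightarrow> m \<in> fst c' \<Longrightarrow> det (J c c' m) \<noteq> 0"
  using density_change[of c c' m] density_pos[of c m] by auto

lemma xf_J:
  assumes "c \<in> A" "c' \<in> A" "m \<in> fst c" "m \<in> fst c'" "set I \<subseteq> {..<N0}"
  shows "xf X c' I (snd c' m) = J c c' m *v xf X c I (snd c m)"
proof -
  have "open (snd c ` (fst c \<inter> fst c'))"
    by (rule open_chart_image[OF atlas assms(1)])
       (use smooth_atlasD(1)[OF atlas assms(1)] smooth_atlasD(1)[OF atlas assms(2)] in auto)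
  then have "tmap c c' differentiable at (snd c m)"
    by (rule smooth_on_differentiable[OF _ smooth_tmap[OF atlas assms(1,2)]]) (use assms in auto)
  then show ?thesis
    unfolding xf_change_of_chart[OF atlas fields assms(1,2,5,3,4)] J_def
    by (rule frechet_derivative_matrix)
qed

lemma Dc_J:
  assumes c: "c \<in> A" "c' \<in> A" and m: "m \<in> fst c" "m \<in> fst c'"
  shows "Dc X N0 c' i (snd c' m) = (*v) (J c c' m) ` Dc X N0 c i (snd c m)"
proof -
  let ?I = "{I. I \<noteq> [] \<and> length I \<le> i + 1 \<and> set I \<subseteq> {..<N0}}"
  have "(\<lambda>I. xf X c' I (snd c' m)) ` ?I = (\<lambda>I. J c c' m *v xf X c I (snd c m)) ` ?I"
    by (rule image_cong[OF refl]) (simp add: xf_J[OF c m])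
  then have "{xf X c' I (snd c' m) |I. I \<noteq> [] \<and> length I \<le> i + 1 \<and> set I \<subseteq> {..<N0}} =
    (*v) (J c c' m) ` {xf X c I (snd c m) |I. I \<noteq> [] \<and> length I \<le> i + 1 \<and> set I \<subseteq> {..<N0}}"
    by (simp only: setcompr_eq_image image_image)
  then show ?thesis
    unfolding Dc_def by (simp only: linear_span_image[OF matrix_vector_mul_linear])
qed

text \<open>\<open>ndim\<close> is computed in the chart chosen for m; invertible Jacobians make
  every other chart give the same value.\<close>

lemma dim_Dc:
  assumes c: "c \<in> A" and m: "m \<in> fst c"
  shows "dim (Dc X N0 c i (snd c m)) = ndim A X N0 i m"
proof -
  let ?c = "chart_at A m"
  have c': "?c \<in> A" "m \<in> fst ?c" using chart_at[OF atlas] by auto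
  have "inj ((*v) (J ?c c m))"
    using det_J[OF c'(1) c c'(2) m] by (simp add: invertible_det_nz[symmetric] invertible_left_inverse matrix_left_invertible_injective)
  then have "dim ((*v) (J ?c c m) ` Dc X N0 ?c i (snd ?c m)) = dim (Dc X N0 ?c i (snd ?c m))"
    by (intro dim_image_eq matrix_vector_mul_linear) (auto intro: inj_on_subset)
  then show ?thesis by (simp add: Dc_J[OF c'(1) c c'(2) m] ndim_def)
qed

lemma ndim_mono: "i \<le> j \<Longrightarrow> ndim A X N0 i m \<le> ndim A X N0 j m"
  unfolding ndim_def Dc_def by (intro dim_subset span_mono) auto

lemma ndim_le: "ndim A X N0 i m \<le> CARD('n)"
  unfolding ndim_def using dim_subset_UNIV[of "Dc X N0 (chart_at A m) i (snd (chart_at A m) m)"] by simp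

lemma ndim_r: "ndim A X N0 r m = CARD('n)"
proof -
  have "ndim A X N0 (rloc A X N0 m) m = CARD('n)"
    unfolding rloc_def using hoerm by (auto intro: LeastI_ex)
  moreover have "rloc A X N0 m \<le> r" unfolding rbold_def by (rule Max_ge[OF rmax]) auto
  ultimately show ?thesis using ndim_mono[of "rloc A X N0 m" r m] ndim_le[of r m] by simp
qed

definition G :: "real \<Rightarrow> ('a, 'n) chart \<Rightarrow> real^'n \<Rightarrow> real^'n^'n" where
  "G h c p = cometric (bracket_words N0 r) (\<lambda>I. h ^ (length I - 1) *\<^sub>R xf X c I p)"

text \<open>Substituting the weighted coordinates moves the powers of h from the norm to the
  fields.\<close>

lemma gh_eq_inf_form:
  assumes "h > 0"
  shows "gh A X N0 h c p = inf_form (Cidx A X N0) (\<lambda>I. h ^ (length I - 1) *\<^sub>R xf X c I p)"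
proof (rule ext)
  fix v
  let ?C = "Cidx A X N0"
  have "{(\<Sum>I\<in>?C. (h powr (- real (length I - 1)) * u I)\<^sup>2) | u. (\<Sum>I\<in>?C. u I *\<^sub>R xf X c I p) = v}
      = {(\<Sum>I\<in>?C. (u I)\<^sup>2) | u. (\<Sum>I\<in>?C. u I *\<^sub>R (h ^ (length I - 1) *\<^sub>R xf X c I p)) = v}" (is "?L = ?R")
  proof
    have p: "h powr (- real (length I - 1)) * h ^ (length I - 1) = 1" for I :: "nat list"
      using assms by (simp add: powr_minus powr_realpow)
    show "?L \<subseteq> ?R"
    proof
      fix x assume "x \<in> ?L"
      then obtain u where u: "x = (\<Sum>I\<in>?C. (h powr (- real (length I - 1)) * u I)\<^sup>2)" "(\<Sum>I\<in>?C. u I *\<^sub>R xf X c I p) = v"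
        by blast
      have e: "h powr (- real (length I - 1)) * u I * h ^ (length I - 1) = u I" for I
        using p[of I] by (metis mult.assoc mult.commute mult.right_neutral)
      then show "x \<in> ?R"
        by (intro CollectI exI[of _ "\<lambda>I. h powr (- real (length I - 1)) * u I"] conjI)
          (simp_all only: scaleR_scaleR e u)
    qed
    show "?R \<subseteq> ?L"
    proof
      fix x assume "x \<in> ?R"
      then obtain u where u: "x = (\<Sum>I\<in>?C. (u I)\<^sup>2)" "(\<Sum>I\<in>?C. u I *\<^sub>R (h ^ (length I - 1) *\<^sub>R xf X c I p)) = v"
        by blast
      have e: "h powr (- real (length I - 1)) * (u I * h ^ (length I - 1)) = u I" for I
        using p[of I] by (metis mult.assoc mult.commute mult.right_neutral)
      then show "x \<in> ?L"
        by (intro CollectI exI[of _ "\<lambda>I. u I * h ^ (length I - 1)"] conjI)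
          (simp_all only: e u(1) u(2)[unfolded scaleR_scaleR])
    qed
  qed
  then show "gh A X N0 h c p v = inf_form ?C (\<lambda>I. h ^ (length I - 1) *\<^sub>R xf X c I p) v"
    by (simp add: gh_def inf_form_def)
qed

text \<open>Words left out of \<open>Cidx\<close> have a bracket that vanishes throughout the chart
  and adds nothing to the sum.\<close>

lemma cometric_Cidx:
  assumes "c \<in> A" "m \<in> fst c"
  shows "cometric (Cidx A X N0) (\<lambda>I. h ^ (length I - 1) *\<^sub>R xf X c I (snd c m)) = G h c (snd c m)"
proof -
  have "xf X c I (snd c m) = 0" if "I \<in> bracket_words N0 r - Cidx A X N0" for I
    using that assms unfolding bracket_words_def Cidx_def by blast
  then have z: "\<forall>I\<in>bracket_words N0 r - Cidx A X N0. (h ^ (length I - 1) *\<^sub>R xf X c I (snd c m)) $ k * w I = 0" for k w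
    by simp
  have "Cidx A X N0 \<subseteq> bracket_words N0 r" unfolding bracket_words_def Cidx_def by blast
  then show ?thesis
    unfolding G_def cometric_def vec_eq_iff vec_lambda_beta
    by (intro allI sum.mono_neutral_left[OF finite_bracket_words _ z])
qed

lemma det_G_pos:
  assumes "c \<in> A" "m \<in> fst c" "h > 0"
  shows "det (G h c (snd c m)) > 0"
  unfolding G_def
proof (rule det_cometric_pos[OF finite_bracket_words])
  let ?p = "snd c m"
  fix x assume x: "\<And>I. I \<in> bracket_words N0 r \<Longrightarrow> (h ^ (length I - 1) *\<^sub>R xf X c I ?p) \<bullet> x = 0"
  have "Dc X N0 c r ?p = span ((\<lambda>I. xf X c I ?p) ` bracket_words N0 r)"
    by (simp add: Dc_def bracket_words_def image_Collect)
  moreover have "span (Dc X N0 c r ?p) = UNIV"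
    using dim_Dc[OF assms(1,2), of r] by (simp add: ndim_r dim_eq_full[symmetric])
  ultimately have "x \<in> span ((\<lambda>I. xf X c I ?p) ` bracket_words N0 r)" by (simp add: span_span)
  then show "x = 0"
    by (rule span_nondegenerate) (use x assms(3) in auto)
qed

definition dens :: "real \<Rightarrow> ('a, 'n) chart \<Rightarrow> 'a \<Rightarrow> real" where
  "dens h c m = 1 / (sqrt (det (G h c (snd c m))) * \<rho> c (snd c m))"

text \<open>The square root of the determinant picks up the absolute Jacobian and \<rho> loses it,
  so their product is invariant.\<close>

lemma dens_change_of_chart:
  assumes c: "c \<in> A" "c' \<in> A" and m: "m \<in> fst c" "m \<in> fst c'"
  shows "dens h c' m = dens h c m"
proof -
  have "G h c' (snd c' m) = cometric (bracket_words N0 r) (\<lambda>I. J c c' m *v (h ^ (length I - 1) *\<^sub>R xf X c I (snd c m)))"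
    unfolding G_def
    by (rule cometric_cong) (simp add: xf_J[OF c m] bracket_words_def matrix_vector_mult_scaleR)
  then have "det (G h c' (snd c' m)) = (det (J c c' m))\<^sup>2 * det (G h c (snd c m))"
    by (simp add: cometric_image G_def det_mul det_transpose power2_eq_square)
  then have "sqrt (det (G h c' (snd c' m))) = \<bar>det (J c c' m)\<bar> * sqrt (det (G h c (snd c m)))"
    by (simp add: real_sqrt_mult)
  then show ?thesis
    unfolding dens_def density_change[OF c m] by (simp add: mult_ac)
qed

lemma dvol_ratio_eq_dens:
  assumes "h > 0" "c \<in> A" "m \<in> fst c"
  shows "dvol_ratio A X N0 \<rho> h m = dens h c m"
proof -
  let ?c = "chart_at A m"
  let ?g = "gram (gh A X N0 h ?c (snd ?c m))"
  have c: "?c \<in> A" "m \<in> fst ?c" using chart_at[OF atlas] by auto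
  have "det ?g * det (G h ?c (snd ?c m)) = 1"
    using det_gram_inf_form[of "Cidx A X N0" "\<lambda>I. h ^ (length I - 1) *\<^sub>R xf X ?c I (snd ?c m)"]
      det_G_pos[OF c assms(1)] unfolding gh_eq_inf_form[OF assms(1)] cometric_Cidx[OF c] by simp
  then have "det ?g = 1 / det (G h ?c (snd ?c m))" by (metis mult_eq_0_iff nonzero_eq_divide_eq zero_neq_one)
  then have "dvol_ratio A X N0 \<rho> h m = dens h ?c m"
    by (simp add: dvol_ratio_def Let_def dens_def real_sqrt_divide)
  also have "\<dots> = dens h c m" by (rule dens_change_of_chart[OF assms(2) c(1) assms(3) c(2)])
  finally show ?thesis .
qed

text \<open>\<open>adapted_frame\<close> prescribes the spans on V through the dimensions at m
  alone; as the frame is independent, this already makes the growth vector constant on V.\<close>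

lemma adapted_frame_adapted_fields:
  assumes c: "c \<in> A" and f: "adapted_frame A X N0 c m V Z"
  shows "adapted_fields X N0 c V (\<lambda>i. ndim A X N0 i m) r Z"
proof -
  have f': "open V" "V \<subseteq> snd c ` fst c" "\<And>a. a < CARD('n) \<Longrightarrow> smooth_on V (Z a)"
    "\<And>q. q \<in> V \<Longrightarrow> frame_at Z q"
    "\<And>q i. q \<in> V \<Longrightarrow> span ((\<lambda>a. Z a q) ` {..<ndim A X N0 i m}) = Dc X N0 c i q"
    "\<And>q a b. q \<in> V \<Longrightarrow> a < ndim A X N0 0 m \<Longrightarrow> b < ndim A X N0 0 m \<Longrightarrow>
         polar (g0 X N0 c q) (Z a q) (Z b q) = (if a = b then 1 else 0)"
    using f unfolding adapted_frame_def frame_at_def by blast+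
  show ?thesis
  proof (intro adapted_fields.intro chart_fields.intro adapted_fields_axioms.intro)
    show "smooth_on V (X j c)" if "j < N0" for j
      by (rule smooth_on_subset[OF smooth_atlasD(2)[OF atlas c] f'(1,2)])
         (use fields that c in \<open>auto simp: smooth_vf_def\<close>)
    show "dim (Dc X N0 c i q) = ndim A X N0 i m" if "q \<in> V" for q i
      using card_frame_image(1)[OF f'(4)[OF that] ndim_le] f'(5)[OF that, of i] by (metis dim_span)
    show "ndim A X N0 r m = CARD('n)" by (rule ndim_r)
  qed (use f' in blast)+
qed

lemma adapted_frame_exists:
  assumes m: "m \<notin> Zsing A X N0" and c: "c \<in> A" "m \<in> fst c"
  shows "\<exists>Z V. adapted_frame A X N0 c m V Z"
proof -
  obtain W where W: "open W" "m \<in> W" "\<forall>m'\<in>W. \<forall>i. ndim A X N0 i m' = ndim A X N0 i m"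
    using m unfolding Zsing_def equiregular_def by auto
  define V where "V = snd c ` (W \<inter> fst c)"
  have V: "open V"
    unfolding V_def by (rule open_chart_image[OF atlas c(1)]) (use W(1) smooth_atlasD(1)[OF atlas c(1)] in auto)
  interpret chart_fields X N0 c V "\<lambda>i. ndim A X N0 i m" r
  proof
    show "smooth_on V (X j c)" if "j < N0" for j
      by (rule smooth_on_subset[OF smooth_atlasD(2)[OF atlas c(1)] V])
         (use fields that c in \<open>auto simp: smooth_vf_def V_def\<close>)
    show "dim (Dc X N0 c i q) = ndim A X N0 i m" if q: "q \<in> V" for q i
    proof -
      obtain m' where m': "m' \<in> W" "m' \<in> fst c" "q = snd c m'" using q by (auto simp: V_def)
      then show ?thesis using dim_Dc[OF c(1) m'(2)] W(3) by simp
    qed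
  qed (use V ndim_r in auto)
  have "snd c m \<in> V" using W(2) c(2) by (auto simp: V_def)
  then obtain U Z where U: "snd c m \<in> U" "U \<subseteq> V" "adapted_fields X N0 c U (\<lambda>i. ndim A X N0 i m) r Z"
    by (rule adapted_fields_exist)
  interpret a: adapted_fields X N0 c U "\<lambda>i. ndim A X N0 i m" r Z by (rule U(3))
  have "adapted_frame A X N0 c m U Z"
    unfolding adapted_frame_def
    using a.open_V U(1,2) a.smooth_Z a.frame_Z a.span_Z a.orthonormal_Z
    by (auto simp: frame_at_def V_def)
  then show ?thesis by blast
qed

text \<open>One f, built from the frame Z, describes the rescaled density on the whole of V for h >
  0, while its value at h = 0 is matched with \<open>popp_val\<close> at the base point m
  only.\<close>

lemma local_limit:
  assumes m: "m \<notin> Zsing A X N0" and c: "c \<in> A" "m \<in> fst c" and fr: "adapted_frame A X N0 c m V Z"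
    and Q: "Qdim A X N0 m = Qb"
  shows "\<exists>f. continuous_on ({0..} \<times> V) f \<and>
    (\<forall>m'\<in>fst c. snd c m' \<in> V \<longrightarrow> (\<forall>h>0. h powr (real Qb - real CARD('n)) * dens h c m' = f (h, snd c m'))) \<and>
    f (0, snd c m) = popp_val A X N0 \<rho> c Z m"
proof -
  interpret a: adapted_fields X N0 c V "\<lambda>i. ndim A X N0 i m" r Z
    by (rule adapted_frame_adapted_fields[OF c(1) fr])
  have p: "snd c m \<in> V" and V: "V \<subseteq> snd c ` fst c" using fr by (auto simp: adapted_frame_def)
  \<comment> \<open>The weights of the frame give the factor h ^ w in the root of the determinant,
    which cancels the power of h in front; the remaining expression makes sense at h = 0.\<close>
  define f where "f = (\<lambda>(h, q). 1 / (\<bar>det (frame_matrix Z q)\<bar> * sqrt (det (a.E h q)) * \<rho> c q))"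
  have Epos: "det (a.E h q) > 0" if "h \<ge> 0" "q \<in> V" for h q
    using a.det_E_pos[OF that(2)] a.det_E_0_pos[OF that(2)] that(1) by (cases "h = 0") auto
  have rpos: "\<rho> c q > 0" if "q \<in> V" for q using V that density_pos[OF c(1)] by auto
  have Fnz: "det (frame_matrix Z q) \<noteq> 0" if "q \<in> V" for q
    using a.frame_Z[OF that] by (simp add: frame_at_iff_det)
  have nprev: "nprev A X N0 j m = a.nprv j" for j by (simp add: nprev_def a.nprv_def)
  have W: "real Qb - real CARD('n) = real (\<Sum>a<CARD('n). a.wt a)"
  proof -
    have "Qb = (\<Sum>a<CARD('n). a.wt a) + CARD('n)"
      using a.sum_wt[OF p] Q unfolding Qdim_def nprev by simp
    then show ?thesis by simp
  qed
  have cont: "continuous_on ({0..} \<times> V) f"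
  proof -
    have 1: "continuous_on ({0..} \<times> V) (\<lambda>x. det (a.E (fst x) (snd x)))"
      using a.continuous_on_det_E by (auto simp: case_prod_unfold intro: continuous_on_subset)
    have "continuous_on V (\<lambda>q. det (frame_matrix Z q))"
      by (rule continuous_on_det_frame) (rule smooth_on_continuous[OF a.smooth_Z])
    then have 2: "continuous_on ({0..} \<times> V) (\<lambda>x. det (frame_matrix Z (snd x)))"
      by (rule continuous_on_compose2[OF _ continuous_on_snd[OF continuous_on_id]]) auto
    have "smooth_on (snd c ` fst c) (\<rho> c)" using mu c(1) by (auto simp: smooth_pos_density_def)
    then have "continuous_on V (\<rho> c)" using smooth_on_continuous continuous_on_subset V by blast
    then have 3: "continuous_on ({0..} \<times> V) (\<lambda>x. \<rho> c (snd x))"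
      by (rule continuous_on_compose2[OF _ continuous_on_snd[OF continuous_on_id]]) auto
    have "\<forall>x\<in>{0..} \<times> V. \<bar>det (frame_matrix Z (snd x))\<bar> * sqrt (det (a.E (fst x) (snd x))) * \<rho> c (snd x) \<noteq> 0"
    proof
      fix x :: "real \<times> (real^'n)" assume "x \<in> {0..} \<times> V"
      then have x: "fst x \<ge> 0" "snd x \<in> V" by auto
      show "\<bar>det (frame_matrix Z (snd x))\<bar> * sqrt (det (a.E (fst x) (snd x))) * \<rho> c (snd x) \<noteq> 0"
        using Fnz[OF x(2)] Epos[OF x] rpos[OF x(2)] by simp
    qed
    then show ?thesis
      unfolding f_def case_prod_unfold by (intro continuous_intros 1 2 3)
  qed
  have eq: "h powr (real Qb - real CARD('n)) * dens h c m' = f (h, snd c m')"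
    if m': "m' \<in> fst c" "snd c m' \<in> V" and h: "h > 0" for m' h
  proof -
    let ?w = "\<Sum>a<CARD('n). a.wt a" and ?q = "snd c m'"
    have "G h c ?q = cometric (bracket_words N0 r) (\<lambda>I. h ^ (length I - 1) *\<^sub>R xf X c I ?q)"
      by (simp add: G_def bracket_words_def )
    then have "sqrt (det (G h c ?q)) = \<bar>det (frame_matrix Z ?q)\<bar> * h ^ ?w * sqrt (det (a.E h ?q))"
      using h by (simp only: a.det_scaled_cometric[OF m'(2)]) (simp add: real_sqrt_mult)
    moreover have "h powr (real Qb - real CARD('n)) = h ^ ?w"
      unfolding W using h by (rule powr_realpow)
    ultimately show ?thesis using h by (simp add: dens_def f_def mult_ac)
  qed
  have "f (0, snd c m) = popp_val A X N0 \<rho> c Z m"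
  proof -
    let ?p = "snd c m"
    have B: "Bmat A X N0 m Z ?p j = a.popp_matrix ?p j" for j
      by (intro ext) (simp add: Bmat_def a.popp_matrix_def nprev words_def)
    have "(\<Prod>j\<in>{1..r}. detn (ndim A X N0 j m - nprev A X N0 j m) (Bmat A X N0 m Z ?p j)) = det (a.E 0 ?p)"
      unfolding B nprev by (rule a.det_E_0[OF p, symmetric])
    moreover have "det (a.E 0 ?p) powr (-1/2) = 1 / sqrt (det (a.E 0 ?p))"
      using Epos[of 0 ?p] p powr_minus[of "det (a.E 0 ?p)" "1/2"] by (simp add: powr_half_sqrt inverse_eq_divide)
    moreover have "frame_det Z ?p = det (frame_matrix Z ?p)" by (simp add: frame_det_def frame_matrix_def)
    ultimately show ?thesis by (simp add: popp_val_def Let_def f_def mult_ac)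
  qed
  then show ?thesis using cont eq by blast
qed

text \<open>\<open>local_limit\<close> is used with exactly the chart and the frame that
  \<open>popp_ratio\<close> selects at m, so the limit has the required value there.\<close>

lemma pointwise_limit:
  assumes m: "m \<notin> Zsing A X N0" and Q: "Qdim A X N0 m = Qb"
  shows "((\<lambda>h. h powr (real Qb - real CARD('n)) * dvol_ratio A X N0 \<rho> h m) \<longlongrightarrow> popp_ratio A X N0 \<rho> m) (at_right 0)"
proof -
  let ?c = "chart_at A m"
  have c: "?c \<in> A" "m \<in> fst ?c" using chart_at[OF atlas] by auto
  define Z where "Z = (SOME Z. \<exists>V. adapted_frame A X N0 ?c m V Z)"
  have "\<exists>V. adapted_frame A X N0 ?c m V Z"
    unfolding Z_def using adapted_frame_exists[OF m c] by (rule someI_ex)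
  then obtain V where fr: "adapted_frame A X N0 ?c m V Z" by blast
  then have p: "snd ?c m \<in> V" by (simp add: adapted_frame_def)
  obtain f where f: "continuous_on ({0..} \<times> V) f"
    "\<And>h. h > 0 \<Longrightarrow> h powr (real Qb - real CARD('n)) * dens h ?c m = f (h, snd ?c m)"
    "f (0, snd ?c m) = popp_val A X N0 \<rho> ?c Z m"
    using local_limit[OF m c fr Q] c(2) p by blast
  have "continuous_on {0..} (\<lambda>h. f (h, snd ?c m))"
    by (rule continuous_on_compose2[OF f(1)]) (use p in \<open>auto intro!: continuous_intros\<close>)
  then have "((\<lambda>h. f (h, snd ?c m)) \<longlongrightarrow> f (0, snd ?c m)) (at 0 within {0..})"
    by (simp add: continuous_on_def)
  then have "((\<lambda>h. f (h, snd ?c m)) \<longlongrightarrow> f (0, snd ?c m)) (at_right 0)"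
    by (rule tendsto_within_subset) auto
  moreover have "\<forall>\<^sub>F h in at_right 0. f (h, snd ?c m) = h powr (real Qb - real CARD('n)) * dvol_ratio A X N0 \<rho> h m"
    using eventually_at_right_less[of "0::real"]
    by eventually_elim (use f(2) dvol_ratio_eq_dens[OF _ c] in simp)
  ultimately have "((\<lambda>h. h powr (real Qb - real CARD('n)) * dvol_ratio A X N0 \<rho> h m) \<longlongrightarrow> f (0, snd ?c m)) (at_right 0)"
    using tendsto_cong by fast
  then show ?thesis by (simp add: f(3) popp_ratio_def Let_def Z_def)
qed

lemma locally_uniform_limit:
  assumes m: "m \<notin> Zsing A X N0" and Q: "\<forall>m. m \<notin> Zsing A X N0 \<longrightarrow> Qdim A X N0 m = Qb"
  shows "\<exists>S. open S \<and> m \<in> S \<and>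
    uniform_limit S (\<lambda>h m. h powr (real Qb - real CARD('n)) * dvol_ratio A X N0 \<rho> h m) (popp_ratio A X N0 \<rho>) (at_right 0)"
proof -
  let ?c = "chart_at A m"
  have c: "?c \<in> A" "m \<in> fst ?c" using chart_at[OF atlas] by auto
  obtain Z V where fr: "adapted_frame A X N0 ?c m V Z" using adapted_frame_exists[OF m c] by blast
  interpret a: adapted_fields X N0 ?c V "\<lambda>i. ndim A X N0 i m" r Z
    by (rule adapted_frame_adapted_fields[OF c(1) fr])
  have p: "snd ?c m \<in> V" using fr by (simp add: adapted_frame_def)
  obtain e where e: "e > 0" "cball (snd ?c m) e \<subseteq> V"
    using open_contains_cball[of V] a.open_V p by blast
  define S where "S = {m' \<in> fst ?c. snd ?c m' \<in> ball (snd ?c m) e}"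
  have S: "open S" "m \<in> S"
    unfolding S_def using open_chart_vimage[OF atlas c(1) open_ball] c(2) e(1) by auto
  have SV: "m' \<in> fst ?c" "snd ?c m' \<in> cball (snd ?c m) e" "snd ?c m' \<in> V" if "m' \<in> S" for m'
    using that e(2) by (auto simp: S_def)
  \<comment> \<open>Nearby points are equiregular too, which makes the assumption on the Hausdorff
    dimension and \<open>pointwise_limit\<close> available at each of them.\<close>
  have reg: "m' \<notin> Zsing A X N0" if "m' \<in> S" for m'
  proof -
    have n: "ndim A X N0 i m'' = ndim A X N0 i m" if "m'' \<in> S" for m'' i
      using dim_Dc[OF c(1) SV(1)[OF that], of i] a.dim_D[OF SV(3)[OF that], of i] by simp
    have "\<forall>m''\<in>S. \<forall>i. ndim A X N0 i m'' = ndim A X N0 i m'" 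
    proof (intro ballI allI)
      fix m'' i assume "m'' \<in> S"
      then show "ndim A X N0 i m'' = ndim A X N0 i m'" using n n[OF that] by simp
    qed
    then have "equiregular A X N0 m'" unfolding equiregular_def using S(1) that by (intro exI[of _ S] conjI)
    then show ?thesis by (simp add: Zsing_def)
  qed
  have "Qdim A X N0 m = Qb" using Q m by blast
  from local_limit[OF m c fr this] obtain f where f: "continuous_on ({0..} \<times> V) f"
    "\<forall>m'\<in>fst ?c. snd ?c m' \<in> V \<longrightarrow> (\<forall>h>0. h powr (real Qb - real CARD('n)) * dens h ?c m' = f (h, snd ?c m'))"
    by (elim exE conjE)
  let ?F = "\<lambda>h m. h powr (real Qb - real CARD('n)) * dvol_ratio A X N0 \<rho> h m"
  have F: "?F h m' = f (h, snd ?c m')" if "h > 0" "m' \<in> S" for h m'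
    using f(2) SV(1,3)[OF that(2)] that(1) by (simp add: dvol_ratio_eq_dens[OF that(1) c(1) SV(1)[OF that(2)]])
  have "uniform_limit (cball (snd ?c m) e) (\<lambda>h q. f (h, q)) (\<lambda>q. f (0, q)) (at_right 0)"
    by (rule uniform_limit_at_right_0[OF compact_cball continuous_on_subset[OF f(1)]]) (use e(2) in auto)
  then have "uniform_limit S (\<lambda>h m'. f (h, snd ?c m')) (\<lambda>m'. f (0, snd ?c m')) (at_right 0)"
    by (rule uniform_limit_compose') (use SV(2) in auto)
  moreover have "\<forall>\<^sub>F h in at_right 0. \<forall>m'\<in>S. f (h, snd ?c m') = ?F h m'"
    using eventually_at_right_less[of "0::real"] by eventually_elim (use F in simp)
  ultimately have u: "uniform_limit S ?F (\<lambda>m'. f (0, snd ?c m')) (at_right 0)"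
    using uniform_limit_cong[of S "\<lambda>h m'. f (h, snd ?c m')" ?F "at_right 0" "\<lambda>m'. f (0, snd ?c m')", OF _ refl]
    by blast
  \<comment> \<open>The frame fixed around m and the one selected at m' are not compared: both
    describe the limit of the same densities.\<close>
  have "f (0, snd ?c m') = popp_ratio A X N0 \<rho> m'" if m': "m' \<in> S" for m'
  proof -
    have "Qdim A X N0 m' = Qb" using Q reg[OF m'] by blast
    then show ?thesis
      by (rule tendsto_unique[OF trivial_limit_at_right_real tendsto_uniform_limitI[OF u m'] pointwise_limit[OF reg[OF m']]])
  qed
  then have "uniform_limit S ?F (popp_ratio A X N0 \<rho>) (at_right 0)"
    using uniform_limit_cong'[of S ?F ?F "\<lambda>m'. f (0, snd ?c m')" "popp_ratio A X N0 \<rho>" "at_right 0", OF refl] u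
    by blast
  then show ?thesis using S by blast
qed

end

theorem theorem1p1:
  fixes A :: "('a::{t2_space, second_countable_topology}, 'n::finite) chart set"
    and X :: "nat \<Rightarrow> ('a, 'n) chart \<Rightarrow> real^'n \<Rightarrow> real^'n"
    and N0 :: nat
    and \<rho> :: "('a, 'n) chart \<Rightarrow> real^'n \<Rightarrow> real"
    and Qb :: nat
  assumes atlas: "smooth_atlas A"
    and conn: "connected (UNIV :: 'a set)"
    and orient: "orientable A"
    and fields: "\<forall>j<N0. smooth_vf A (X j)"
    and hoerm: "\<forall>m. \<exists>r. ndim A X N0 r m = CARD('n)"
    and rmax: "finite (range (rloc A X N0))"
    and Qconst: "\<forall>m. m \<notin> Zsing A X N0 \<longrightarrow> Qdim A X N0 m = Qb"
    and mu: "smooth_pos_density A \<rho>"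
  shows "\<forall>K. compact K \<and> K \<subseteq> - Zsing A X N0 \<longrightarrow>
           uniform_limit K (\<lambda>h m. h powr (real Qb - real CARD('n)) * dvol_ratio A X N0 \<rho> h m)
             (popp_ratio A X N0 \<rho>) (at_right 0)"
proof (intro allI impI)
  fix K assume K: "compact K \<and> K \<subseteq> - Zsing A X N0"
  interpret sub_riemannian A X N0 \<rho> by unfold_locales fact+
  show "uniform_limit K (\<lambda>h m. h powr (real Qb - real CARD('n)) * dvol_ratio A X N0 \<rho> h m)
             (popp_ratio A X N0 \<rho>) (at_right 0)"
    by (rule uniform_limit_compact_local) (use K locally_uniform_limit[OF _ Qconst] in auto)
qed

end
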